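(* Let $r\approx 0.5332964167$ be the unique root in $(0,1)$ of $8r^3+3r^2-2r-1=0$. Up to isometries of the plane, the compact packings of the plane using discs of radius $1$ and $r$ are exactly the packings belonging to Class I or Class II below. Moreover, up to isometry there is exactly one packing that belongs to both classes. Class I (layers of large discs and layers of small discs, with no two adjacent layers of small discs). Put $h_0=\sqrt3$ and $h_1=1+r+\sqrt{(1+r)^2-1}$, and choose a sequence $(\delta_k)_{k\in\mathbb{Z}}\in\{0,1\}^{\mathbb{Z}}$ that is not identically $0$. Let $y_0=0$ and $y_{k+1}=y_k+h_{\delta_k}$. The discs of radius $1$ are centred at the points $(2j+k,\,y_k)$, $j,k\in\mathbb{Z}$. For each $k$ with $\delta_k=1$ there is a layer of discs of radius $r$ centred at the points $(2j+k,\,y_k+1+r)$ and $(2j+k+1,\,y_k+\sqrt{(1+r)^2-1})$, $j\in\mathbb{Z}$. There are no other discs. Class II (layers of large discs alternating with pairs of tangent small discs aligned vertically, each layer having two possible locations relative to the previous one). Put $L=2\sqrt{1+2r}$, $s=1/\sqrt{1+2r}$, $h=\sqrt{4-s^2}$, and choose a sequence $(\epsilon_k)_{k\in\mathbb{Z}}\in\{+1,-1\}^{\mathbb{Z}}$. Let $x_0=0$ and $x_{k+1}=x_k+\epsilon_k s$. The discs of radius $1$ are centred at the points $(x_k+jL,\,kh)$, and the discs of radius $r$ are centred at the points $(x_k+(j+\tfrac12)L,\,kh\pm r)$, $j,k\in\mathbb{Z}$. There are no other discs.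
   Context: A packing of the plane is a collection of closed discs in $\mathbb{R}^2$ with pairwise disjoint interiors. A packing is compact if for every disc $D$ of the packing, the discs of the packing tangent to $D$, listed in cyclic order around $D$ as $D_1,\dots,D_n$ (with $D_{n+1}=D_1$), are such that $D_i$ is tangent to $D_{i+1}$ for $i=1,\dots,n$, and this chain surrounds $D$: the angles, in $(0,\pi)$, at the centre of $D$ in the triangles with vertices the centres of $D,D_i,D_{i+1}$ sum to $2\pi$. A compact packing using discs of radius $1$ and $r$ is a compact packing in which every disc has radius $1$ or $r$ and discs of both radii occur. *)

theory Defs
  imports "HOL-Analysis.Analysis"
begin

text \<open>
  The plane is the type \<open>complex\<close>. A pair \<open>(c, \<rho>)\<close> with \<open>\<rho> > 0\<close> stands for the closed disc
  \<open>cball c \<rho>\<close>, which determines it.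
\<close>

type_synonym disc = "complex \<times> real"

abbreviation centre :: "disc \<Rightarrow> complex" where "centre \<equiv> fst"
abbreviation radius :: "disc \<Rightarrow> real" where "radius \<equiv> snd"

definition region :: "disc \<Rightarrow> complex set" where
  "region D = cball (centre D) (radius D)"

definition packing :: "disc set \<Rightarrow> bool" where
  "packing P \<longleftrightarrow> (\<forall>D\<in>P. radius D > 0) \<and>
     pairwise (\<lambda>D E. interior (region D) \<inter> interior (region E) = {}) P"

text \<open>External tangency, the only kind possible for discs with disjoint interiors.\<close>

definition tangent :: "disc \<Rightarrow> disc \<Rightarrow> bool" where
  "tangent D E \<longleftrightarrow> dist (centre D) (centre E) = radius D + radius E"

text \<open>
  The unoriented angle at \<open>a\<close> of the triangle \<open>a b c\<close>. It lies in the open interval \<open>(0, pi)\<close>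
  when the triangle is non-degenerate, as it is for the centres of three mutually tangent discs.
\<close>

definition angle_at :: "complex \<Rightarrow> complex \<Rightarrow> complex \<Rightarrow> real" where
  "angle_at a b c = arccos ((b - a) \<bullet> (c - a) / (norm (b - a) * norm (c - a)))"

text \<open>
  The list \<open>Ds\<close> enumerates the discs tangent to \<open>D\<close> counterclockwise, beginning at the ray
  from the centre of \<open>D\<close> in the positive real direction; the remaining two conditions are
  invariant under rotating the list, so where it begins is immaterial. Having a list
  also expresses that only finitely many discs touch \<open>D\<close>.
\<close>

definition surrounded_in :: "disc set \<Rightarrow> disc \<Rightarrow> bool" where
  "surrounded_in P D \<longleftrightarrow> (\<exists>Ds.
     set Ds = {E \<in> P. tangent D E} \<and>
     sorted_wrt (\<lambda>E F. Arg2pi (centre E - centre D) < Arg2pi (centre F - centre D)) Ds \<and>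
     (\<forall>i<length Ds. tangent (Ds ! i) (Ds ! (Suc i mod length Ds))) \<and>
     (\<Sum>i<length Ds.
        angle_at (centre D) (centre (Ds ! i)) (centre (Ds ! (Suc i mod length Ds)))) = 2 * pi)"

definition compact_packing :: "disc set \<Rightarrow> bool" where
  "compact_packing P \<longleftrightarrow> packing P \<and> (\<forall>D\<in>P. surrounded_in P D)"

definition compact_packing_using :: "real \<Rightarrow> disc set \<Rightarrow> bool" where
  "compact_packing_using r P \<longleftrightarrow> compact_packing P \<and> radius ` P = {1, r}"

definition plane_isometry :: "(complex \<Rightarrow> complex) \<Rightarrow> bool" where
  "plane_isometry f \<longleftrightarrow> (\<forall>z w. dist (f z) (f w) = dist z w)"

definition congruent_packings :: "disc set \<Rightarrow> disc set \<Rightarrow> bool" where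
  "congruent_packings P Q \<longleftrightarrow>
     (\<exists>f. plane_isometry f \<and> Q = (\<lambda>D. (f (centre D), radius D)) ` P)"

definition layer_height :: "real \<Rightarrow> nat \<Rightarrow> real" where
  "layer_height r d = (if d = 0 then sqrt 3 else 1 + r + sqrt ((1 + r)\<^sup>2 - 1))"

definition class_I :: "real \<Rightarrow> disc set set" where
  "class_I r = {P. \<exists>(\<delta> :: int \<Rightarrow> nat) (y :: int \<Rightarrow> real).
     range \<delta> \<subseteq> {0, 1} \<and> (\<exists>k. \<delta> k \<noteq> 0) \<and>
     y 0 = 0 \<and> (\<forall>k. y (k + 1) = y k + layer_height r (\<delta> k)) \<and>
     P = {(Complex (of_int (2 * j + k)) (y k), 1) | j k. True}
       \<union> {(Complex (of_int (2 * j + k)) (y k + 1 + r), r) | j k. \<delta> k = 1}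
       \<union> {(Complex (of_int (2 * j + k + 1)) (y k + sqrt ((1 + r)\<^sup>2 - 1)), r) | j k. \<delta> k = 1}}"

definition class_II :: "real \<Rightarrow> disc set set" where
  "class_II r = (let L = 2 * sqrt (1 + 2 * r); s = 1 / sqrt (1 + 2 * r); h = sqrt (4 - s\<^sup>2) in
     {P. \<exists>(\<epsilon> :: int \<Rightarrow> real) (x :: int \<Rightarrow> real).
     range \<epsilon> \<subseteq> {1, -1} \<and>
     x 0 = 0 \<and> (\<forall>k. x (k + 1) = x k + \<epsilon> k * s) \<and>
     P = {(Complex (x k + of_int j * L) (of_int k * h), 1) | j k. True}
       \<union> {(Complex (x k + (of_int j + 1 / 2) * L) (of_int k * h + r), r) | j k. True}
       \<union> {(Complex (x k + (of_int j + 1 / 2) * L) (of_int k * h - r), r) | j k. True}})"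

definition belongs_to :: "disc set \<Rightarrow> disc set set \<Rightarrow> bool" where
  "belongs_to P C \<longleftrightarrow> (\<exists>Q\<in>C. congruent_packings Q P)"

lemma radius_root_unique:
  "\<exists>!r::real. 0 < r \<and> r < 1 \<and> 8 * r ^ 3 + 3 * r\<^sup>2 - 2 * r - 1 = 0"
proof -
  let ?f = "\<lambda>r::real. 8 * r ^ 3 + 3 * r\<^sup>2 - 2 * r - 1"
  have "\<exists>x\<ge>0. x \<le> 1 \<and> ?f x = 0"
    by (rule IVT) auto
  then obtain x where x: "0 \<le> x" "x \<le> 1" "?f x = 0" by blast
  have "x \<noteq> 0" "x \<noteq> 1" using x(3) by auto
  hence ex: "0 < x \<and> x < 1 \<and> ?f x = 0" using x by auto
  have less: False if "0 < a" "a < b" "?f a = 0" "?f b = 0" for a b :: real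
  proof -
    have "8 * a\<^sup>2 * b + 8 * a * b\<^sup>2 + 3 * a * b + 1 > 0"
      using that by (intro add_pos_pos mult_pos_pos) auto
    moreover have "b * ?f a - a * ?f b
        = (a - b) * (8 * a\<^sup>2 * b + 8 * a * b\<^sup>2 + 3 * a * b + 1)"
      by (simp add: algebra_simps power2_eq_square power3_eq_cube)
    ultimately show False using that by auto
  qed
  show ?thesis
  proof (rule ex1I[of _ x])
    show "0 < x \<and> x < 1 \<and> ?f x = 0" by (rule ex)
  next
    fix z :: real
    assume "0 < z \<and> z < 1 \<and> ?f z = 0"
    then show "z = x" using ex less[of z x] less[of x z] by (cases z x rule: linorder_cases) auto
  qed
qed

lemma radius_root_approx:
  fixes r :: real
  assumes "0 < r" "8 * r ^ 3 + 3 * r\<^sup>2 - 2 * r - 1 = 0"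
  shows "\<bar>r - 0.5332964167\<bar> < 10 powi (-10)"
proof -
  have mono: "8 * a\<^sup>2 + 3 * a - 2 - 1 / a \<le> 8 * b\<^sup>2 + 3 * b - 2 - 1 / b"
    if "0 < a" "a \<le> b" for a b :: real
  proof -
    have "a\<^sup>2 \<le> b\<^sup>2" "1 / b \<le> 1 / a"
      using that by (auto intro: power_mono simp: frac_le)
    then show ?thesis using that by linarith
  qed
  have z: "8 * r\<^sup>2 + 3 * r - 2 - 1 / r = 0"
    using assms by (simp add: field_simps power2_eq_square power3_eq_cube)
  have "\<not> r \<le> 0.5332964166"
  proof
    assume "r \<le> 0.5332964166"
    from mono[OF assms(1) this] z show False by (simp add: power2_eq_square)
  qed
  moreover have "\<not> 0.5332964168 \<le> r"
  proof
    assume "0.5332964168 \<le> r"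
    from mono[OF _ this] z show False by (simp add: power2_eq_square)
  qed
  ultimately show ?thesis by (simp add: power_int_def abs_less_iff field_simps)
qed

end

theory Submission
  imports Defs
begin

text \<open>
  The angle at a disc between two consecutive neighbours depends only on the three radii. By the
  cubic equation all these angles are combinations of \<open>pi\<close> and the single angle \<open>phi\<close> between
  two small neighbours of a large disc, and the bounds \<open>2 * pi / 9 < phi < pi / 4\<close> leave few
  cyclic words of radii that can surround a disc: LSLLS for a small disc, and LLLLLL, LLLLSSS,
  LSSSLSSS, LSSLSSSS for a large one. If the word LSSLSSSS does not occur, a row of touching
  large discs is found whose surroundings are forced layer by layer as in the first class; if it
  occurs, it forces a layer of the second class, and then all further ones. This exhibits a packing
  of one of the classes inside the given packing. The two are equal because discs are connected
  by tangency: a disc has a neighbour of smaller power distance to any given centre.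
  Conversely, discs that close up around a disc of a packing with angle sum \<open>2 * pi\<close> are all
  of its neighbours, so compactness of the packings of the classes reduces to listing these discs.
  Finally, the second class has no three mutually tangent large discs, and in the first class
  this forces a layer of small discs between any two layers of large ones.
\<close>

section \<open>Wreaths and coronas\<close>

text \<open>The cubic says exactly that two touching large discs subtend the angle
  \<open>2 * phi\<close> at a small disc that touches both. Then
  \<open>sin phi = 1 / (1 + r)\<close>, which makes the mixed angles complements of
  \<open>phi\<close> and \<open>phi / 2\<close>. The bounds on \<open>phi\<close> also act
  geometrically: at each disc the smallest angle exceeds half of the largest. So no disc fits
  between consecutive members of a closed ring, and a chain of tangent discs around a disc is a
  block of consecutive neighbours. Positions are then forced one at a time: two touching discs, a
  third radius and an orientation determine the third centre. The cubic makes all lengths involved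
  rational in \<open>r\<close>, so each placement is a polynomial check. Angle sums alone leave two
  unwanted cases. Six small discs around a small one fall to connectedness only; LSLSSSSS falls to a
  look at a small neighbour. In \<open>surrounded_in\<close> the list starts at a fixed ray and the
  angles are unoriented; \<open>corona\<close> is the oriented, rotation-invariant form in which the
  work is done.\<close>

definition ang :: "real \<Rightarrow> real \<Rightarrow> real \<Rightarrow> real" where
  "ang a b c = arccos (1 - 2 * b * c / ((a + b) * (a + c)))"

text \<open>The last condition is a positive cross product: \<open>E\<close> and \<open>F\<close>
  lie counterclockwise around \<open>D\<close> at an angle in \<open>(0, pi)\<close>. Orientation is
  what makes the third disc unique.\<close>

definition tri :: "disc \<Rightarrow> disc \<Rightarrow> disc \<Rightarrow> bool" where
  "tri D E F \<longleftrightarrow> tangent D E \<and> tangent E F \<and> tangent F D \<and>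
     Im (cnj (centre E - centre D) * (centre F - centre D)) > 0"

text \<open>Pairing the list with its \<open>rotate1\<close> expresses cyclic succession without
  indices, and the angles are functions of radii alone.\<close>

definition corona :: "disc set \<Rightarrow> disc \<Rightarrow> disc list \<Rightarrow> bool" where
  "corona P D Fs \<longleftrightarrow> set Fs = {E \<in> P. tangent D E} \<and> list_all2 (tri D) Fs (rotate1 Fs) \<and>
     sum_list (map2 (\<lambda>E F. ang (radius D) (radius E) (radius F)) Fs (rotate1 Fs)) = 2 * pi"

lemma tangent_sym: "tangent D E \<longleftrightarrow> tangent E D"
  by (simp add: tangent_def dist_commute add.commute)

lemma ang_sym: "ang a b c = ang a c b"
  by (simp add: ang_def mult_ac)

lemma ang_arg:
  fixes a b c :: real
  assumes "a > 0" "b > 0" "c > 0"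
  shows "0 < 2 * b * c / ((a + b) * (a + c))" "2 * b * c / ((a + b) * (a + c)) < 2"
proof -
  have "b * c < (a + b) * (a + c)" using assms
    by (simp add: algebra_simps add_pos_pos)
  then show "2 * b * c / ((a + b) * (a + c)) < 2" using assms
    by (simp add: divide_less_eq)
qed (use assms in auto)

lemma ang_bounds:
  assumes "a > 0" "b > 0" "c > 0"
  shows "0 < ang a b c" "ang a b c < pi"
  using ang_arg[OF assms] arccos_lt_bounded[of "1 - 2 * b * c / ((a + b) * (a + c))"]
  unfolding ang_def by linarith+

lemma cos_ang:
  assumes "a > 0" "b > 0" "c > 0"
  shows "cos (ang a b c) = 1 - 2 * b * c / ((a + b) * (a + c))"
  using ang_arg[OF assms] unfolding ang_def by (intro cos_arccos) linarith+

lemma tri_cycle: "tri D E F \<Longrightarrow> tri E F D"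
  by (auto simp: tri_def tangent_def algebra_simps)

lemma inner_dist:
  fixes a b c :: complex
  shows "(b - a) \<bullet> (c - a) = ((dist a b)\<^sup>2 + (dist a c)\<^sup>2 - (dist b c)\<^sup>2) / 2"
  unfolding dist_norm cmod_power2 inner_complex_def by (simp add: power2_eq_square algebra_simps)

text \<open>Law of cosines for the side lengths \<open>a + b\<close>, \<open>a + c\<close>,
  \<open>b + c\<close>; this is the origin of the formula in \<open>ang\<close>.\<close>

lemma inner_tangent:
  assumes pos: "radius D > 0" "radius E > 0" "radius F > 0"
    and "tangent D E" "tangent E F" "tangent F D"
  shows "(centre E - centre D) \<bullet> (centre F - centre D) =
    (radius D + radius E) * (radius D + radius F) * cos (ang (radius D) (radius E) (radius F))"
proof -
  have "(centre E - centre D) \<bullet> (centre F - centre D) =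
    ((radius D + radius E)\<^sup>2 + (radius D + radius F)\<^sup>2 - (radius E + radius F)\<^sup>2) / 2"
    using assms(4-6) by (simp add: inner_dist tangent_def dist_commute add.commute)
  also have "\<dots> = (radius D + radius E) * (radius D + radius F) - 2 * radius E * radius F"
    by (simp add: power2_eq_square field_simps)
  finally show ?thesis using pos by (simp add: cos_ang right_diff_distrib)
qed

lemma norm_tangent: "tangent D E \<Longrightarrow> norm (centre E - centre D) = radius D + radius E"
  by (simp add: tangent_def dist_norm norm_minus_commute)

lemma angle_at_tangent:
  assumes pos: "radius D > 0" "radius E > 0" "radius F > 0"
    and tan: "tangent D E" "tangent E F" "tangent F D"
  shows "angle_at (centre D) (centre E) (centre F) = ang (radius D) (radius E) (radius F)"
proof -
  have "norm (centre F - centre D) = radius D + radius F"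
    using norm_tangent[of D F] tan(3) by (simp add: tangent_sym)
  then have "angle_at (centre D) (centre E) (centre F) =
      arccos (cos (ang (radius D) (radius E) (radius F)))"
    unfolding angle_at_def inner_tangent[OF assms] norm_tangent[OF tan(1)] using pos by simp
  then show ?thesis using ang_bounds[OF pos] by (simp add: arccos_cos)
qed

text \<open>The product \<open>cnj v * w\<close> has known modulus, and its real part is the inner
  product. Its imaginary part is thus known up to sign, and the orientation in \<open>tri\<close>
  fixes the sign.\<close>

lemma tri_step:
  assumes pos: "radius D > 0" "radius E > 0" "radius F > 0" and "tri D E F"
  shows "centre F - centre D = of_real ((radius D + radius F) / (radius D + radius E)) *
    (centre E - centre D) * cis (ang (radius D) (radius E) (radius F))"
proof -
  define v w k \<gamma> where "v = centre E - centre D" and "w = centre F - centre D"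
    and "k = (radius D + radius E) * (radius D + radius F)"
    and "\<gamma> = ang (radius D) (radius E) (radius F)"
  have tan: "tangent D E" "tangent E F" "tangent F D" "tangent D F" and im: "Im (cnj v * w) > 0"
    using assms(4) by (auto simp: tri_def v_def w_def tangent_sym)
  have k: "k > 0" using pos by (simp add: k_def)
  have g: "sin \<gamma> > 0" unfolding \<gamma>_def using ang_bounds[OF pos] by (intro sin_gt_zero)
  have re: "Re (cnj v * w) = k * cos \<gamma>"
  proof -
    have "Re (cnj v * w) = v \<bullet> w" by (simp add: inner_complex_def)
    then show ?thesis using inner_tangent[OF pos tan(1-3)] by (simp add: v_def w_def k_def \<gamma>_def)
  qed
  have nv: "norm v = radius D + radius E" and nw: "norm w = radius D + radius F"
    using norm_tangent tan by (auto simp: v_def w_def)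
  have "(Re (cnj v * w))\<^sup>2 + (Im (cnj v * w))\<^sup>2 = k\<^sup>2"
    unfolding cmod_power2[symmetric] by (simp add: norm_mult nv nw k_def)
  then have "(Im (cnj v * w))\<^sup>2 = k\<^sup>2 - k\<^sup>2 * (cos \<gamma>)\<^sup>2" unfolding re by (simp add: power_mult_distrib)
  also have "\<dots> = (k * sin \<gamma>)\<^sup>2"
    by (simp add: power_mult_distrib sin_squared_eq algebra_simps)
  finally have "Im (cnj v * w) = k * sin \<gamma>"
    using im k g by (simp add: power2_eq_iff_nonneg)
  then have eq: "cnj v * w = of_real k * cis \<gamma>" using re by (simp add: complex_eq_iff)
  have "of_real ((radius D + radius E)\<^sup>2) * w = v * (cnj v * w)"
    unfolding nv[symmetric] mult.assoc[symmetric] complex_norm_square by (simp add: mult_ac)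
  also have "\<dots> = of_real k * v * cis \<gamma>" unfolding eq by simp
  finally have "of_real ((radius D + radius E)\<^sup>2) * w = of_real k * v * cis \<gamma>" .
  moreover have "of_real b * w = of_real k * z \<Longrightarrow> w = of_real (k / b) * z" if "b \<noteq> 0" for b :: real and z
    using that by (simp add: field_simps)
  ultimately have "w = of_real (k / (radius D + radius E)\<^sup>2) * (v * cis \<gamma>)"
    using pos by (metis add_pos_pos less_irrefl mult.assoc zero_less_power)
  also have "k / (radius D + radius E)\<^sup>2 = (radius D + radius F) / (radius D + radius E)"
    by (simp add: k_def power2_eq_square)
  finally show ?thesis by (simp add: v_def w_def \<gamma>_def mult.assoc)
qed

text \<open>The rigidity behind every forced placement: the right side of \<open>tri_step\<close>
  mentions the third disc only through its radius.\<close>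

lemma tri_unique:
  assumes "radius D > 0" "radius E > 0" "radius F > 0" "tri D E F" "tri D E G"
    "radius F = radius G"
  shows "F = G"
proof -
  have "centre F - centre D = centre G - centre D"
    using tri_step[of D E F] tri_step[of D E G] assms by simp
  then show ?thesis using assms(6) by (simp add: prod_eq_iff)
qed

lemma sum_cyclic:
  "(\<Sum>i<length xs. f (xs ! i) (xs ! (Suc i mod length xs))) = sum_list (map2 f xs (rotate1 xs))"
  by (simp add: sum_list_sum_nth nth_rotate1 atLeast0LessThan)

lemma all_cyclic:
  "(\<forall>i<length xs. R (xs ! i) (xs ! (Suc i mod length xs))) \<longleftrightarrow> list_all2 R xs (rotate1 xs)"
  by (auto simp: list_all2_conv_all_nth nth_rotate1)

lemma corona_rotate1: assumes "corona P D Fs" shows "corona P D (rotate1 Fs)"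
proof (cases Fs)
  case (Cons x xs)
  show ?thesis
  proof (cases xs)
    case xs: (Cons y ys)
    have eq: "rotate1 Fs = xs @ [x]" "rotate1 (rotate1 Fs) = (ys @ [x]) @ [y]" "length xs = length (ys @ [x])"
      by (auto simp: Cons xs)
    have "list_all2 (tri D) xs (ys @ [x])" "tri D x y"
      using assms by (auto simp: corona_def Cons xs)
    then have "list_all2 (tri D) (rotate1 Fs) (rotate1 (rotate1 Fs))"
      unfolding eq(2) unfolding eq(1) by (intro list_all2_appendI) auto
    moreover have "sum_list (map2 f (rotate1 Fs) (rotate1 (rotate1 Fs))) = sum_list (map2 f Fs (rotate1 Fs))"
      for f :: "disc \<Rightarrow> disc \<Rightarrow> real"
      unfolding eq(2) unfolding eq(1) zip_append[OF eq(3)] by (simp add: Cons xs)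
    ultimately show ?thesis using assms by (auto simp: corona_def)
  qed (use assms Cons in simp)
qed (use assms in simp)

lemma corona_rotate: "corona P D Fs \<Longrightarrow> corona P D (rotate m Fs)"
  by (induction m) (auto simp: corona_rotate1)

lemma corona_head:
  assumes "corona P D Fs" "E \<in> P" "tangent D E"
  obtains Gs m where "corona P D (E # Gs)" "E # Gs = rotate m Fs"
proof -
  have "E \<in> set Fs" using assms by (auto simp: corona_def)
  then obtain xs ys where "Fs = xs @ E # ys" by (meson split_list)
  then have "rotate (length xs) Fs = E # ys @ xs" by (simp add: rotate_append)
  then show thesis using that corona_rotate[OF assms(1), of "length xs"] by metis
qed

lemma corona_not_Nil: "corona P D Fs \<Longrightarrow> Fs \<noteq> []"
  by (auto simp: corona_def)

section \<open>Directions of neighbours as partial sums of angles\<close>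

definition psum :: "disc \<Rightarrow> disc list \<Rightarrow> nat \<Rightarrow> real" where
  "psum D Fs i = (\<Sum>k<i. ang (radius D) (radius (Fs ! k)) (radius (Fs ! (Suc k mod length Fs))))"

text \<open>Iterates \<open>tri_step\<close>. Stating the direction through \<open>cis\<close> keeps
  it modulo a full turn, so no bound on the partial sum is needed here.\<close>

lemma chain_args:
  assumes pos: "radius D > 0" "\<forall>F\<in>set Fs. radius F > 0"
    and tri: "list_all2 (tri D) Fs (rotate1 Fs)" and i: "i < length Fs"
  shows "centre (Fs ! i) - centre D = of_real (radius D + radius (Fs ! i)) *
    cis (Arg2pi (centre (Fs ! 0) - centre D) + psum D Fs i)"
  using i
proof (induction i)
  case 0
  have "tri D (Fs ! 0) (Fs ! (Suc 0 mod length Fs))"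
    using tri 0 unfolding all_cyclic[symmetric] by blast
  then have "norm (centre (Fs ! 0) - centre D) = radius D + radius (Fs ! 0)"
    by (simp add: tri_def norm_tangent)
  then show ?case
    using Arg2pi_eq[of "centre (Fs ! 0) - centre D"] by (simp add: psum_def cis_conv_exp)
next
  case (Suc i)
  have t: "tri D (Fs ! i) (Fs ! Suc i)"
    using tri Suc.prems unfolding all_cyclic[symmetric] by (metis Suc_lessD mod_less)
  have p: "radius (Fs ! i) > 0" "radius (Fs ! Suc i) > 0" using Suc.prems pos by auto
  have "radius D + radius (Fs ! i) \<noteq> 0" using pos(1) p by simp
  moreover have "of_real (a / b) * (of_real b * z) * w = of_real a * (z * w)" if "b \<noteq> 0"
    for a b :: real and z w :: complex
    using that by simp
  ultimately have "centre (Fs ! Suc i) - centre D = of_real (radius D + radius (Fs ! Suc i)) *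
    (cis (Arg2pi (centre (Fs ! 0) - centre D) + psum D Fs i) *
     cis (ang (radius D) (radius (Fs ! i)) (radius (Fs ! Suc i))))"
    unfolding tri_step[OF pos(1) p t] using Suc by (metis Suc_lessD)
  then show ?case using Suc.prems by (simp add: cis_mult psum_def add.assoc)
qed

lemma psum_length:
  "psum D Fs (length Fs) =
    sum_list (map2 (\<lambda>E F. ang (radius D) (radius E) (radius F)) Fs (rotate1 Fs))"
  unfolding psum_def by (rule sum_cyclic)

lemma psum_strict:
  assumes "radius D > 0" "\<forall>F\<in>set Fs. radius F > 0" "i < j" "j \<le> length Fs"
  shows "psum D Fs i < psum D Fs j"
proof -
  have "Fs \<noteq> []" using assms by auto
  then have "ang (radius D) (radius (Fs ! k)) (radius (Fs ! (Suc k mod length Fs))) > 0"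
    if "k < length Fs" for k
    using that assms by (intro ang_bounds) auto
  then show ?thesis unfolding psum_def using assms(3,4)
    by (intro sum_strict_mono2) (auto intro: less_imp_le)
qed

lemma Arg2pi_cis:
  assumes "k > 0" "0 \<le> t" "t < 2 * pi"
  shows "Arg2pi (of_real k * cis t) = t"
  using assms by (intro Arg2pi_unique[of k]) (auto simp: cis_conv_exp)

lemma arccos_cos_le: "0 \<le> t \<Longrightarrow> arccos (cos t) \<le> t"
  using arccos_cos[of t] arccos_ubound[of "cos t"] by (cases "t \<le> pi") auto

text \<open>The gaps between consecutive arguments sum to \<open>2 * pi\<close>, and an unoriented
  angle never exceeds its gap. As the unoriented angles have the same sum, each equals its gap;
  hence every gap is less than \<open>pi\<close> and the triples are counterclockwise.\<close>

lemma surrounded_imp_corona: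
  assumes pos: "\<forall>E\<in>P. radius E > 0" and D: "D \<in> P" and "surrounded_in P D"
  shows "\<exists>Fs. corona P D Fs"
proof -
  obtain Ds where set: "set Ds = {E \<in> P. tangent D E}"
    and sorted: "sorted_wrt (\<lambda>E F. Arg2pi (centre E - centre D) < Arg2pi (centre F - centre D)) Ds"
    and tang: "\<forall>i<length Ds. tangent (Ds ! i) (Ds ! (Suc i mod length Ds))"
    and sum: "(\<Sum>i<length Ds. angle_at (centre D) (centre (Ds ! i))
        (centre (Ds ! (Suc i mod length Ds)))) = 2 * pi"
    using assms(3) unfolding surrounded_in_def by blast
  \<comment> \<open>The last gap runs from the last disc across the positive real ray to the first
    one, hence the extra \<open>2 * pi\<close>.\<close>
  define n v t \<Delta> where "n = length Ds" and "v = (\<lambda>i. centre (Ds ! i) - centre D)"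
    and "t = (\<lambda>i. Arg2pi (v i))"
    and "\<Delta> = (\<lambda>i. if Suc i < n then t (Suc i) - t i else t 0 + 2 * pi - t i)"
  have n: "n > 0" using sum by (cases Ds) (auto simp: n_def)
  have mem: "Ds ! i \<in> P" "tangent D (Ds ! i)" if "i < n" for i
    using that set nth_mem[of i Ds] by (auto simp: n_def)
  have rpos: "radius (Ds ! i) > 0" if "i < n" for i using mem[OF that] pos by auto
  have Dpos: "radius D > 0" using D pos by auto
  have nv: "norm (v i) = radius D + radius (Ds ! i)" "norm (v i) > 0" if "i < n" for i
    using norm_tangent[OF mem(2)[OF that]] rpos[OF that] Dpos by (auto simp: v_def)
  have vt: "v i = of_real (norm (v i)) * cis (t i)" for i
    using Arg2pi_eq[of "v i"] by (simp add: t_def cis_conv_exp)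
  have prod: "cnj (v i) * v j = of_real (norm (v i) * norm (v j)) * cis (t j - t i)" for i j
  proof -
    have "cnj (v i) * v j = of_real (norm (v i) * norm (v j)) * (cnj (cis (t i)) * cis (t j))"
      by (subst (1) vt, subst (1) vt) simp
    then show ?thesis by (simp add: cis_cnj cis_mult)
  qed
  have tm: "t i < t j" if "i < j" "j < n" for i j
    using sorted_wrt_nth_less[OF sorted that(1)] that by (simp add: t_def v_def n_def)
  have tb: "0 \<le> t i" "t i < 2 * pi" for i unfolding t_def by (auto simp: Arg2pi_ge_0 Arg2pi_lt_2pi)
  have dpos: "0 \<le> \<Delta> i" for i using tm[of i "Suc i"] tb[of i] tb[of 0] by (auto simp: \<Delta>_def)
  have ca: "cos (t (Suc i mod n) - t i) = cos (\<Delta> i)" "sin (t (Suc i mod n) - t i) = sin (\<Delta> i)"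
    if "i < n" for i
  proof -
    have "Suc i mod n = (if Suc i < n then Suc i else 0)"
      using that by (auto simp: mod_Suc less_Suc_eq)
    then have "\<Delta> i = t (Suc i mod n) - t i \<or> \<Delta> i = t (Suc i mod n) - t i + 2 * pi"
      by (auto simp: \<Delta>_def)
    then show "cos (t (Suc i mod n) - t i) = cos (\<Delta> i)" "sin (t (Suc i mod n) - t i) = sin (\<Delta> i)"
      using cos_periodic sin_periodic by metis+
  qed
  have an: "angle_at (centre D) (centre (Ds ! i)) (centre (Ds ! (Suc i mod n))) = arccos (cos (\<Delta> i))"
    if "i < n" for i
  proof -
    have j: "Suc i mod n < n" using n by simp
    have "v i \<bullet> v (Suc i mod n) = Re (cnj (v i) * v (Suc i mod n))" by (simp add: inner_complex_def)
    also have "\<dots> = norm (v i) * norm (v (Suc i mod n)) * cos (\<Delta> i)"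
      unfolding prod using ca[OF that] by simp
    finally show ?thesis unfolding angle_at_def using nv(2)[OF that] nv(2)[OF j]
      by (simp add: v_def)
  qed
  have sumd: "(\<Sum>i<n. \<Delta> i) = 2 * pi"
  proof -
    obtain m where m: "n = Suc m" using n by (cases n) auto
    have "(\<Sum>i<m. \<Delta> i) = (\<Sum>i<m. t (Suc i) - t i)" by (intro sum.cong) (auto simp: \<Delta>_def m)
    then show ?thesis by (simp add: m \<Delta>_def sum_lessThan_telescope)
  qed
  \<comment> \<open>Termwise inequality together with equal sums forces termwise equality.\<close>
  have eq: "arccos (cos (\<Delta> i)) = \<Delta> i" if "i < n" for i
  proof (rule sum_mono_inv[of _ "{..<n}"])
    show "(\<Sum>i<n. arccos (cos (\<Delta> i))) = sum \<Delta> {..<n}"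
      unfolding sumd using sum an by (simp add: n_def)
  qed (use that dpos in \<open>auto intro: arccos_cos_le\<close>)
  have tang2: "tangent (Ds ! i) (Ds ! (Suc i mod n))" "tangent (Ds ! (Suc i mod n)) D" if "i < n" for i
    using tang that mem(2)[of "Suc i mod n"] n by (auto simp: n_def tangent_sym)
  have dang: "\<Delta> i = ang (radius D) (radius (Ds ! i)) (radius (Ds ! (Suc i mod n)))" if "i < n" for i
    using angle_at_tangent[OF Dpos rpos[OF that] rpos[of "Suc i mod n"] mem(2)[OF that] tang2[OF that]]
      an[OF that] eq[OF that] n by simp
  have "tri D (Ds ! i) (Ds ! (Suc i mod n))" if "i < n" for i
  proof -
    have j: "Suc i mod n < n" using n by simp
    have "sin (\<Delta> i) > 0" unfolding dang[OF that] using ang_bounds[OF Dpos rpos[OF that] rpos[OF j]]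
      by (intro sin_gt_zero)
    moreover have "Im (cnj (v i) * v (Suc i mod n)) = norm (v i) * norm (v (Suc i mod n)) * sin (\<Delta> i)"
      unfolding prod using ca[OF that] by simp
    ultimately have "Im (cnj (v i) * v (Suc i mod n)) > 0"
      using nv(2)[OF that] nv(2)[OF j] by simp
    then show ?thesis using mem(2)[OF that] tang2[OF that] by (simp add: tri_def v_def)
  qed
  then have "list_all2 (tri D) Ds (rotate1 Ds)" unfolding all_cyclic[symmetric] n_def by blast
  moreover have "sum_list (map2 (\<lambda>E F. ang (radius D) (radius E) (radius F)) Ds (rotate1 Ds)) = 2 * pi"
    unfolding sum_cyclic[symmetric] n_def[symmetric] using sumd dang by simp
  ultimately show ?thesis using set unfolding corona_def by blast
qed

text \<open>After rotating the list to begin at the smallest argument, the partial sums do not carry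
  an argument past \<open>2 * pi\<close>; so the arguments increase along the list.\<close>

lemma corona_imp_surrounded:
  assumes pos: "\<forall>E\<in>P. radius E > 0" and D: "D \<in> P" and "corona P D Gs"
  shows "surrounded_in P D"
proof -
  define A where "A = (\<lambda>E. Arg2pi (centre E - centre D))"
  have "finite (A ` set Gs)" "A ` set Gs \<noteq> {}" using corona_not_Nil[OF assms(3)] by auto
  then obtain E where E: "E \<in> set Gs" "\<forall>F\<in>set Gs. A E \<le> A F"
    using Min_in[of "A ` set Gs"] Min_le[of "A ` set Gs"] by (metis imageE imageI)
  have "E \<in> P" "tangent D E" using E assms(3) by (auto simp: corona_def)
  from corona_head[OF assms(3) this] obtain Hs m
    where H: "corona P D (E # Hs)" "E # Hs = rotate m Gs" by blast
  define Fs where "Fs = E # Hs"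
  have c: "set Fs = {E \<in> P. tangent D E}" "list_all2 (tri D) Fs (rotate1 Fs)"
    "psum D Fs (length Fs) = 2 * pi"
    using H unfolding corona_def Fs_def[symmetric] psum_length by auto
  have min: "A (Fs ! 0) \<le> A F" if "F \<in> set Fs" for F
  proof -
    have "set Fs = set Gs" using H(2) by (simp add: Fs_def)
    then show ?thesis using that E(2) by (simp add: Fs_def)
  qed
  have Dp: "radius D > 0" and Fp: "\<forall>F\<in>set Fs. radius F > 0" using pos D c(1) by auto
  have args: "A (Fs ! i) = A (Fs ! 0) + psum D Fs i" if i: "i < length Fs" for i
  proof -
    define x where "x = A (Fs ! 0) + psum D Fs i"
    have rp: "radius D + radius (Fs ! i) > 0" using Dp Fp i by (auto simp: add_pos_pos)
    have v: "centre (Fs ! i) - centre D = of_real (radius D + radius (Fs ! i)) * cis x"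
      using chain_args[OF Dp Fp c(2) i] by (simp add: x_def A_def)
    have "0 \<le> psum D Fs i" using psum_strict[OF Dp Fp, of 0 i] i by (cases "i = 0") (auto simp: psum_def)
    then have x0: "0 \<le> x" by (simp add: x_def A_def Arg2pi_ge_0)
    have x1: "x < A (Fs ! 0) + 2 * pi"
      using psum_strict[OF Dp Fp i] c(3) by (simp add: x_def)
    have "x < 2 * pi"
    proof (rule ccontr)
      \<comment> \<open>Past a full turn the true argument would be \<open>x - 2 * pi\<close>, which
        is smaller than that of the first disc.\<close>
      assume "\<not> x < 2 * pi"
      then have x2: "0 \<le> x - 2 * pi" by simp
      have c2: "cis x = cis (x - 2 * pi)"
        using cos_periodic[of "x - 2 * pi"] sin_periodic[of "x - 2 * pi"] by (simp add: complex_eq_iff)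
      have "A (Fs ! 0) < 2 * pi" by (simp add: A_def Arg2pi_lt_2pi)
      then have "x - 2 * pi < 2 * pi" using x1 by simp
      from Arg2pi_cis[OF rp x2 this] have "A (Fs ! i) = x - 2 * pi" unfolding A_def v c2 .
      then show False using min[of "Fs ! i"] i x1 by simp
    qed
    then show ?thesis using Arg2pi_cis[OF rp x0] unfolding A_def v by (simp add: x_def A_def)
  qed
  have "sorted_wrt (\<lambda>E F. A E < A F) Fs"
    unfolding sorted_wrt_iff_nth_less using args psum_strict[OF Dp Fp] by auto
  moreover have t: "tri D (Fs ! i) (Fs ! (Suc i mod length Fs))" if "i < length Fs" for i
    using c(2) that unfolding all_cyclic[symmetric] by blast
  have "(\<Sum>i<length Fs. angle_at (centre D) (centre (Fs ! i)) (centre (Fs ! (Suc i mod length Fs))))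
     = psum D Fs (length Fs)"
    unfolding psum_def
  proof (intro sum.cong refl angle_at_tangent)
    fix i assume "i \<in> {..<length Fs}"
    then have i: "i < length Fs" and j: "Suc i mod length Fs < length Fs" by (auto simp: Fs_def)
    show "0 < radius (Fs ! i)" "0 < radius (Fs ! (Suc i mod length Fs))" using i j Fp by auto
    show "tangent D (Fs ! i)" "tangent (Fs ! i) (Fs ! (Suc i mod length Fs))"
      "tangent (Fs ! (Suc i mod length Fs)) D" using t[OF i] by (auto simp: tri_def)
  qed (rule Dp)
  ultimately show ?thesis unfolding surrounded_in_def
    by (intro exI[of _ Fs]) (use c t in \<open>auto simp: tri_def A_def\<close>)
qed

section \<open>Isometries, packings and connectedness\<close>

lemma ball_disjoint_iff:
  fixes x y :: "'a::real_normed_vector"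
  assumes "a > 0" "b > 0"
  shows "ball x a \<inter> ball y b = {} \<longleftrightarrow> a + b \<le> dist x y"
proof
  assume e: "ball x a \<inter> ball y b = {}"
  show "a + b \<le> dist x y"
  proof (rule ccontr)
    assume "\<not> a + b \<le> dist x y"
    then have l: "norm (y - x) < a + b" by (simp add: dist_norm norm_minus_commute)
    \<comment> \<open>The point that divides the segment between the centres in the ratio of the
      radii lies in both balls.\<close>
    define z where "z = x + (a / (a + b)) *\<^sub>R (y - x)"
    have "y - z = (1 - a / (a + b)) *\<^sub>R (y - x)" by (simp add: z_def algebra_simps)
    also have "1 - a / (a + b) = b / (a + b)" using assms by (simp add: field_simps)
    finally have yz: "y - z = (b / (a + b)) *\<^sub>R (y - x)" .
    have "dist x z = a / (a + b) * norm (y - x)" "dist y z = b / (a + b) * norm (y - x)"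
      unfolding dist_norm yz using assms by (simp_all add: z_def)
    moreover have "a / (a + b) * norm (y - x) < a / (a + b) * (a + b)"
      "b / (a + b) * norm (y - x) < b / (a + b) * (a + b)"
      using assms l by (intro mult_strict_left_mono; simp)+
    moreover have "a / (a + b) * (a + b) = a" "b / (a + b) * (a + b) = b" using assms by auto
    ultimately have "z \<in> ball x a \<inter> ball y b" by auto
    then show False using e by blast
  qed
qed (rule disjoint_ballI)

text \<open>The working form of compactness: distances replace interiors, and \<open>corona\<close>
  replaces the sorted list with its \<open>arccos\<close> values.\<close>

lemma compact_packing_iff:
  "compact_packing P \<longleftrightarrow> (\<forall>D\<in>P. radius D > 0) \<and>
     pairwise (\<lambda>D E. radius D + radius E \<le> dist (centre D) (centre E)) P \<and>
     (\<forall>D\<in>P. \<exists>Fs. corona P D Fs)"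
proof -
  have "pairwise (\<lambda>D E. interior (region D) \<inter> interior (region E) = {}) P \<longleftrightarrow>
    pairwise (\<lambda>D E. radius D + radius E \<le> dist (centre D) (centre E)) P" if "\<forall>D\<in>P. radius D > 0"
    using that by (auto simp: pairwise_def region_def interior_cball ball_disjoint_iff)
  then show ?thesis unfolding compact_packing_def packing_def
    using surrounded_imp_corona corona_imp_surrounded by blast
qed

section \<open>Isometries and their action on coronas\<close>

abbreviation move :: "(complex \<Rightarrow> complex) \<Rightarrow> disc \<Rightarrow> disc" where
  "move f D \<equiv> (f (centre D), radius D)"

text \<open>Composing with the inverse of the candidate motion gives a map \<open>k\<close> that
  fixes 0 and 1. Distances to these two points fix the real part, and \<open>k \<i>\<close> decides
  between the identity and conjugation.\<close>

lemma plane_isometry_form: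
  assumes "plane_isometry f"
  obtains a b where "norm a = 1" "f = (\<lambda>z. a * z + b) \<or> f = (\<lambda>z. a * cnj z + b)"
proof -
  define b where "b = f 0"
  define a where "a = f 1 - b"
  define k where "k = (\<lambda>z. cnj a * (f z - b))"
  have iso: "norm (f z - f w) = norm (z - w)" for z w
    using assms by (simp add: plane_isometry_def dist_norm)
  have a: "norm a = 1" using iso[of 1 0] by (simp add: a_def b_def)
  have ca: "a * cnj a = 1" using complex_norm_square[of a] a by simp
  have kd: "norm (k z - k w) = norm (z - w)" for z w
  proof -
    have "k z - k w = cnj a * (f z - f w)" by (simp add: k_def algebra_simps)
    then show ?thesis using iso a by (simp add: norm_mult)
  qed
  have fk: "f z = a * k z + b" for z
    unfolding k_def mult.assoc[symmetric] ca by simp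
  have k0: "k 0 = 0" "k 1 = 1" by (simp_all add: k_def b_def) (use ca in \<open>simp add: a_def b_def mult.commute\<close>)
  have kn: "(Re (k z) - Re (k w))\<^sup>2 + (Im (k z) - Im (k w))\<^sup>2 = (Re z - Re w)\<^sup>2 + (Im z - Im w)\<^sup>2" for z w
    using kd[of z w] cmod_power2[of "k z - k w"] cmod_power2[of "z - w"] by simp
  have re: "Re (k z) = Re z" for z
    using kn[of z 0] kn[of z 1] by (simp add: k0 power2_eq_square algebra_simps)
  have im: "(Im (k z) - Im (k w))\<^sup>2 = (Im z - Im w)\<^sup>2" for z w
    using kn[of z w] by (simp add: re)
  have "Im (k \<i>) = 1 \<or> Im (k \<i>) = -1" using im[of \<i> 0] by (simp add: k0 power2_eq_1_iff)
  then have "k = (\<lambda>z. z) \<or> k = cnj"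
  proof (elim disj_forward)
    assume "Im (k \<i>) = 1"
    then have "Im (k z) = Im z" for z
      using im[of z \<i>] im[of z 0] by (simp add: k0 power2_eq_square algebra_simps)
    then show "k = (\<lambda>z. z)" using re by (auto simp: complex_eq_iff)
  next
    assume "Im (k \<i>) = -1"
    then have "Im (k z) = - Im z" for z
      using im[of z \<i>] im[of z 0] by (simp add: k0 power2_eq_square algebra_simps)
    then show "k = cnj" using re by (auto simp: complex_eq_iff)
  qed
  then show thesis using that[OF a] fk by auto
qed

lemma plane_isometry_affine:
  "norm a = 1 \<Longrightarrow> plane_isometry (\<lambda>z. a * z + b)"
  "norm a = 1 \<Longrightarrow> plane_isometry (\<lambda>z. a * cnj z + b)"
proof -
  assume a: "norm a = 1"
  have "norm (a * z - a * w) = norm (z - w)" for z w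
    unfolding right_diff_distrib[symmetric] norm_mult a by simp
  moreover have "norm (cnj z - cnj w) = norm (z - w)" for z w
    by (metis complex_cnj_diff complex_mod_cnj)
  ultimately show "plane_isometry (\<lambda>z. a * z + b)" "plane_isometry (\<lambda>z. a * cnj z + b)"
    by (simp_all add: plane_isometry_def dist_norm)
qed

lemma plane_isometry_cnj: "plane_isometry cnj"
  using plane_isometry_affine(2)[of 1 0] by simp

lemma plane_isometry_uminus_cnj: "plane_isometry (\<lambda>z. - cnj z)"
  using plane_isometry_affine(2)[of "-1" 0] by simp

text \<open>Surjectivity is no part of \<open>plane_isometry\<close>; it comes from the explicit
  affine form.\<close>

lemma plane_isometry_inverse:
  assumes "plane_isometry f"
  obtains g where "plane_isometry g" "\<And>z. g (f z) = z" "\<And>z. f (g z) = z"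
proof -
  obtain a b where a: "norm a = 1" and f: "f = (\<lambda>z. a * z + b) \<or> f = (\<lambda>z. a * cnj z + b)"
    using plane_isometry_form[OF assms] .
  have ca: "a * cnj a = 1" "cnj a * a = 1" using complex_norm_square[of a] a by (simp_all add: mult.commute)
  have c: "cnj a * (a * z) = z" "a * (cnj a * z) = z" for z
    unfolding mult.assoc[symmetric] ca by simp_all
  have na: "norm (cnj a) = 1" using a by simp
  show thesis using f
  proof
    assume f: "f = (\<lambda>z. a * z + b)"
    show thesis
    proof (rule that[OF plane_isometry_affine(1)[OF na]])
      show "cnj a * f z + - (cnj a * b) = z" "f (cnj a * z + - (cnj a * b)) = z" for z
        unfolding f by (simp_all add: distrib_left right_diff_distrib c)
    qed
  next
    assume f: "f = (\<lambda>z. a * cnj z + b)"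
    show thesis
    proof (rule that[OF plane_isometry_affine(2)[OF a]])
      show "a * cnj (f z) + - (a * cnj b) = z" "f (a * cnj z + - (a * cnj b)) = z" for z
        unfolding f by (simp_all add: distrib_left right_diff_distrib c)
    qed
  qed
qed

lemma congruent_packings_refl: "congruent_packings P P"
  unfolding congruent_packings_def
  by (intro exI[of _ "\<lambda>z. z"]) (simp add: plane_isometry_def)

lemma congruent_packings_sym:
  assumes "congruent_packings P Q" shows "congruent_packings Q P"
proof -
  obtain f where f: "plane_isometry f" "Q = move f ` P"
    using assms by (auto simp: congruent_packings_def)
  obtain g where g: "plane_isometry g" "\<And>z. g (f z) = z" using plane_isometry_inverse[OF f(1)] by metis
  have "P = move g ` Q" by (simp add: f(2) image_image g(2))
  then show ?thesis using g(1) by (auto simp: congruent_packings_def)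
qed

lemma congruent_packings_trans:
  assumes "congruent_packings P Q" "congruent_packings Q R" shows "congruent_packings P R"
proof -
  obtain f where f: "plane_isometry f" "Q = move f ` P"
    using assms(1) by (auto simp: congruent_packings_def)
  obtain g where g: "plane_isometry g" "R = move g ` Q"
    using assms(2) by (auto simp: congruent_packings_def)
  have "plane_isometry (g \<circ> f)" "R = move (g \<circ> f) ` P"
    using f g by (auto simp: plane_isometry_def image_image)
  then show ?thesis unfolding congruent_packings_def by blast
qed

lemma tangent_move: "plane_isometry f \<Longrightarrow> tangent (move f D) (move f E) \<longleftrightarrow> tangent D E"
  by (simp add: tangent_def plane_isometry_def)

lemma tri_move_affine:
  assumes "norm a = 1"
  shows "tri (move (\<lambda>z. a * z + b) D) (move (\<lambda>z. a * z + b) E) (move (\<lambda>z. a * z + b) F) \<longleftrightarrow> tri D E F"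
    "tri (move (\<lambda>z. a * cnj z + b) D) (move (\<lambda>z. a * cnj z + b) E) (move (\<lambda>z. a * cnj z + b) F)
       \<longleftrightarrow> tri D F E"
proof -
  have ca: "cnj a * a = 1" using complex_norm_square[of a] assms by (simp add: mult.commute)
  have "cnj (a * e + b - (a * d + b)) * (a * f + b - (a * d + b)) = (cnj a * a) * (cnj (e - d) * (f - d))"
    for d e f by (simp add: algebra_simps)
  then have c: "Im (cnj (a * e + b - (a * d + b)) * (a * f + b - (a * d + b))) = Im (cnj (e - d) * (f - d))"
    for d e f unfolding ca by simp
  have d: "Im (cnj (cnj e - cnj d) * (cnj f - cnj d)) = Im (cnj (f - d) * (e - d))" for d e f
    by (simp add: algebra_simps)
  note t = tangent_move[OF plane_isometry_affine(1)[OF assms, of b]]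
    tangent_move[OF plane_isometry_affine(2)[OF assms, of b]]
  show "tri (move (\<lambda>z. a * z + b) D) (move (\<lambda>z. a * z + b) E) (move (\<lambda>z. a * z + b) F) \<longleftrightarrow> tri D E F"
    unfolding tri_def t unfolding fst_conv c ..
  show "tri (move (\<lambda>z. a * cnj z + b) D) (move (\<lambda>z. a * cnj z + b) E) (move (\<lambda>z. a * cnj z + b) F)
       \<longleftrightarrow> tri D F E"
    unfolding tri_def t unfolding fst_conv c d using tangent_sym by auto
qed

lemma tri_move:
  assumes "plane_isometry f"
  shows "(\<forall>D E F. tri (move f D) (move f E) (move f F) \<longleftrightarrow> tri D E F) \<or>
    (\<forall>D E F. tri (move f D) (move f E) (move f F) \<longleftrightarrow> tri D F E)"
proof -
  obtain a b where a: "norm a = 1" and f: "f = (\<lambda>z. a * z + b) \<or> f = (\<lambda>z. a * cnj z + b)"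
    using plane_isometry_form[OF assms] .
  show ?thesis using f
  proof (elim disj_forward)
    show "\<forall>D E F. tri (move f D) (move f E) (move f F) \<longleftrightarrow> tri D E F" if "f = (\<lambda>z. a * z + b)"
      unfolding that using tri_move_affine(1)[OF a] by blast
    show "\<forall>D E F. tri (move f D) (move f E) (move f F) \<longleftrightarrow> tri D F E" if "f = (\<lambda>z. a * cnj z + b)"
      unfolding that using tri_move_affine(2)[OF a] by blast
  qed
qed

lemma set_move:
  assumes "plane_isometry f"
  shows "{E \<in> move f ` P. tangent (move f D) E} = move f ` {E \<in> P. tangent D E}"
  using tangent_move[OF assms] by blast

lemma corona_move_direct:
  assumes f: "plane_isometry f"
    and t: "\<forall>D E F. tri (move f D) (move f E) (move f F) \<longleftrightarrow> tri D E F"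
    and c: "corona P D Fs"
  shows "corona (move f ` P) (move f D) (map (move f) Fs)"
  using c unfolding corona_def set_move[OF f]
  by (simp add: rotate1_map list_all2_map1 list_all2_map2 t[unfolded fst_conv snd_conv] zip_map_map split_def o_def)

text \<open>A reflection reverses the cyclic order. The list \<open>rev (rotate1 Fs)\<close> is
  chosen because its \<open>rotate1\<close> is \<open>rev Fs\<close>, so the pairs of successors are
  the old ones, swapped and in reverse order.\<close>

lemma corona_move_opposite:
  assumes f: "plane_isometry f"
    and t: "\<forall>D E F. tri (move f D) (move f E) (move f F) \<longleftrightarrow> tri D F E"
    and c: "corona P D Fs"
  shows "corona (move f ` P) (move f D) (map (move f) (rev (rotate1 Fs)))"
proof -
  define Gs where "Gs = map (move f) (rev (rotate1 Fs))"
  have "rotate1 (rev (rotate1 Fs)) = rev Fs" by (cases Fs) auto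
  then have r: "rotate1 Gs = map (move f) (rev Fs)" by (simp add: Gs_def rotate1_map)
  have "list_all2 (tri (move f D)) Gs (rotate1 Gs) \<longleftrightarrow>
      list_all2 (\<lambda>E F. tri D F E) (rotate1 Fs) Fs"
    unfolding r unfolding Gs_def
    by (simp add: list_all2_map1 list_all2_map2 t[unfolded fst_conv snd_conv])
  also have "\<dots> \<longleftrightarrow> list_all2 (tri D) Fs (rotate1 Fs)"
    using list_all2_conv_all_nth by (metis (no_types, lifting))
  finally have "list_all2 (tri (move f D)) Gs (rotate1 Gs)" using c by (simp add: corona_def)
  moreover have "map2 (\<lambda>E F. ang (radius D) (radius E) (radius F)) Gs (rotate1 Gs)
      = rev (map2 (\<lambda>E F. ang (radius D) (radius E) (radius F)) Fs (rotate1 Fs))"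
    unfolding r unfolding Gs_def
    by (intro nth_equalityI) (auto simp: rev_nth rev_map ang_sym)
  ultimately show ?thesis using c unfolding corona_def set_move[OF f] Gs_def[symmetric]
    by (simp add: sum_list_rev) (simp add: Gs_def)
qed

lemma compact_packing_using_move:
  assumes f: "plane_isometry f" and "compact_packing_using r P"
  shows "compact_packing_using r (move f ` P)"
proof -
  have cp: "compact_packing P" and rad: "radius ` P = {1, r}"
    using assms(2) by (auto simp: compact_packing_using_def)
  have "\<exists>Gs. corona (move f ` P) (move f D) Gs" if "D \<in> P" for D
    using cp that corona_move_direct[OF f] corona_move_opposite[OF f] tri_move[OF f]
    unfolding compact_packing_iff by blast
  then have "compact_packing (move f ` P)"
    using cp f unfolding compact_packing_iff plane_isometry_def by (simp add: pairwise_image) (simp add: pairwise_def)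
  then show ?thesis using rad by (simp add: compact_packing_using_def image_image)
qed

lemma compact_packing_using_congruent:
  assumes "congruent_packings P Q" "compact_packing_using r P"
  shows "compact_packing_using r Q"
proof -
  obtain f where "plane_isometry f" "Q = move f ` P"
    using assms(1) by (auto simp: congruent_packings_def)
  then show ?thesis using compact_packing_using_move[OF _ assms(2), of f] by simp
qed

text \<open>A corona without the claim that all neighbours are listed. It refers to no packing, so
  it can be verified by coordinates and inside a subcollection.\<close>

definition wreath :: "disc \<Rightarrow> disc list \<Rightarrow> bool" where
  "wreath D Fs \<longleftrightarrow> list_all2 (tri D) Fs (rotate1 Fs) \<and>
     sum_list (map2 (\<lambda>E F. ang (radius D) (radius E) (radius F)) Fs (rotate1 Fs)) = 2 * pi"

lemma corona_wreath: "corona P D Fs \<longleftrightarrow> set Fs = {E \<in> P. tangent D E} \<and> wreath D Fs"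
  by (simp add: corona_def wreath_def)

lemma wreath_tangent:
  assumes "wreath D Fs" "F \<in> set Fs" shows "tangent D F"
proof -
  obtain i where "i < length Fs" "F = Fs ! i" using assms(2) by (metis in_set_conv_nth)
  moreover have "tri D (Fs ! i) (rotate1 Fs ! i)" if "i < length Fs" for i
    using assms(1) list_all2_nthD that unfolding wreath_def by blast
  ultimately show ?thesis unfolding tri_def by blast
qed

text \<open>The direction of \<open>z\<close> falls into the gap between two consecutive discs of
  the ring. The gap is at most \<gamma>, so one of its two ends is within
  \<open>\<gamma> / 2\<close> of that direction.\<close>

lemma wreath_near:
  assumes pos: "radius D > 0" "\<forall>F\<in>set Fs. radius F > 0" and w: "wreath D Fs"
    and \<gamma>: "\<And>E F. E \<in> set Fs \<Longrightarrow> F \<in> set Fs \<Longrightarrow> ang (radius D) (radius E) (radius F) \<le> \<gamma>" "\<gamma> \<le> 2 * pi"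
  shows "\<exists>F\<in>set Fs. (centre F - centre D) \<bullet> z \<ge> (radius D + radius F) * norm z * cos (\<gamma> / 2)"
proof -
  define n p where "n = length Fs" and "p = psum D Fs"
  define t0 where "t0 = Arg2pi (centre (Fs ! 0) - centre D)"
  have tri: "list_all2 (tri D) Fs (rotate1 Fs)" and pn: "p n = 2 * pi"
    using w by (auto simp: wreath_def p_def n_def psum_length)
  have n: "n > 0" using pn by (cases n) (auto simp: p_def psum_def)
  have p0: "p 0 = 0" by (simp add: p_def psum_def)
  \<comment> \<open>The direction of \<open>z\<close> measured from the first disc, reduced to one
    turn.\<close>
  define t where "t = (if Arg2pi z \<ge> t0 then Arg2pi z - t0 else Arg2pi z - t0 + 2 * pi)"
  have t: "0 \<le> t" "t < 2 * pi"
    using Arg2pi_lt_2pi[of z] Arg2pi_ge_0[of z] Arg2pi_lt_2pi[of "centre (Fs ! 0) - centre D"]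
      Arg2pi_ge_0[of "centre (Fs ! 0) - centre D"] by (auto simp: t_def t0_def)
  have ct: "cis (Arg2pi z) = cis (t0 + t)"
    using cos_periodic[of "Arg2pi z"] sin_periodic[of "Arg2pi z"] by (auto simp: t_def complex_eq_iff)
  have inner: "(centre (Fs ! i) - centre D) \<bullet> z = (radius D + radius (Fs ! i)) * norm z * cos (t - p i)"
    if "i < n" for i
  proof -
    have z: "z = of_real (norm z) * cis (t0 + t)"
      using Arg2pi_eq[of z] ct by (simp add: cis_conv_exp)
    have v: "centre (Fs ! i) - centre D = of_real (radius D + radius (Fs ! i)) * cis (t0 + p i)"
      using chain_args[OF pos tri] that by (simp add: n_def t0_def p_def)
    have ip: "(of_real a * cis x) \<bullet> (of_real b * cis y) = a * b * cos (y - x)" for a b x y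
      by (simp add: inner_complex_def cos_diff algebra_simps)
    have "(centre (Fs ! i) - centre D) \<bullet> (of_real (norm z) * cis (t0 + t)) =
        (radius D + radius (Fs ! i)) * norm z * cos (t - p i)"
      unfolding v ip by simp
    then show ?thesis using z by simp
  qed
  \<comment> \<open>The last disc that is not beyond the direction of \<open>z\<close>.\<close>
  define i where "i = Max {i. i < n \<and> p i \<le> t}"
  have fin: "finite {i. i < n \<and> p i \<le> t}" by simp
  have "i \<in> {i. i < n \<and> p i \<le> t}" unfolding i_def using n t p0 by (intro Max_in) auto
  then have i: "i < n" "p i \<le> t" by auto
  have i1: "t < p (Suc i)"
  proof (cases "Suc i < n")
    case True
    then show ?thesis using Max_ge[OF fin, of "Suc i"] unfolding i_def[symmetric]
      by (metis (no_types, lifting) mem_Collect_eq not_less Suc_n_not_le_n)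
  next
    case False
    then have "Suc i = n" using i by simp
    then show ?thesis using pn t by simp
  qed
  have "p (Suc i) = p i + ang (radius D) (radius (Fs ! i)) (radius (Fs ! (Suc i mod n)))"
    by (simp add: p_def psum_def n_def)
  then have step: "p (Suc i) \<le> p i + \<gamma>" using \<gamma>(1) i n by (simp add: n_def)
  have mono: "cos (\<gamma> / 2) \<le> cos x" if "\<bar>x\<bar> \<le> \<gamma> / 2" for x
    using that \<gamma>(2) cos_monotone_0_pi_le[of "\<bar>x\<bar>" "\<gamma> / 2"] by simp
  have fin: ?thesis if j: "j < n" "cos (\<gamma> / 2) \<le> cos (t - p j)" for j
  proof (rule bexI)
    show F: "Fs ! j \<in> set Fs" using j by (simp add: n_def)
    then have "radius (Fs ! j) > 0" using pos(2) by blast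
    then show "(radius D + radius (Fs ! j)) * norm z * cos (\<gamma> / 2) \<le> (centre (Fs ! j) - centre D) \<bullet> z"
      unfolding inner[OF j(1)] using pos(1) j(2) by (intro mult_left_mono) auto
  qed
  show ?thesis
  proof (cases "t - p i \<le> \<gamma> / 2")
    case True
    then show ?thesis using fin[of i] i mono[of "t - p i"] by simp
  next
    case False
    then have near: "\<bar>t - p (Suc i)\<bar> \<le> \<gamma> / 2" using i1 step by simp
    show ?thesis
    proof (cases "Suc i < n")
      case True
      then show ?thesis using fin[of "Suc i"] mono[OF near] by simp
    next
      case F: False
      then have "Suc i = n" using i by simp
      \<comment> \<open>The gap after the last disc ends at the first one, a full turn
        later.\<close>
      then have "cos (t - p (Suc i)) = cos (t - p 0)"
        using cos_periodic[of "t - 2 * pi"] by (simp add: pn p0)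
      then show ?thesis using fin[of 0] n mono[OF near] by simp
    qed
  qed
qed

text \<open>A further neighbour \<open>E\<close> would be seen from \<open>D\<close> within
  \<open>\<gamma> / 2\<close> of some disc \<open>F\<close> of the ring. Since \<open>E\<close> and
  \<open>F\<close> do not overlap, that angle is at least \<open>ang\<close> of the three radii,
  which exceeds \<open>\<gamma> / 2\<close>.\<close>

lemma wreath_corona:
  assumes pos: "\<forall>E\<in>P. radius E > 0"
    and pack: "pairwise (\<lambda>D E. radius D + radius E \<le> dist (centre D) (centre E)) P"
    and D: "D \<in> P" and w: "wreath D Fs" "set Fs \<subseteq> P"
    and \<gamma>: "\<And>E F. E \<in> P \<Longrightarrow> F \<in> P \<Longrightarrow>
      \<gamma> / 2 < ang (radius D) (radius E) (radius F) \<and> ang (radius D) (radius E) (radius F) \<le> \<gamma>"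
  shows "corona P D Fs"
proof -
  have Dp: "radius D > 0" using D pos by blast
  have \<gamma>2: "0 \<le> \<gamma>" "\<gamma> \<le> 2 * pi" using \<gamma>[OF D D] ang_bounds[OF Dp Dp Dp] by linarith+
  have "E \<in> set Fs" if E: "E \<in> P" "tangent D E" for E
  proof (rule ccontr)
    assume E': "E \<notin> set Fs"
    obtain F where F: "F \<in> set Fs" "(centre F - centre D) \<bullet> (centre E - centre D)
        \<ge> (radius D + radius F) * norm (centre E - centre D) * cos (\<gamma> / 2)"
      using wreath_near[OF Dp _ w(1) _ \<gamma>2(2), of "centre E - centre D"] pos w(2) \<gamma> by blast
    have FP: "F \<in> P" "E \<noteq> F" "tangent D F" using F w E' wreath_tangent by auto
    have Ep: "radius E > 0" and Fp: "radius F > 0" using E FP pos by blast+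
    have "radius E + radius F \<le> dist (centre F) (centre E)"
      using pairwiseD[OF pack E(1) FP(1) FP(2)] by (simp add: dist_commute)
    then have "(radius E + radius F)\<^sup>2 \<le> (dist (centre F) (centre E))\<^sup>2"
      using Ep Fp by (intro power_mono) auto
    then have "(centre F - centre D) \<bullet> (centre E - centre D) \<le>
      ((radius D + radius F)\<^sup>2 + (radius D + radius E)\<^sup>2 - (radius E + radius F)\<^sup>2) / 2"
      using E FP by (simp add: inner_dist tangent_def)
    also have "\<dots> = (radius D + radius E) * (radius D + radius F) - 2 * radius E * radius F"
      by (simp add: power2_eq_square field_simps)
    also have "\<dots> = (radius D + radius E) * (radius D + radius F) *
        cos (ang (radius D) (radius E) (radius F))"
      using Dp Ep Fp by (simp add: cos_ang right_diff_distrib)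
    finally have "(radius D + radius E) * (radius D + radius F) * cos (\<gamma> / 2) \<le>
      (radius D + radius E) * (radius D + radius F) * cos (ang (radius D) (radius E) (radius F))"
      using F(2) norm_tangent[OF E(2)] by (simp add: mult_ac)
    then have "cos (\<gamma> / 2) \<le> cos (ang (radius D) (radius E) (radius F))"
      using Dp Ep Fp by simp
    moreover have "cos (ang (radius D) (radius E) (radius F)) < cos (\<gamma> / 2)"
      using \<gamma>[OF E(1) FP(1)] \<gamma>2 ang_bounds[OF Dp Ep Fp] by (intro cos_monotone_0_pi) auto
    ultimately show False by simp
  qed
  then show ?thesis unfolding corona_wreath using w wreath_tangent[OF w(1)] by blast
qed

text \<open>Centres are at least \<open>2 * c\<close> apart, so infinitely many in a ball would
  contradict Bolzano-Weierstrass.\<close>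

lemma finite_bounded_packing:
  assumes c: "c > 0" "\<forall>D\<in>P. radius D \<ge> c"
    and pack: "pairwise (\<lambda>D E. radius D + radius E \<le> dist (centre D) (centre E)) P"
  shows "finite {D \<in> P. dist e (centre D) \<le> R}"
proof (rule ccontr)
  define M where "M = {D \<in> P. dist e (centre D) \<le> R}"
  assume "infinite {D \<in> P. dist e (centre D) \<le> R}"
  then have M: "infinite M" by (simp add: M_def)
  have sep: "2 * c \<le> dist (centre D) (centre E)" if "D \<in> P" "E \<in> P" "D \<noteq> E" for D E
  proof -
    have "c \<le> radius D" "c \<le> radius E" using c(2) that by auto
    then show ?thesis using pairwiseD[OF pack that] by linarith
  qed
  have "inj_on centre M"
    by (rule inj_onI) (use sep c in \<open>force simp: M_def\<close>)
  then have "infinite (centre ` M)" using M finite_imageD by blast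
  moreover have "centre ` M \<subseteq> cball e R" by (auto simp: M_def)
  ultimately obtain x where x: "x islimpt (centre ` M)"
    using compact_cball[of e R] unfolding compact_eq_Bolzano_Weierstrass by blast
  then have inf: "infinite (centre ` M \<inter> ball x c)"
    using c(1) by (simp add: islimpt_eq_infinite_ball)
  then obtain y where y: "y \<in> centre ` M \<inter> ball x c"
    by (metis infinite_imp_nonempty ex_in_conv)
  have "infinite (centre ` M \<inter> ball x c - {y})" using inf by simp
  then obtain z where z: "z \<in> centre ` M \<inter> ball x c - {y}"
    by (metis infinite_imp_nonempty ex_in_conv)
  obtain D E where DE: "D \<in> P" "E \<in> P" "y = centre D" "z = centre E" using y z by (auto simp: M_def)
  have "dist y z < 2 * c" using y z dist_triangle_less_add[of y x c z c] by (auto simp: dist_commute)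
  then show False using sep[of D E] DE z by auto
qed

text \<open>
  Connectedness: as the discs around \<open>D\<close> surround it, one of them has smaller power distance
  to any given point outside \<open>D\<close>; so a walk along tangent discs reaches every disc.
\<close>

lemma closed_subpacking_eq:
  assumes pos: "c > 0" "\<forall>D\<in>P. radius D \<ge> c"
    and pack: "pairwise (\<lambda>D E. radius D + radius E \<le> dist (centre D) (centre E)) P"
    and Q: "Q \<subseteq> P" "Q \<noteq> {}" and w: "\<And>D. D \<in> Q \<Longrightarrow> \<exists>Fs. wreath D Fs \<and> set Fs \<subseteq> Q"
    and \<gamma>: "\<And>D E F. D \<in> P \<Longrightarrow> E \<in> P \<Longrightarrow> F \<in> P \<Longrightarrow> ang (radius D) (radius E) (radius F) \<le> \<gamma>" "\<gamma> \<le> 2 * pi"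
    and c: "\<And>D E. D \<in> P \<Longrightarrow> E \<in> P \<Longrightarrow> radius D < (radius D + radius E) * cos (\<gamma> / 2)"
    and C: "\<And>D. D \<in> P \<Longrightarrow> radius D \<le> C"
  shows "Q = P"
proof (rule ccontr)
  assume "Q \<noteq> P"
  then obtain E where E: "E \<in> P" "E \<notin> Q" using Q by blast
  obtain D0 where D0: "D0 \<in> Q" using Q by blast
  \<comment> \<open>The power of the centre of the missing disc \<open>E\<close> with respect to
    each circle. Bounded radii turn a bound on the power into a bound on the distance, so a minimum
    over \<open>Q\<close> exists.\<close>
  define pw where "pw = (\<lambda>D. (dist (centre E) (centre D))\<^sup>2 - (radius D)\<^sup>2)"
  define M where "M = {D \<in> Q. pw D \<le> pw D0}"
  have "M \<subseteq> {D \<in> P. dist (centre E) (centre D) \<le> sqrt (\<bar>pw D0\<bar> + C\<^sup>2)}"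
  proof
    fix D assume D: "D \<in> M"
    then have DP: "D \<in> P" using Q by (auto simp: M_def)
    then have "(radius D)\<^sup>2 \<le> C\<^sup>2" using C[OF DP] pos by (intro power_mono) force+
    moreover have "pw D \<le> pw D0" using D by (simp add: M_def)
    moreover have "(dist (centre E) (centre D))\<^sup>2 = pw D + (radius D)\<^sup>2" by (simp add: pw_def)
    ultimately have "(dist (centre E) (centre D))\<^sup>2 \<le> \<bar>pw D0\<bar> + C\<^sup>2"
      using abs_ge_self[of "pw D0"] by linarith
    then show "D \<in> {D \<in> P. dist (centre E) (centre D) \<le> sqrt (\<bar>pw D0\<bar> + C\<^sup>2)}"
      using DP real_le_rsqrt by blast
  qed
  then have "finite M" using finite_subset finite_bounded_packing[OF pos pack] by blast
  moreover have "D0 \<in> M" using D0 by (simp add: M_def)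
  ultimately have "Min (pw ` M) \<in> pw ` M" "\<forall>F\<in>M. Min (pw ` M) \<le> pw F"
    using Min_in[of "pw ` M"] Min_le[of "pw ` M"] by blast+
  then obtain D where D: "D \<in> M" "\<forall>F\<in>M. pw D \<le> pw F" by auto
  then have DQ: "D \<in> Q" "D \<in> P" "D \<noteq> E" using Q E by (auto simp: M_def)
  obtain Fs where Fs: "wreath D Fs" "set Fs \<subseteq> Q" using w DQ by blast
  have rp: "radius F > 0" if "F \<in> P" for F using pos that by (meson less_le_trans)
  have Dp: "radius D > 0" and Ep: "radius E > 0" using rp DQ E by blast+
  have Fp: "\<forall>F\<in>set Fs. radius F > 0" using rp Fs Q by blast
  obtain F where F: "F \<in> set Fs" "(centre F - centre D) \<bullet> (centre E - centre D)
        \<ge> (radius D + radius F) * norm (centre E - centre D) * cos (\<gamma> / 2)"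
    using wreath_near[OF Dp Fp Fs(1) _ \<gamma>(2), of "centre E - centre D"] \<gamma>(1)[OF DQ(2)] Fs(2) Q(1)
    by blast
  have FQ: "F \<in> Q" "tangent D F" "radius F > 0" using F Fs wreath_tangent Fp by auto
  have cpos: "cos (\<gamma> / 2) > 0" 
  proof -
    have "0 < (radius D + radius E) * cos (\<gamma> / 2)" using c[OF DQ(2) E(1)] Dp by linarith
    then show ?thesis using Dp Ep by (simp add: zero_less_mult_iff)
  qed
  have "radius D + radius E \<le> norm (centre E - centre D)"
    using pairwiseD[OF pack DQ(2) E(1) DQ(3)] by (simp add: dist_norm norm_minus_commute)
  then have "(radius D + radius E) * cos (\<gamma> / 2) \<le> norm (centre E - centre D) * cos (\<gamma> / 2)"
    using cpos by (intro mult_right_mono) auto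
  then have "radius D < norm (centre E - centre D) * cos (\<gamma> / 2)" using c[OF DQ(2) E(1)] by simp
  then have "(radius D + radius F) * radius D < (radius D + radius F) * (norm (centre E - centre D) * cos (\<gamma> / 2))"
    using Dp FQ by (intro mult_strict_left_mono) auto
  \<comment> \<open>For \<open>F\<close> tangent to \<open>D\<close>, \<open>pw D - pw F\<close> is
    twice the difference of the two sides, so \<open>F\<close> contradicts the minimality of
    \<open>D\<close>.\<close>
  then have less: "(radius D + radius F) * radius D < (centre F - centre D) \<bullet> (centre E - centre D)"
    using F(2) by (simp add: mult.assoc)
  also have "\<dots> = ((radius D + radius F)\<^sup>2 + (dist (centre E) (centre D))\<^sup>2 - (dist (centre E) (centre F))\<^sup>2) / 2"
    using FQ by (simp add: inner_dist tangent_def dist_commute)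
  finally have "pw F < pw D" by (simp add: pw_def power2_eq_square field_simps)
  moreover from this have "F \<in> M" using D(1) FQ(1) by (simp add: M_def)
  ultimately show False using D(2) by force
qed

section \<open>Words of coronas\<close>

text \<open>The turn from \<open>E\<close> to \<open>F\<close> is at most \<gamma> and equals a
  partial angle sum of the corona. It is positive, and two steps already exceed \<gamma>; so
  \<open>F\<close> is reached after exactly one step.\<close>

lemma corona_next:
  assumes pos: "\<forall>E\<in>P. radius E > 0" and D: "D \<in> P"
    and \<gamma>: "\<And>E F. E \<in> P \<Longrightarrow> F \<in> P \<Longrightarrow>
      \<gamma> / 2 < ang (radius D) (radius E) (radius F) \<and> ang (radius D) (radius E) (radius F) \<le> \<gamma>"
    and c: "corona P D (E # Fs)" and F: "F \<in> P" "tri D E F"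
  shows "\<exists>Gs. Fs = F # Gs"
proof -
  define Es where "Es = E # Fs"
  have set: "set Es = {E \<in> P. tangent D E}" and w: "wreath D Es"
    using c by (simp_all add: corona_wreath Es_def)
  then have tri: "list_all2 (tri D) Es (rotate1 Es)" and p2: "psum D Es (length Es) = 2 * pi"
    by (auto simp: wreath_def psum_length)
  have Dp: "radius D > 0" and Fp: "radius F > 0" using pos D F by blast+
  have Ep: "\<forall>E\<in>set Es. radius E > 0" using pos set by blast
  have "F \<in> set Es" using F set by (simp add: tri_def tangent_sym)
  then obtain i where i: "i < length Es" "F = Es ! i" by (metis in_set_conv_nth)
  have E: "E \<in> set Es" "Es ! 0 = E" by (simp_all add: Es_def)
  then have E': "radius E > 0" "E \<in> P" using Ep set by blast+
  define t where "t = Arg2pi (centre E - centre D)"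
  define a where "a = ang (radius D) (radius E) (radius F)"
  have a: "0 < a" "a < pi" using ang_bounds[OF Dp E'(1) Fp] by (simp_all add: a_def)
  have k: "radius D + radius E \<noteq> 0" "radius D + radius F \<noteq> 0" using Dp E' Fp by simp_all
  have vE: "centre E - centre D = of_real (radius D + radius E) * cis t"
    using chain_args[OF Dp Ep tri, of 0] by (simp add: E t_def psum_def Es_def)
  have canc: "of_real (x / y) * (of_real y * z) * w = of_real x * (z * w)" if "y \<noteq> 0"
    for x y :: real and z w :: complex
    using that by simp
  have "centre F - centre D = of_real (radius D + radius F) * cis (t + a)"
    unfolding tri_step[OF Dp E'(1) Fp F(2)] vE canc[OF k(1)] a_def by (simp add: cis_mult)
  moreover have "centre F - centre D = of_real (radius D + radius F) * cis (t + psum D Es i)"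
    using chain_args[OF Dp Ep tri i(1)] by (simp add: E t_def i)
  ultimately have "of_real (radius D + radius F) * cis (t + psum D Es i) = of_real (radius D + radius F) * cis (t + a)"
    by simp
  then have "cis (t + psum D Es i) = cis (t + a)" using k(2) by (metis mult_cancel_left of_real_eq_0_iff)
  then have "cis (-t) * cis (t + psum D Es i) = cis (-t) * cis (t + a)" by simp
  then have "cis (psum D Es i) = cis a" by (simp add: cis_mult)
  then have "Arg2pi (of_real 1 * cis (psum D Es i)) = Arg2pi (of_real 1 * cis a)" by simp
  moreover have "0 \<le> psum D Es i" "psum D Es i < 2 * pi"
    using psum_strict[OF Dp Ep, of 0 i] psum_strict[OF Dp Ep i(1)] i p2
    by (cases "i = 0"; simp add: psum_def)+
  ultimately have eq: "psum D Es i = a" using a by (subst (asm) (1 2) Arg2pi_cis) auto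
  then have i0: "i \<noteq> 0" using a by (intro notI) (simp add: psum_def)
  have two: "psum D Es 2 > \<gamma>" if "2 \<le> length Es"
  proof -
    have m: "Es ! k \<in> P" if "k < length Es" for k using that set nth_mem by blast
    have l: "Suc 0 < length Es" using that by simp
    have "(Suc (Suc 0) mod length Es) < length Es" by (simp add: Es_def)
    with l have "ang (radius D) (radius (Es ! 0)) (radius (Es ! Suc 0)) > \<gamma> / 2"
      "ang (radius D) (radius (Es ! Suc 0)) (radius (Es ! (Suc (Suc 0) mod length Es))) > \<gamma> / 2"
      using \<gamma> m E E' by auto
    moreover have "psum D Es 2 = ang (radius D) (radius (Es ! 0)) (radius (Es ! Suc 0)) +
      ang (radius D) (radius (Es ! Suc 0)) (radius (Es ! (Suc (Suc 0) mod length Es)))"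
      using that by (simp add: psum_def numeral_2_eq_2)
    ultimately show ?thesis by simp
  qed
  have "i = 1"
  proof (rule ccontr)
    assume "i \<noteq> 1"
    then have "2 \<le> i" using i0 by simp
    then have "psum D Es 2 \<le> psum D Es i"
      using psum_strict[OF Dp Ep, of 2 i] i(1) by (cases "i = 2") auto
    then show False using two \<open>2 \<le> i\<close> i(1) eq \<gamma>[OF E'(2) F(1)] by (simp add: a_def)
  qed
  then show ?thesis using i by (cases Fs) (auto simp: Es_def)
qed

lemma corona_chain:
  assumes pos: "\<forall>E\<in>P. radius E > 0" and D: "D \<in> P"
    and \<gamma>: "\<And>E F. E \<in> P \<Longrightarrow> F \<in> P \<Longrightarrow>
      \<gamma> / 2 < ang (radius D) (radius E) (radius F) \<and> ang (radius D) (radius E) (radius F) \<le> \<gamma>"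
    and "corona P D (E # Fs)" "successively (tri D) (E # Gs)" "set Gs \<subseteq> P" "length Gs \<le> length Fs"
  shows "\<exists>Hs. Fs = Gs @ Hs"
  using assms(4-)
proof (induction Gs arbitrary: E Fs)
  case (Cons G Gs)
  then obtain Fs' where Fs': "Fs = G # Fs'"
    using corona_next[OF pos D \<gamma>, of E Fs G] by auto
  then have "corona P D (G # Fs' @ [E])" using corona_rotate1[OF Cons.prems(1)] by simp
  \<comment> \<open>The corona is rotated to start at \<open>G\<close>, with \<open>E\<close> now
    last; the length bound keeps \<open>Gs\<close> from reaching that final
    \<open>E\<close>.\<close>
  then obtain Hs where "Fs' @ [E] = Gs @ Hs" using Cons.IH[of G "Fs' @ [E]"] Cons.prems Fs' by auto
  then show ?case using Cons.prems(4) Fs' by (auto simp: append_eq_append_conv2)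
qed simp

section \<open>Cyclic words over the letters large (\<open>True\<close>) and small
  (\<open>False\<close>)\<close>

definition cnt :: "(bool \<Rightarrow> bool \<Rightarrow> bool) \<Rightarrow> bool list \<Rightarrow> nat" where
  "cnt p w = length (filter (\<lambda>(x, y). p x y) (zip w (rotate1 w)))"

lemma sum_list_pairs:
  fixes f :: "bool \<Rightarrow> bool \<Rightarrow> real"
  assumes "f False True = f True False"
  shows "sum_list (map (\<lambda>(x, y). f x y) ps) =
    length (filter (\<lambda>(x, y). x \<and> y) ps) * f True True +
    length (filter (\<lambda>(x, y). x \<noteq> y) ps) * f True False +
    length (filter (\<lambda>(x, y). \<not> x \<and> \<not> y) ps) * f False False"
proof (induction ps)
  case (Cons p ps)
  then show ?case using assms by (cases p; cases "fst p"; cases "snd p") (simp_all add: algebra_simps)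
qed simp

lemma length_pairs:
  "length (filter (\<lambda>(x, y). x \<and> y) ps) + length (filter (\<lambda>(x, y). x \<noteq> y) ps) +
    length (filter (\<lambda>(x, y). \<not> x \<and> \<not> y) ps) = length (ps :: (bool \<times> bool) list)"
proof (induction ps)
  case (Cons p ps)
  then show ?case by (cases p; cases "fst p"; cases "snd p") simp_all
qed simp

definition rots :: "'a list \<Rightarrow> 'a list list" where
  "rots w = map (\<lambda>m. rotate m w) [0..<length w]"

text \<open>The numbers \<open>a\<close>, \<open>b\<close>, \<open>c\<close> of adjacent pairs LL,
  mixed and SS determine the angle sum around a disc of given radius. The clauses are the
  constraints that a cyclic word puts on these numbers, and the words behind the triples that will
  survive; rotations are allowed since the first letter is arbitrary.\<close>

definition word_ok :: "bool list \<Rightarrow> bool" where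
  "word_ok w \<longleftrightarrow> (let a = cnt (\<and>) w; b = cnt (\<noteq>) w; c = cnt (\<lambda>x y. \<not> x \<and> \<not> y) w in
     even b \<and> (b = 0 \<longrightarrow> a = 0 \<or> c = 0) \<and>
     (a = 6 \<and> b = 0 \<and> c = 0 \<longrightarrow> w = [True, True, True, True, True, True]) \<and>
     (a = 3 \<and> b = 2 \<and> c = 2 \<longrightarrow> w \<in> set (rots [True, True, True, True, False, False, False])) \<and>
     (a = 0 \<and> b = 4 \<and> c = 4 \<longrightarrow>
        w \<in> set (rots [True, False, False, False, True, False, False, False]) \<or>
        w \<in> set (rots [True, False, False, True, False, False, False, False]) \<or>
        w \<in> set (rots [True, False, True, False, False, False, False, False])) \<and>
     (a = 1 \<and> b = 4 \<and> c = 0 \<longrightarrow> w \<in> set (rots [True, False, True, True, False])))"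

text \<open>All 511 words of length at most eight are checked by evaluation.\<close>

lemma words_ok_enum:
  "\<forall>n\<in>set [0..<9]. \<forall>w\<in>set (List.n_lists n [True, False]). word_ok w"
  by code_simp

lemma words_ok: "length w \<le> 8 \<Longrightarrow> word_ok w"
  using words_ok_enum by (auto simp: set_n_lists)

text \<open>
  With \<open>x = phi / pi\<close> the hypotheses \<open>eq\<close> of the next two lemmas say that the angles around a
  large and a small disc, respectively, sum to \<open>2 * pi\<close>.
\<close>

lemma large_counts:
  fixes a b c :: nat and x :: real
  assumes x: "2 / 9 < x" "x < 1 / 4" and n: "a + b + c \<le> 8" and e: "even b" "b = 0 \<longrightarrow> a = 0 \<or> c = 0"
    and eq: "real a / 3 + real b * (1 / 2 - x) + real c * x = 2"
  shows "a = 6 \<and> b = 0 \<and> c = 0 \<or> a = 3 \<and> b = 2 \<and> c = 2 \<or> a = 0 \<and> b = 4 \<and> c = 4"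
proof -
  have "b = 0 \<or> b = 2 \<or> b = 4 \<or> b = 6 \<or> b = 8" using n e(1) by presburger
  moreover have "c = 0 \<or> c = 1 \<or> c = 2 \<or> c = 3 \<or> c = 4 \<or> c = 5 \<or> c = 6 \<or> c = 7 \<or> c = 8"
    using n by linarith
  moreover have "a = 0 \<or> a = 1 \<or> a = 2 \<or> a = 3 \<or> a = 4 \<or> a = 5 \<or> a = 6 \<or> a = 7 \<or> a = 8"
    using n by linarith
  \<comment> \<open>In the surviving triples \<open>b = c\<close>, so \<open>x\<close> cancels from
    the equation. Every other triple violates a side condition or has no solution \<open>x\<close>
    in the given interval.\<close>
  ultimately show ?thesis
    by (elim disjE; use x n e eq in \<open>simp; fail\<close>)
qed

lemma small_counts:
  fixes a b c :: nat and x :: real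
  assumes x: "2 / 9 < x" "x < 1 / 4" and n: "a + b + c \<le> 6" and e: "even b" "b = 0 \<longrightarrow> a = 0 \<or> c = 0"
    and eq: "real a * (2 * x) + real b * (1 / 2 - x / 2) + real c / 3 = 2"
  shows "a = 1 \<and> b = 4 \<and> c = 0 \<or> a = 0 \<and> b = 0 \<and> c = 6"
proof -
  have "b = 0 \<or> b = 2 \<or> b = 4 \<or> b = 6" using n e(1) by presburger
  moreover have "c = 0 \<or> c = 1 \<or> c = 2 \<or> c = 3 \<or> c = 4 \<or> c = 5 \<or> c = 6" using n by linarith
  moreover have "a = 0 \<or> a = 1 \<or> a = 2 \<or> a = 3 \<or> a = 4 \<or> a = 5 \<or> a = 6" using n by linarith
  ultimately show ?thesis
    by (elim disjE; use x n e eq in \<open>simp; fail\<close>)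
qed

lemma ang_eqI:
  assumes "0 \<le> t" "t \<le> pi" "cos t = 1 - 2 * b * c / ((a + b) * (a + c))"
  shows "ang a b c = t"
  unfolding ang_def assms(3)[symmetric] using assms(1,2) by (rule arccos_cos)

section \<open>The angle \<open>phi\<close> and the angles of the packing\<close>

locale radius_root =
  fixes r :: real
  assumes r_pos: "0 < r" and r_less: "r < 1" and cubic: "8 * r ^ 3 + 3 * r\<^sup>2 - 2 * r - 1 = 0"
begin

lemma cubic': "8 * (r * (r * r)) + 3 * (r * r) = 2 * r + 1"
  using cubic by (simp add: power2_eq_square power3_eq_cube)

lemma r_bounds: "0.533 < r" "r < 0.534"
proof -
  have "\<bar>r - 0.5332964167\<bar> < 10 powi (-10)" by (rule radius_root_approx[OF r_pos cubic])
  also have "(10::real) powi (-10) < 0.0001" by (simp add: power_int_def power_divide)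
  finally have "r - 0.5332964167 < 0.0001 \<and> - (r - 0.5332964167) < 0.0001"
    by (simp only: abs_less_iff)
  then show "0.533 < r" "r < 0.534" by simp_all
qed

definition phi :: real where "phi = ang 1 r r"

lemma cos_phi: "cos phi = 1 - 2 * r\<^sup>2 / (1 + r)\<^sup>2"
  unfolding phi_def using r_pos by (simp add: cos_ang power2_eq_square)

lemma cos_phi_bounds: "0.75 < cos phi" "cos phi < 0.759"
proof -
  have p: "(1 + r)\<^sup>2 > 0" using r_pos by simp
  have rr: "r * r \<ge> 0.533 * 0.533" "r * r \<le> 0.534 * 0.534"
    using r_bounds by (intro mult_mono; simp)+
  show "0.75 < cos phi" "cos phi < 0.759" unfolding cos_phi using p rr r_bounds
    by (simp_all add: field_simps power2_eq_square)
qed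

lemma phi_pos: "0 < phi" "phi < pi"
  unfolding phi_def using r_pos by (auto intro!: ang_bounds)

lemma phi_less_half: "phi < pi / 2"
proof (rule ccontr)
  assume "\<not> phi < pi / 2"
  then have "cos phi \<le> cos (pi / 2)" using phi_pos by (intro cos_monotone_0_pi_le) auto
  then show False using cos_phi_bounds by simp
qed

text \<open>This is where the cubic enters the trigonometry: with \<open>u = (1 + r)\<^sup>2\<close>
  it is equivalent to \<open>(u - 2 * r\<^sup>2)\<^sup>2 = u\<^sup>2 - u\<close>. The right side of
  the lemma is the cosine of the angle between two touching large discs at a small one.\<close>

lemma cos_2phi: "cos (2 * phi) = 1 - 2 / (1 + r)\<^sup>2"
proof -
  define u where "u = (1 + r)\<^sup>2"
  have u: "u > 0" using r_pos by (simp add: u_def)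
  have "(u - 2 * r\<^sup>2)\<^sup>2 = u\<^sup>2 - u"
    using cubic by (simp add: u_def power2_eq_square power3_eq_cube algebra_simps)
  then have "2 * (u - 2 * r\<^sup>2)\<^sup>2 / u\<^sup>2 - 1 = (2 * (u\<^sup>2 - u) - u\<^sup>2) / u\<^sup>2"
    using u by (simp add: field_simps)
  also have "\<dots> = 1 - 2 / u" using u by (simp add: field_simps power2_eq_square)
  finally have "2 * (u - 2 * r\<^sup>2)\<^sup>2 / u\<^sup>2 - 1 = 1 - 2 / u" .
  moreover have "cos phi = (u - 2 * r\<^sup>2) / u" using u by (simp add: cos_phi u_def[symmetric] field_simps)
  ultimately show ?thesis by (simp add: cos_double_cos power_divide u_def[symmetric])
qed

lemma phi_less: "phi < pi / 4"
proof (rule ccontr)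
  assume "\<not> phi < pi / 4"
  then have "cos (2 * phi) \<le> cos (pi / 2)" using phi_less_half by (intro cos_monotone_0_pi_le) auto
  moreover have "1 - 2 / (1 + r)\<^sup>2 > 0"
  proof -
    have "1.533 * 1.533 \<le> (1 + r) * (1 + r)" using r_bounds by (intro mult_mono) auto
    then have "(1 + r)\<^sup>2 > 2" by (simp add: power2_eq_square)
    then show ?thesis by (simp add: divide_less_eq)
  qed
  ultimately show False by (simp add: cos_2phi)
qed

text \<open>With \<open>c = cos phi\<close> between 0.75 and 0.759,
  \<open>cos (3 * phi) = c * (4 * c\<^sup>2 - 3)\<close> lies below
  \<open>-1/2 = cos (2 * pi / 3)\<close>.\<close>

lemma phi_greater: "2 * pi / 9 < phi"
proof (rule ccontr)
  define c where "c = cos phi"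
  assume "\<not> 2 * pi / 9 < phi"
  then have "cos (2 * pi / 3) \<le> cos (3 * phi)" using phi_pos by (intro cos_monotone_0_pi_le) auto
  moreover have "cos (2 * pi / 3) = - 1 / 2" by (simp add: cos_120)
  moreover have "cos (3 * phi) = 4 * c ^ 3 - 3 * c" by (simp add: cos_treble_cos c_def)
  moreover have "c ^ 3 \<le> c * (0.759 * 0.759)"
  proof -
    have "c * c \<le> 0.759 * 0.759" using cos_phi_bounds by (intro mult_mono) (auto simp: c_def)
    then have "c * (c * c) \<le> c * (0.759 * 0.759)"
      using cos_phi_bounds by (intro mult_left_mono) (auto simp: c_def)
    then show ?thesis by (simp add: power3_eq_cube mult.assoc)
  qed
  ultimately show False using cos_phi_bounds by (simp add: c_def)
qed

lemma sin_phi: "sin phi = 1 / (1 + r)"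
proof -
  have "(sin phi)\<^sup>2 = (1 - cos (2 * phi)) / 2"
    by (simp add: cos_double_sin)
  also have "\<dots> = (1 / (1 + r))\<^sup>2" by (simp add: cos_2phi power_divide)
  finally show ?thesis using r_pos phi_pos by (simp add: power2_eq_iff_nonneg sin_ge_zero)
qed

lemma sin_half_phi: "sin (phi / 2) = r / (1 + r)"
proof -
  have "cos phi = 1 - 2 * (sin (phi / 2))\<^sup>2" using cos_double_sin[of "phi / 2"] by simp
  then have "(sin (phi / 2))\<^sup>2 = (r / (1 + r))\<^sup>2" by (simp add: cos_phi power_divide)
  then show ?thesis using r_pos phi_pos by (simp add: power2_eq_iff_nonneg sin_ge_zero)
qed

text \<open>The mixed angles are complements of \<open>phi\<close> and \<open>phi / 2\<close>
  because the law of cosines gives them the cosines \<open>1 / (1 + r)\<close> and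
  \<open>r / (1 + r)\<close>, the sines of those two angles.\<close>

lemma ang_values:
  "ang 1 1 1 = pi / 3" "ang r r r = pi / 3" "ang 1 r r = phi" "ang r 1 1 = 2 * phi"
  "ang 1 1 r = pi / 2 - phi" "ang 1 r 1 = pi / 2 - phi"
  "ang r 1 r = pi / 2 - phi / 2" "ang r r 1 = pi / 2 - phi / 2"
proof -
  show "ang 1 1 1 = pi / 3" "ang r r r = pi / 3"
    by (rule ang_eqI; use r_pos in \<open>simp add: cos_60\<close>)+
  show "ang 1 r r = phi" by (simp add: phi_def)
  show "ang r 1 1 = 2 * phi"
    by (rule ang_eqI) (use phi_pos phi_less_half in \<open>simp_all add: cos_2phi power2_eq_square add.commute\<close>)
  show 1: "ang 1 1 r = pi / 2 - phi"
  proof (rule ang_eqI)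
    show "cos (pi / 2 - phi) = 1 - 2 * 1 * r / ((1 + 1) * (1 + r))"
      using r_pos unfolding cos_diff cos_pi_half sin_pi_half sin_phi by (simp add: divide_simps)
  qed (use phi_pos phi_less_half in simp_all)
  show 2: "ang r 1 r = pi / 2 - phi / 2"
  proof (rule ang_eqI)
    have "r * 2 + r * (r * 2) > 0" using r_pos by (intro add_pos_pos mult_pos_pos) auto
    then show "cos (pi / 2 - phi / 2) = 1 - 2 * 1 * r / ((r + 1) * (r + r))"
      using r_pos unfolding cos_diff cos_pi_half sin_pi_half sin_half_phi by (simp add: field_simps)
  qed (use phi_pos phi_less_half in simp_all)
  show "ang 1 r 1 = pi / 2 - phi" "ang r r 1 = pi / 2 - phi / 2" using 1 2 by (simp_all add: ang_sym)
qed

text \<open>The largest angle at a disc of radius \<open>a\<close>: between two large neighbours in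
  both cases. By the bounds on \<open>phi\<close> every other angle at the disc is more than half of
  it.\<close>

definition max_ang :: "real \<Rightarrow> real" where
  "max_ang a = (if a = 1 then pi / 3 else 2 * phi)"

lemma ang_range:
  assumes "a \<in> {1, r}" "b \<in> {1, r}" "c \<in> {1, r}"
  shows "max_ang a / 2 < ang a b c" "ang a b c \<le> max_ang a" "ang a b c \<le> pi / 2"
  using assms phi_less phi_greater r_less by (auto simp: max_ang_def ang_values)

lemma cp_radius: "compact_packing_using r P \<Longrightarrow> D \<in> P \<Longrightarrow> radius D \<in> {1, r}"
  unfolding compact_packing_using_def by blast

lemma cp_pos: "compact_packing_using r P \<Longrightarrow> \<forall>D\<in>P. radius D > 0"
  using cp_radius r_pos by fastforce

lemma cp_pack:
  "compact_packing_using r P \<Longrightarrow>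
    pairwise (\<lambda>D E. radius D + radius E \<le> dist (centre D) (centre E)) P"
  by (simp add: compact_packing_using_def compact_packing_iff)

lemma cp_corona: "compact_packing_using r P \<Longrightarrow> D \<in> P \<Longrightarrow> \<exists>Fs. corona P D Fs"
  by (simp add: compact_packing_using_def compact_packing_iff)

lemma corona_mem: "corona P D Fs \<Longrightarrow> F \<in> set Fs \<Longrightarrow> F \<in> P"
  by (simp add: corona_def)

lemma cp_ang_range:
  assumes "compact_packing_using r P" "D \<in> P" "E \<in> P" "F \<in> P"
  shows "max_ang (radius D) / 2 < ang (radius D) (radius E) (radius F) \<and>
    ang (radius D) (radius E) (radius F) \<le> max_ang (radius D)"
    "ang (radius D) (radius E) (radius F) \<le> pi / 2"
  using ang_range[OF assms(2-4)[THEN cp_radius[OF assms(1)]]] by simp_all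

lemma cp_chain:
  assumes "compact_packing_using r P" "D \<in> P" "corona P D (E # Fs)"
    "successively (tri D) (E # Gs)" "set Gs \<subseteq> P" "length Gs \<le> length Fs"
  shows "\<exists>Hs. Fs = Gs @ Hs"
  using corona_chain[OF cp_pos[OF assms(1)] assms(2) cp_ang_range(1)[OF assms(1,2)] assms(3-6)] .

text \<open>Connectedness in the form used throughout: a part of a packing in which every disc is
  surrounded is the whole packing.\<close>

lemma cp_subpacking_eq:
  assumes P: "pairwise (\<lambda>D E. radius D + radius E \<le> dist (centre D) (centre E)) P"
    "\<And>D. D \<in> P \<Longrightarrow> radius D \<in> {1, r}"
    and Q: "Q \<subseteq> P" "Q \<noteq> {}" "\<And>D. D \<in> Q \<Longrightarrow> \<exists>Fs. wreath D Fs \<and> set Fs \<subseteq> Q"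
  shows "Q = P"
proof (rule closed_subpacking_eq[where c = r and C = 1 and \<gamma> = "pi / 2", OF r_pos _ P(1) Q])
  show "\<forall>D\<in>P. r \<le> radius D" using P(2) r_less by fastforce
  show "radius D \<le> 1" if "D \<in> P" for D using P(2)[OF that] r_less by auto
  show "ang (radius D) (radius E) (radius F) \<le> pi / 2" if "D \<in> P" "E \<in> P" "F \<in> P" for D E F
    using ang_range(3)[OF P(2) P(2) P(2)] that by blast
  \<comment> \<open>\<open>cos (pi / 4)\<close> is replaced by 0.7. The tight case is a large
    \<open>D\<close> and a small \<open>E\<close>, where \<open>(1 + r) * 0.7\<close> just exceeds
    1.\<close>
  have "7 / 5 < sqrt 2" by (rule real_less_rsqrt) (simp add: power2_eq_square)
  then have c: "cos (pi / 2 / 2) > 0.7" "cos (pi / 2 / 2) > 0" by (simp_all add: cos_45)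
  have "1 < (1 + r) * 0.7" using r_bounds by simp
  also have "(1 + r) * 0.7 < (1 + r) * cos (pi / 2 / 2)" using c r_pos by (intro mult_strict_left_mono) auto
  finally have 1: "1 < (1 + r) * cos (pi / 2 / 2)" .
  have "(r + r) * 0.7 < (r + r) * cos (pi / 2 / 2)" using c r_pos by (intro mult_strict_left_mono) auto
  then have 2: "r < (r + r) * cos (pi / 2 / 2)" using r_pos by simp
  also have "\<dots> < (r + 1) * cos (pi / 2 / 2)" using c r_less by (intro mult_strict_right_mono) auto
  finally have 3: "r < (r + 1) * cos (pi / 2 / 2)" .
  have 4: "1 < (1 + 1) * cos (pi / 2 / 2)" using c by simp
  show "radius D < (radius D + radius E) * cos (pi / 2 / 2)" if "D \<in> P" "E \<in> P" for D E
    using P(2)[OF that(1)] P(2)[OF that(2)] 1 2 3 4 by (elim insertE emptyE) simp_all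
  show "pi / 2 \<le> 2 * pi" using pi_ge_zero by linarith
qed

definition letter :: "bool \<Rightarrow> real" where "letter b = (if b then 1 else r)"

lemma sum_word:
  assumes "\<And>F. F \<in> set Fs \<Longrightarrow> radius F \<in> {1, r}" and w: "w = map (\<lambda>F. radius F = 1) Fs"
  shows "sum_list (map2 (\<lambda>E F. ang a (radius E) (radius F)) Fs (rotate1 Fs)) =
    cnt (\<and>) w * ang a 1 1 + cnt (\<noteq>) w * ang a 1 r + cnt (\<lambda>x y. \<not> x \<and> \<not> y) w * ang a r r"
    "map radius Fs = map letter w"
proof -
  have v: "radius F = letter (radius F = 1)" if "F \<in> set Fs" for F
    using assms(1)[OF that] by (auto simp: letter_def)
  then show "map radius Fs = map letter w" by (simp add: w)
  have "map2 (\<lambda>E F. ang a (radius E) (radius F)) Fs (rotate1 Fs) =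
      map2 (\<lambda>E F. ang a (letter (radius E = 1)) (letter (radius F = 1))) Fs (rotate1 Fs)"
  proof (intro map_cong refl)
    fix p assume "p \<in> set (zip Fs (rotate1 Fs))"
    moreover obtain E F where p: "p = (E, F)" by (cases p)
    ultimately have "E \<in> set Fs" "F \<in> set Fs" using set_zip_leftD set_zip_rightD by (fastforce, fastforce)
    from arg_cong2[where f = "ang a", OF v[OF this(1)] v[OF this(2)]]
    show "(case p of (E, F) \<Rightarrow> ang a (radius E) (radius F)) =
      (case p of (E, F) \<Rightarrow> ang a (letter (radius E = 1)) (letter (radius F = 1)))" by (simp only: p prod.case)
  qed
  also have "\<dots> = map (\<lambda>(x, y). ang a (letter x) (letter y)) (zip w (rotate1 w))"
    by (simp add: w rotate1_map zip_map_map split_def o_def)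
  finally show "sum_list (map2 (\<lambda>E F. ang a (radius E) (radius F)) Fs (rotate1 Fs)) =
    cnt (\<and>) w * ang a 1 1 + cnt (\<noteq>) w * ang a 1 r + cnt (\<lambda>x y. \<not> x \<and> \<not> y) w * ang a r r"
    using sum_list_pairs[of "\<lambda>x y. ang a (letter x) (letter y)" "zip w (rotate1 w)"]
    by (simp add: ang_sym letter_def cnt_def)
qed

lemma phi_ratio: "2 / 9 < phi / pi" "phi / pi < 1 / 4"
  using phi_less phi_greater pi_gt_zero by (simp_all add: field_simps)

lemma rots_map: "w \<in> set (rots u) \<Longrightarrow> map f w \<in> set (rots (map f u))"
  by (auto simp: rots_def rotate_map)

text \<open>Everything that the angle sum allows around a large disc. The last word, LSLSSSSS, is
  still present: it has the same pair counts as the two words before it.\<close>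

lemma large_words_raw:
  assumes cp: "compact_packing_using r P" and D: "D \<in> P" "radius D = 1" and c: "corona P D Fs"
  shows "map radius Fs = [1, 1, 1, 1, 1, 1] \<or> map radius Fs \<in> set (rots [1, 1, 1, 1, r, r, r]) \<or>
    map radius Fs \<in> set (rots [1, r, r, r, 1, r, r, r]) \<or> map radius Fs \<in> set (rots [1, r, r, 1, r, r, r, r]) \<or>
    map radius Fs \<in> set (rots [1, r, 1, r, r, r, r, r])"
proof -
  define w where "w = map (\<lambda>F. radius F = 1) Fs"
  define A B C x where "A = cnt (\<and>) w" and "B = cnt (\<noteq>) w" and "C = cnt (\<lambda>x y. \<not> x \<and> \<not> y) w"
    and "x = phi / pi"
  note s = sum_word[OF cp_radius[OF cp corona_mem[OF c]] w_def]
  have "real A * (pi / 3) + real B * (pi / 2 - phi) + real C * phi = 2 * pi"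
    using c s(1)[of 1] D by (simp add: corona_def A_def B_def C_def ang_values)
  then have "(real A * (pi / 3) + real B * (pi / 2 - phi) + real C * phi) / pi = 2" by simp
  moreover have "(real A * (pi / 3) + real B * (pi / 2 - phi) + real C * phi) / pi =
      real A / 3 + real B * (1 / 2 - x) + real C * x" by (simp add: x_def field_simps)
  ultimately have eq: "real A / 3 + real B * (1 / 2 - x) + real C * x = 2" by simp
  have n: "A + B + C = length w" unfolding A_def B_def C_def cnt_def using length_pairs[of "zip w (rotate1 w)"] by simp
  have x: "2 / 9 < x" "x < 1 / 4" using phi_ratio by (simp_all add: x_def)
  \<comment> \<open>Each angle is at least \<open>phi\<close> and nine times \<open>phi\<close>
    exceeds a full turn, so there are at most eight neighbours.\<close>
  have "real A * x \<le> real A * (1 / 3)" "real B * x \<le> real B * (1 / 2 - x)"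
    using x by (intro mult_left_mono; simp)+
  then have "(real A + real B + real C) * x \<le> 2" using eq by (simp add: algebra_simps)
  moreover have "9 * x > 2" using x by simp
  ultimately have "(real A + real B + real C) * x < 9 * x" by linarith
  then have "real A + real B + real C < 9" using x mult_right_less_imp_less[of _ x 9] by simp
  then have "real (A + B + C) < 9" by simp
  then have "A + B + C \<le> 8" by linarith
  then have "word_ok w" and le: "A + B + C \<le> 8" using words_ok n by auto
  then have ok: "even B" "B = 0 \<longrightarrow> A = 0 \<or> C = 0"
     "A = 6 \<and> B = 0 \<and> C = 0 \<longrightarrow> w = [True, True, True, True, True, True]"
     "A = 3 \<and> B = 2 \<and> C = 2 \<longrightarrow> w \<in> set (rots [True, True, True, True, False, False, False])"
     "A = 0 \<and> B = 4 \<and> C = 4 \<longrightarrow>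
        w \<in> set (rots [True, False, False, False, True, False, False, False]) \<or>
        w \<in> set (rots [True, False, False, True, False, False, False, False]) \<or>
        w \<in> set (rots [True, False, True, False, False, False, False, False])"
    unfolding word_ok_def Let_def A_def[symmetric] B_def[symmetric] C_def[symmetric] by blast+
  have "w = [True, True, True, True, True, True] \<or>
    w \<in> set (rots [True, True, True, True, False, False, False]) \<or>
    w \<in> set (rots [True, False, False, False, True, False, False, False]) \<or>
    w \<in> set (rots [True, False, False, True, False, False, False, False]) \<or>
    w \<in> set (rots [True, False, True, False, False, False, False, False])"
    using large_counts[OF x le ok(1,2) eq] ok(3-5) by blast
  moreover have "map radius Fs \<in> set (rots (map letter u))" if "w \<in> set (rots u)" for u
    using rots_map[OF that, of letter] by (simp only: s(2))
  moreover have "map radius Fs = map letter u" if "w = u" for u using s(2) that by simp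
  ultimately have "map radius Fs = map letter [True, True, True, True, True, True] \<or>
    map radius Fs \<in> set (rots (map letter [True, True, True, True, False, False, False])) \<or>
    map radius Fs \<in> set (rots (map letter [True, False, False, False, True, False, False, False])) \<or>
    map radius Fs \<in> set (rots (map letter [True, False, False, True, False, False, False, False])) \<or>
    map radius Fs \<in> set (rots (map letter [True, False, True, False, False, False, False, False]))"
    by blast
  then show ?thesis by (simp only: letter_def list.map if_True if_False)
qed

text \<open>The second alternative is a ring of six small discs. Its angles \<open>pi / 3\<close>
  sum correctly, so no angle count can remove it.\<close>

lemma small_words_raw:
  assumes cp: "compact_packing_using r P" and D: "D \<in> P" "radius D = r" and c: "corona P D Fs"
  shows "map radius Fs \<in> set (rots [1, r, 1, 1, r]) \<or> (\<forall>F\<in>set Fs. radius F = r)"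
proof -
  define w where "w = map (\<lambda>F. radius F = 1) Fs"
  define A B C x where "A = cnt (\<and>) w" and "B = cnt (\<noteq>) w" and "C = cnt (\<lambda>x y. \<not> x \<and> \<not> y) w"
    and "x = phi / pi"
  note s = sum_word[OF cp_radius[OF cp corona_mem[OF c]] w_def]
  have "real A * (2 * phi) + real B * (pi / 2 - phi / 2) + real C * (pi / 3) = 2 * pi"
    using c s(1)[of r] D by (simp add: corona_def A_def B_def C_def ang_values ang_sym[of r 1 r])
  then have "(real A * (2 * phi) + real B * (pi / 2 - phi / 2) + real C * (pi / 3)) / pi = 2" by simp
  moreover have "(real A * (2 * phi) + real B * (pi / 2 - phi / 2) + real C * (pi / 3)) / pi =
      real A * (2 * x) + real B * (1 / 2 - x / 2) + real C / 3" by (simp add: x_def field_simps)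
  ultimately have eq: "real A * (2 * x) + real B * (1 / 2 - x / 2) + real C / 3 = 2" by simp
  have n: "A + B + C = length w" unfolding A_def B_def C_def cnt_def using length_pairs[of "zip w (rotate1 w)"] by simp
  have x: "2 / 9 < x" "x < 1 / 4" using phi_ratio by (simp_all add: x_def)
  \<comment> \<open>Each angle at a small disc is at least \<open>pi / 3\<close>, so there are at
    most six neighbours.\<close>
  have "real A * (1 / 3) \<le> real A * (2 * x)" "real B * (1 / 3) \<le> real B * (1 / 2 - x / 2)"
    using x by (intro mult_left_mono; simp)+
  then have "real (A + B + C) \<le> 6" using eq unfolding of_nat_add by linarith
  then have le: "A + B + C \<le> 6" by linarith
  then have "word_ok w" using words_ok n by auto
  then have ok: "even B" "B = 0 \<longrightarrow> A = 0 \<or> C = 0"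
     "A = 1 \<and> B = 4 \<and> C = 0 \<longrightarrow> w \<in> set (rots [True, False, True, True, False])"
    unfolding word_ok_def Let_def A_def[symmetric] B_def[symmetric] C_def[symmetric] by blast+
  from small_counts[OF x le ok(1,2) eq] show ?thesis
  proof
    assume "A = 1 \<and> B = 4 \<and> C = 0"
    then have "w \<in> set (rots [True, False, True, True, False])" using ok by blast
    from rots_map[OF this, of letter] have "map radius Fs \<in> set (rots (map letter [True, False, True, True, False]))"
      by (simp only: s(2))
    then show ?thesis by (simp only: letter_def list.map if_True if_False simp_thms)
  next
    assume *: "A = 0 \<and> B = 0 \<and> C = 6"
    have "length (filter (\<lambda>(x, y). \<not> x \<and> \<not> y) (zip w (rotate1 w))) = length (zip w (rotate1 w))"
      using * n by (simp add: C_def cnt_def)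
    then have all: "\<forall>p\<in>set (zip w (rotate1 w)). \<not> fst p"
      by (metis (mono_tags, lifting) length_filter_less nat_neq_iff split_beta)
    have "\<not> w ! i" if "i < length w" for i
    proof -
      have "(w ! i, rotate1 w ! i) \<in> set (zip w (rotate1 w))" using that by (auto simp: set_zip)
      then show ?thesis using all by fastforce
    qed
    then have "\<forall>b\<in>set w. \<not> b" by (metis in_set_conv_nth)
    then show ?thesis using cp_radius[OF cp corona_mem[OF c]] by (auto simp: w_def)
  qed
qed

end

lemma rots_simps:
  "rots [a, b, c, d, e] = [[a, b, c, d, e], [b, c, d, e, a], [c, d, e, a, b], [d, e, a, b, c], [e, a, b, c, d]]"
  "rots [a, b, c, d, e, f, g] = [[a, b, c, d, e, f, g], [b, c, d, e, f, g, a], [c, d, e, f, g, a, b],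
     [d, e, f, g, a, b, c], [e, f, g, a, b, c, d], [f, g, a, b, c, d, e], [g, a, b, c, d, e, f]]"
  "rots [a, b, c, d, e, f, g, h] = [[a, b, c, d, e, f, g, h], [b, c, d, e, f, g, h, a],
     [c, d, e, f, g, h, a, b], [d, e, f, g, h, a, b, c], [e, f, g, h, a, b, c, d],
     [f, g, h, a, b, c, d, e], [g, h, a, b, c, d, e, f], [h, a, b, c, d, e, f, g]]"
  by (simp_all add: rots_def upt_rec rotate_def eval_nat_numeral)

lemma rots_unrotate: "u \<in> set (rots w) \<Longrightarrow> \<exists>k. rotate k u = w"
proof -
  assume "u \<in> set (rots w)"
  then obtain m where m: "u = rotate m w" "m < length w" by (auto simp: rots_def)
  have "rotate (length w - m) u = rotate (length w) w" using m by (simp add: rotate_rotate)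
  then show ?thesis by auto
qed

lemma tangent_irrefl: "radius D > 0 \<Longrightarrow> \<not> tangent D D"
  by (simp add: tangent_def)

lemma corona_ends:
  assumes c: "corona P D (N # Gs)" and "radius N > 0"
  obtains F L where "tri D N F" "tri D L N" "F \<in> P" "L \<in> P" "F \<in> set Gs" "L \<in> set Gs"
proof -
  have l: "list_all2 (tri D) (N # Gs) (Gs @ [N])" and s: "set (N # Gs) \<subseteq> P"
    using c by (auto simp: corona_def)
  have G: "Gs \<noteq> []" using l tangent_irrefl[OF assms(2)] by (auto simp: tri_def)
  then obtain F Gs' where F: "Gs = F # Gs'" by (cases Gs) auto
  obtain bs L where L: "Gs = bs @ [L]" using G by (metis append_butlast_last_id)
  have "list_all2 (tri D) ((N # bs) @ [L]) ((bs @ [L]) @ [N])" using l by (simp add: L)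
  then have "tri D L N" by (subst (asm) list_all2_append) auto
  moreover have "tri D N F" using l F by simp
  moreover have "F \<in> set Gs" unfolding F by simp
  moreover have "L \<in> set Gs" unfolding L by simp
  ultimately show thesis using s by (intro that[of F L]) auto
qed

text \<open>Turns tangency and orientation into polynomial conditions on coordinates; all concrete
  triangles are checked through it.\<close>

lemma tri_Complex:
  assumes "(x2 - x1)\<^sup>2 + (y2 - y1)\<^sup>2 = (p1 + p2)\<^sup>2" "(x3 - x2)\<^sup>2 + (y3 - y2)\<^sup>2 = (p2 + p3)\<^sup>2"
    "(x1 - x3)\<^sup>2 + (y1 - y3)\<^sup>2 = (p3 + p1)\<^sup>2"
    "(x2 - x1) * (y3 - y1) > (y2 - y1) * (x3 - x1)" "p1 > 0" "p2 > 0" "p3 > 0"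
  shows "tri (Complex x1 y1, p1) (Complex x2 y2, p2) (Complex x3 y3, p3)"
proof -
  have "dist (Complex x y) (Complex x' y') = p" if "(x' - x)\<^sup>2 + (y' - y)\<^sup>2 = p\<^sup>2" "p > 0" for x y x' y' p
  proof -
    have "(x - x')\<^sup>2 + (y - y')\<^sup>2 = p\<^sup>2" using that(1) by (simp add: power2_commute)
    then show ?thesis using that(2) by (simp add: dist_norm cmod_def)
  qed
  moreover have "(x2 - x1) * (y3 - y1) + (y1 - y2) * (x3 - x1) > 0" using assms(4) by (simp add: algebra_simps)
  ultimately show ?thesis using assms by (simp add: tri_def tangent_def)
qed

section \<open>Removing the words that only the angle sums allow\<close>

context radius_root
begin

text \<open>The property of having only small neighbours spreads to each neighbour. By connectedness
  all discs would be small, but radius 1 occurs.\<close>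

lemma no_small_only_corona:
  assumes cp: "compact_packing_using r P" and D: "D \<in> P" "radius D = r" "corona P D Fs"
  shows "\<not> (\<forall>F\<in>set Fs. radius F = r)"
proof
  define Q where "Q = {D \<in> P. radius D = r \<and> (\<exists>Fs. corona P D Fs \<and> (\<forall>F\<in>set Fs. radius F = r))}"
  assume "\<forall>F\<in>set Fs. radius F = r"
  then have "D \<in> Q" using D by (auto simp: Q_def)
  have cl: "\<exists>Fs. wreath D Fs \<and> set Fs \<subseteq> Q" if "D \<in> Q" for D
  proof -
    obtain Fs where Fs: "corona P D Fs" "\<forall>F\<in>set Fs. radius F = r" and DP: "D \<in> P" "radius D = r"
      using \<open>D \<in> Q\<close> by (auto simp: Q_def)
    have "N \<in> Q" if N: "N \<in> set Fs" for N
    proof -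
      have NP: "N \<in> P" "tangent D N" using N Fs(1) by (auto simp: corona_def)
      have Nr: "radius N = r" using N Fs(2) by blast
      obtain Gs m where G: "corona P D (N # Gs)" "N # Gs = rotate m Fs"
        using corona_head[OF Fs(1) NP(1,2)] .
      obtain F L where FL: "tri D N F" "tri D L N" "F \<in> P" "L \<in> P" "F \<in> set Gs" "L \<in> set Gs"
        using corona_ends[OF G(1)] Nr r_pos by metis
      have "set (N # Gs) = set Fs" unfolding G(2) by simp
      then have rad: "radius F = r" "radius L = r" using Fs(2) FL by auto
      obtain Hs0 where H0: "corona P N Hs0" using cp_corona[OF cp NP(1)] by blast
      have "tangent N F" using FL by (simp add: tri_def)
      then obtain Hs where H: "corona P N (F # Hs)" using corona_head[OF H0 FL(3)] by blast
      from small_words_raw[OF cp NP(1) Nr H] show "N \<in> Q"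
      proof
        assume w: "map radius (F # Hs) \<in> set (rots [1, r, 1, 1, r])"
        then have "length Hs = 4" by (auto simp: rots_simps dest: arg_cong[where f = length])
        \<comment> \<open>Around the neighbour \<open>N\<close> the discs \<open>F\<close>,
          \<open>D\<close>, \<open>L\<close> are three consecutive small ones, which LSLLS does not
          contain.\<close>
        moreover have "tri N F D" "tri N D L" using FL tri_cycle by blast+
        ultimately obtain Hs' where "Hs = [D, L] @ Hs'"
          using cp_chain[OF cp NP(1) H, of "[D, L]"] DP FL by auto
        then show "N \<in> Q" using w r_less by (auto simp: rots_simps rad DP)
      next
        assume "\<forall>E\<in>set (F # Hs). radius E = r"
        then show "N \<in> Q" unfolding Q_def using NP Nr H by blast
      qed
    qed
    then show ?thesis using Fs(1) corona_wreath by blast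
  qed
  have "Q = P"
  proof (rule cp_subpacking_eq[OF cp_pack[OF cp] cp_radius[OF cp]])
    show "Q \<subseteq> P" by (auto simp: Q_def)
    show "Q \<noteq> {}" using \<open>D \<in> Q\<close> by blast
  qed (use cl in auto)
  have "1 \<in> radius ` P" using cp by (simp add: compact_packing_using_def)
  then obtain E where E: "1 = radius E" "E \<in> P" by (rule imageE)
  then have "E \<in> Q" using \<open>Q = P\<close> by simp
  then have "radius E = r" by (simp add: Q_def)
  then show False using E r_less by simp
qed

lemma small_words:
  assumes "compact_packing_using r P" "D \<in> P" "radius D = r" "corona P D Fs"
  shows "map radius Fs \<in> set (rots [1, r, 1, 1, r])"
  using small_words_raw[OF assms] no_small_only_corona[OF assms] by blast

text \<open>The standard way to find new discs: a known chain of neighbours begins some corona, and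
  the admissible words then tell the radii of the rest.\<close>

lemma corona_extend:
  assumes cp: "compact_packing_using r P" and D: "D \<in> P"
    and E: "tangent D E" "successively (tri D) (E # Es)" "set (E # Es) \<subseteq> P"
    and l: "\<And>Fs. corona P D Fs \<Longrightarrow> length Es < length Fs"
  shows "\<exists>Hs. corona P D (E # Es @ Hs)"
proof -
  obtain Fs where "corona P D Fs" using cp_corona[OF cp D] by blast
  moreover have "E \<in> P" using E by simp
  ultimately obtain Gs where G: "corona P D (E # Gs)" using corona_head[OF _ _ E(1)] by metis
  then obtain Hs where "Gs = Es @ Hs"
    using cp_chain[OF cp D G E(2)] E(3) l[OF G] by auto
  then show ?thesis using G by blast
qed

lemma small_corona:
  assumes cp: "compact_packing_using r P" and D: "D \<in> P" "radius D = r"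
    and E: "tangent D E" "successively (tri D) (E # Es)" "set (E # Es) \<subseteq> P" and l: "length Es < 5"
  shows "\<exists>Hs. corona P D (E # Es @ Hs) \<and> map radius (E # Es @ Hs) \<in> set (rots [1, r, 1, 1, r])"
proof -
  have "length Fs = 5" if "corona P D Fs" for Fs
    using small_words[OF cp D that] by (auto simp: rots_simps dest: arg_cong[where f = length])
  then show ?thesis using corona_extend[OF cp D(1) E] l small_words[OF cp D] by metis
qed

definition large_words :: "real list set" where
  "large_words = insert [1, 1, 1, 1, 1, 1] (set (rots [1, 1, 1, 1, r, r, r]) \<union>
     set (rots [1, r, r, r, 1, r, r, r]) \<union> set (rots [1, r, r, 1, r, r, r, r]))"

text \<open>In LSLSSSSS a small disc sits between two large ones next to the large disc
  \<open>D\<close>. That small disc would have three consecutive large neighbours, which LSLLS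
  excludes.\<close>

lemma large_words:
  assumes cp: "compact_packing_using r P" and D: "D \<in> P" "radius D = 1" and c: "corona P D Fs"
  shows "map radius Fs \<in> large_words"
proof -
  have False if w: "map radius Fs \<in> set (rots [1, r, 1, r, r, r, r, r])"
  proof -
    obtain k where k: "map radius (rotate k Fs) = [1, r, 1, r, r, r, r, r]"
      using rots_unrotate[OF w] unfolding rotate_map by (elim exE)
    obtain F0 F1 F2 Fs' where F: "rotate k Fs = F0 # F1 # F2 # Fs'" "radius F0 = 1" "radius F1 = r" "radius F2 = 1"
      using k by (auto simp: map_eq_Cons_conv)
    have c': "corona P D (F0 # F1 # F2 # Fs')" using corona_rotate[OF c, of k] F by simp
    then have t: "tri D F0 F1" "tri D F1 F2" and m: "F0 \<in> P" "F1 \<in> P" "F2 \<in> P"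
      by (auto simp: corona_def)
    then have t': "tri F1 F2 D" "tri F1 D F0" using tri_cycle by blast+
    then obtain Hs where "map radius ([F2, D, F0] @ Hs) \<in> set (rots [1, r, 1, 1, r])"
      using small_corona[OF cp m(2) F(3), of F2 "[D, F0]"] m D by (auto simp: tri_def)
    then show False using F D r_less by (auto simp: rots_simps)
  qed
  then show ?thesis using large_words_raw[OF cp D c] unfolding large_words_def by blast
qed

lemma large_corona:
  assumes cp: "compact_packing_using r P" and D: "D \<in> P" "radius D = 1"
    and E: "tangent D E" "successively (tri D) (E # Es)" "set (E # Es) \<subseteq> P" and l: "length Es < 6"
  shows "\<exists>Hs. corona P D (E # Es @ Hs) \<and> map radius (E # Es @ Hs) \<in> large_words"
proof -
  have "length Fs \<ge> 6" if "corona P D Fs" for Fs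
    using large_words[OF cp D that]
    by (auto simp: large_words_def rots_simps dest: arg_cong[where f = length])
  then show ?thesis using corona_extend[OF cp D(1) E] l large_words[OF cp D]
    by (metis less_le_trans)
qed

lemma cp_tri_unique:
  assumes cp: "compact_packing_using r P" and P: "D \<in> P" "F \<in> P"
    and t: "tri D E F" "tri D E (z, radius F)" and E: "E \<in> P"
  shows "F = (z, radius F)"
proof -
  have p: "radius D > 0" "radius E > 0" "radius F > 0" using cp_pos[OF cp] P E by blast+
  show ?thesis by (rule tri_unique[OF p t]) simp
qed

text \<open>Both discs come right after \<open>E\<close> in the corona of \<open>D\<close>. Unlike
  in \<open>tri_unique\<close> the radii may differ a priori; this shows that a large and a small
  candidate for the same gap exclude each other.\<close>

lemma cp_apex_unique:
  assumes cp: "compact_packing_using r P" and P: "D \<in> P" "E \<in> P" "F \<in> P" "G \<in> P"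
    and t: "tri D E F" "tri D E G"
  shows "F = G"
proof -
  obtain Fs where "corona P D Fs" using cp_corona[OF cp P(1)] by blast
  moreover have "tangent D E" using t by (simp add: tri_def)
  ultimately obtain Gs where G: "corona P D (E # Gs)" using corona_head[OF _ P(2)] by metis
  have "Gs \<noteq> []"
  proof
    assume "Gs = []"
    then have "tri D E E" using G by (simp add: corona_def)
    then show False using tangent_irrefl[of E] cp_pos[OF cp] P(2) by (auto simp: tri_def)
  qed
  then have l: "1 \<le> length Gs" by (cases Gs) auto
  have "\<exists>Hs. Gs = [F] @ Hs" "\<exists>Hs. Gs = [G] @ Hs"
    using cp_chain[OF cp P(1) G, of "[F]"] cp_chain[OF cp P(1) G, of "[G]"] P t l by simp_all
  then show ?thesis by auto
qed

text \<open>\<open>av\<close> is the height \<open>sqrt ((1 + r)\<^sup>2 - 1)\<close> of a small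
  disc resting on two touching large ones; \<open>qv\<close>, \<open>sv\<close>, \<open>hv\<close>
  are \<open>L / 2\<close>, \<open>s\<close>, \<open>h\<close> of Class II. Only the cubic makes
  these square roots rational in \<open>r\<close>.\<close>

definition av :: real where "av = (1 + 2 * r - r\<^sup>2) / (1 + r)"
definition qv :: real where "qv = (1 + r) / (2 * r)"
definition sv :: real where "sv = 2 * r / (1 + r)"
definition hv :: real where "hv = 1 / r"

lemma av_eqs: "av * av = r * r + 2 * r" "av * r = 1 + 2 * r - r * r - av"
proof -
  have 1: "av * (1 + r) = 1 + 2 * r - r\<^sup>2" using r_pos by (simp add: av_def)
  then show "av * r = 1 + 2 * r - r * r - av" by (simp add: algebra_simps power2_eq_square)
  have "av * av * (1 + r)\<^sup>2 = (1 + 2 * r - r\<^sup>2)\<^sup>2" unfolding 1[symmetric] by (simp add: power2_eq_square)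
  also have "\<dots> = (r * r + 2 * r) * (1 + r)\<^sup>2"
    using cubic by (simp add: power2_eq_square power3_eq_cube algebra_simps)
  finally show "av * av = r * r + 2 * r" using r_pos by simp
qed

lemma av_bounds: "1.16 < av" "av < 1.17"
proof -
  have rr: "r * r \<ge> 0.533 * 0.533" "r * r \<le> 0.534 * 0.534"
    using r_bounds by (intro mult_mono; simp)+
  then show "1.16 < av" "av < 1.17" using r_bounds r_pos
    by (simp_all add: av_def field_simps power2_eq_square)
qed

lemma sqrt_av: "sqrt ((1 + r)\<^sup>2 - 1) = av"
  using av_eqs av_bounds by (intro real_sqrt_unique) (simp_all add: power2_eq_square algebra_simps)

text \<open>The last equation says that the cells of both classes, \<open>2 * (1 + r + av)\<close>
  and \<open>2 * qv * hv\<close>, have equal area; it is needed for the packing common to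
  both.\<close>

lemma qv_eqs: "qv * qv = 1 + 2 * r" "qv * sv = 1" "qv * r = (1 + r) / 2" "hv * r = 1"
  "sv * sv + hv * hv = 4" "sv * r = 2 * r - sv" "qv * hv = 1 + r + av"
proof -
  have p: "r > 0" "1 + r > 0" using r_pos by simp_all
  have "r * 2 + r * (r * 2) > 0" using p by (intro add_pos_pos mult_pos_pos) auto
  then show q: "qv * r = (1 + r) / 2" and h: "hv * r = 1" and "qv * sv = 1" "sv * r = 2 * r - sv"
    using p by (simp_all add: qv_def sv_def hv_def field_simps)
  have "qv * qv * (4 * (r * r)) = (1 + r)\<^sup>2" 
  proof -
    have "qv * qv * (4 * (r * r)) = (2 * (qv * r))\<^sup>2" by (simp add: power2_eq_square)
    also have "2 * (qv * r) = 1 + r" unfolding q by simp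
    finally show ?thesis .
  qed
  also have "\<dots> = (1 + 2 * r) * (4 * (r * r))" using cubic' by (simp add: power2_eq_square algebra_simps)
  finally show "qv * qv = 1 + 2 * r" using p by simp
  have s: "sv * (1 + r) = 2 * r" using p by (simp add: sv_def)
  have "(sv * sv + hv * hv) * ((r * r) * (1 + r)\<^sup>2) = (sv * (1 + r))\<^sup>2 * (r * r) + (hv * r)\<^sup>2 * (1 + r)\<^sup>2"
    by (simp add: power2_eq_square algebra_simps)
  also have "\<dots> = 4 * (r * r * (r * r)) + (1 + r)\<^sup>2" by (simp add: s h power2_eq_square)
  also have "\<dots> = 4 * ((r * r) * (1 + r)\<^sup>2)" using cubic' by (simp add: power2_eq_square algebra_simps)
  finally show "sv * sv + hv * hv = 4" using p by simp
  have "av * (1 + r) = 1 + 2 * r - r\<^sup>2" using p by (simp add: av_def)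
  then have "(1 + r + av) * (1 + r) = 2 + 4 * r" by (simp add: power2_eq_square algebra_simps)
  then have "(1 + r + av) * (1 + r) * (2 * (r * r)) = (1 + r) * (1 + r)" using cubic' by (simp add: algebra_simps)
  then have "(1 + r + av) * (2 * (r * r)) = 1 + r" using p by simp
  then show "qv * hv = 1 + r + av" using p by (simp add: qv_def hv_def field_simps)
qed

lemma qv_bounds: "1.43 < qv" "qv < 1.44" "0.69 < sv" "sv < 0.7" "1.87 < hv" "hv < 1.88"
  using r_bounds r_pos by (simp_all add: qv_def sv_def hv_def field_simps)

lemma class_II_consts: "sqrt (1 + 2 * r) = qv" "1 / qv = sv" "sqrt (4 - sv\<^sup>2) = hv"
proof -
  show "sqrt (1 + 2 * r) = qv"
    using qv_eqs(1) qv_bounds by (intro real_sqrt_unique) (simp_all add: power2_eq_square)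
  show "1 / qv = sv" using qv_eqs(2) qv_bounds by (simp add: field_simps)
  show "sqrt (4 - sv\<^sup>2) = hv"
    using qv_eqs(5) qv_bounds by (intro real_sqrt_unique) (simp_all add: power2_eq_square)
qed

section \<open>The first class, layer by layer\<close>

abbreviation big :: "real \<Rightarrow> real \<Rightarrow> disc" where "big x y \<equiv> (Complex x y, 1)"
abbreviation small :: "real \<Rightarrow> real \<Rightarrow> disc" where "small x y \<equiv> (Complex x y, r)"

lemmas constants_I = av_eqs av_bounds r_bounds r_pos real_sqrt_mult_self[of 3] real_sqrt_gt_zero[of 3]

lemma cp_tri_eq:
  assumes "compact_packing_using r P" "D \<in> P" "E \<in> P" "F \<in> P" "tri D E F" "tri D E (z, p)" "radius F = p"
  shows "F = (z, p)"
  using cp_tri_unique[OF assms(1,2,4,5) _ assms(3)] assms(6,7) by simp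

text \<open>The triangles above a row of Class I. Coordinates enter through equations, so that the
  rules match centres in any syntactic form; \<open>tri_I'\<close> is the same list after a
  half-turn.\<close>

lemma tri_I:
  shows "x2 = x + 2 \<Longrightarrow> x3 = x + 1 \<Longrightarrow> y3 = y + sqrt 3 \<Longrightarrow> tri (big x y) (big x2 y) (big x3 y3)"
    "x2 = x + 1 \<Longrightarrow> y2 = y + sqrt 3 \<Longrightarrow> x3 = x - 1 \<Longrightarrow> y3 = y2 \<Longrightarrow> tri (big x y) (big x2 y2) (big x3 y3)"
    "x2 = x + 2 \<Longrightarrow> x3 = x + 1 \<Longrightarrow> y3 = y + av \<Longrightarrow> tri (big x y) (big x2 y) (small x3 y3)"
    "x2 = x + 1 \<Longrightarrow> y2 = y + av \<Longrightarrow> y3 = y + 1 + r \<Longrightarrow> tri (big x y) (small x2 y2) (small x y3)"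
    "y2 = y + 1 + r \<Longrightarrow> x3 = x - 1 \<Longrightarrow> y3 = y + av \<Longrightarrow> tri (big x y) (small x y2) (small x3 y3)"
    "x2 = x + 1 \<Longrightarrow> y2 = y + av - 1 - r \<Longrightarrow> y3 = y + av \<Longrightarrow> tri (small x y) (small x2 y2) (big x2 y3)"
    "x2 = x + 1 \<Longrightarrow> y2 = y + av \<Longrightarrow> x3 = x - 1 \<Longrightarrow> tri (small x y) (big x2 y2) (big x3 y2)"
  by ((clarify, rule tri_Complex); use constants_I in \<open>simp add: power2_eq_square algebra_simps\<close>)+

lemma tri_I':
  shows "x2 = x - 2 \<Longrightarrow> x3 = x - 1 \<Longrightarrow> y3 = y - sqrt 3 \<Longrightarrow> tri (big x y) (big x2 y) (big x3 y3)"
    "x2 = x - 1 \<Longrightarrow> y2 = y - sqrt 3 \<Longrightarrow> x3 = x + 1 \<Longrightarrow> y3 = y2 \<Longrightarrow> tri (big x y) (big x2 y2) (big x3 y3)"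
    "x2 = x - 2 \<Longrightarrow> x3 = x - 1 \<Longrightarrow> y3 = y - av \<Longrightarrow> tri (big x y) (big x2 y) (small x3 y3)"
    "x2 = x - 1 \<Longrightarrow> y2 = y - av \<Longrightarrow> y3 = y - 1 - r \<Longrightarrow> tri (big x y) (small x2 y2) (small x y3)"
    "y2 = y - 1 - r \<Longrightarrow> x3 = x + 1 \<Longrightarrow> y3 = y - av \<Longrightarrow> tri (big x y) (small x y2) (small x3 y3)"
    "x2 = x - 1 \<Longrightarrow> y2 = y - av + 1 + r \<Longrightarrow> y3 = y - av \<Longrightarrow> tri (small x y) (small x2 y2) (big x2 y3)"
    "x2 = x - 1 \<Longrightarrow> y2 = y - av \<Longrightarrow> x3 = x + 1 \<Longrightarrow> tri (small x y) (big x2 y2) (big x3 y2)"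
  by ((clarify, rule tri_Complex); use constants_I in \<open>simp add: power2_eq_square algebra_simps\<close>)+

definition row :: "disc set \<Rightarrow> real \<Rightarrow> real \<Rightarrow> bool" where
  "row P x y \<longleftrightarrow> (\<forall>j::int. big (x + 2 * of_int j) y \<in> P)"

definition below :: "disc set \<Rightarrow> nat \<Rightarrow> real \<Rightarrow> real \<Rightarrow> bool" where
  "below P d x y \<longleftrightarrow> (if d = 0 then row P (x + 1) (y - sqrt 3) else
     (\<forall>j::int. small (x + 2 * of_int j) (y - 1 - r) \<in> P \<and> small (x + 2 * of_int j + 1) (y - av) \<in> P))"

text \<open>For \<open>d = 0\<close> this already contains the next large row; otherwise it is only
  the two layers of small discs that fill the gap.\<close>

definition above :: "disc set \<Rightarrow> nat \<Rightarrow> real \<Rightarrow> real \<Rightarrow> bool" where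
  "above P d x y \<longleftrightarrow> (if d = 0 then row P (x + 1) (y + sqrt 3) else
     (\<forall>j::int. small (x + 2 * of_int j) (y + 1 + r) \<in> P \<and> small (x + 2 * of_int j + 1) (y + av) \<in> P))"

lemma row_shift: "row P (x + 2 * of_int i) y \<longleftrightarrow> row P x y"
proof -
  have "row P x y" if "row P (x + 2 * of_int i) y" for x i
    unfolding row_def
  proof
    fix j :: int
    have "big (x + 2 * of_int i + 2 * of_int (j - i)) y \<in> P" using that unfolding row_def by blast
    then show "big (x + 2 * of_int j) y \<in> P" by (simp add: algebra_simps)
  qed
  from this[of x i] this[of "x + 2 * of_int i" "-i"] show ?thesis by auto
qed

lemma layer_height_av: "layer_height r d = (if d = 0 then sqrt 3 else 1 + r + av)"
  by (simp add: layer_height_def sqrt_av)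

lemma above_below:
  assumes "above P d x y"
  shows "d \<noteq> 0 \<Longrightarrow> below P d (x + 1) (y + layer_height r d)"
    "d = 0 \<Longrightarrow> row P (x + 1) (y + layer_height r d)"
proof -
  assume d: "d \<noteq> 0"
  show "below P d (x + 1) (y + layer_height r d)" unfolding below_def if_not_P[OF d]
  proof
    fix j :: int
    have A: "\<forall>j::int. small (x + 2 * of_int j) (y + 1 + r) \<in> P \<and> small (x + 2 * of_int j + 1) (y + av) \<in> P"
      using assms unfolding above_def if_not_P[OF d] .
    have "small (x + 2 * of_int j + 1) (y + av) \<in> P" "small (x + 2 * of_int (j + 1)) (y + 1 + r) \<in> P"
      using A[rule_format, of j] A[rule_format, of "j + 1"] by simp_all
    then show "small (x + 1 + 2 * of_int j) (y + layer_height r d - 1 - r) \<in> P \<and>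
      small (x + 1 + 2 * of_int j + 1) (y + layer_height r d - av) \<in> P"
      using d by (simp add: layer_height_av algebra_simps)
  qed
next
  assume "d = 0"
  then show "row P (x + 1) (y + layer_height r d)" using assms by (simp add: above_def layer_height_av)
qed

lemma corona_suffix:
  assumes "corona P D (A # L @ Z # Hs)"
  shows "list_all2 (tri D) (Z # Hs) (Hs @ [A])" "set Hs \<subseteq> P"
proof -
  have "list_all2 (tri D) ((A # L) @ (Z # Hs)) ((L @ [Z]) @ (Hs @ [A]))"
    using assms by (simp add: corona_def)
  then show "list_all2 (tri D) (Z # Hs) (Hs @ [A])" by (subst (asm) list_all2_append) auto
  show "set Hs \<subseteq> P" using assms by (auto simp: corona_def)
qed

text \<open>The left and right neighbours and the discs below already spell LLLL or LSSSL. Every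
  admissible word with such a beginning ends in LL or SSS.\<close>

lemma lower_half_rest:
  assumes cp: "compact_packing_using r P" and R: "row P x y" and B: "below P d x y"
  shows "(\<exists>F G. {F, G} \<subseteq> P \<and> radius F = 1 \<and> radius G = 1 \<and> tri (big x y) (big (x + 2) y) F \<and>
      tri (big x y) F G \<and> tri (big x y) G (big (x - 2) y)) \<or>
    (\<exists>F G H. {F, G, H} \<subseteq> P \<and> radius F = r \<and> radius G = r \<and> radius H = r \<and> tri (big x y) (big (x + 2) y) F \<and>
      tri (big x y) F G \<and> tri (big x y) G H \<and> tri (big x y) H (big (x - 2) y))"
proof -
  have R': "big x y \<in> P" "big (x - 2) y \<in> P" "big (x + 2) y \<in> P"
    using R[unfolded row_def, rule_format, of 0] R[unfolded row_def, rule_format, of "-1"]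
      R[unfolded row_def, rule_format, of 1] by simp_all
  define X W Z where "X = big x y" and "W = big (x - 2) y" and "Z = big (x + 2) y"
  have "\<exists>Es. successively (tri X) (W # Es @ [Z]) \<and> set Es \<subseteq> P \<and> (map radius Es = [1, 1] \<or> map radius Es = [r, r, r])"
  proof (cases "d = 0")
    case True
    then have "\<forall>j::int. big (x + 1 + 2 * of_int j) (y - sqrt 3) \<in> P" using B by (simp add: below_def row_def)
    from this[rule_format, of 0] this[rule_format, of "-1"]
    have "set [big (x - 1) (y - sqrt 3), big (x + 1) (y - sqrt 3)] \<subseteq> P" by simp
    moreover have "successively (tri X) (W # [big (x - 1) (y - sqrt 3), big (x + 1) (y - sqrt 3)] @ [Z])"
      using tri_I'(1)[of _ x _ _ y] tri_I'(2)[of _ x _ y]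
        tri_cycle[OF tri_I'(1)[of x "x + 2" "x + 1" "y - sqrt 3" y]] by (simp add: X_def W_def Z_def)
    ultimately show ?thesis by (intro exI conjI disjI1) (assumption, assumption, simp)
  next
    case False
    then have "\<forall>j::int. small (x + 2 * of_int j) (y - 1 - r) \<in> P \<and> small (x + 2 * of_int j + 1) (y - av) \<in> P"
      using B by (simp add: below_def)
    from this[rule_format, of 0] this[rule_format, of "-1"]
    have "set [small (x - 1) (y - av), small x (y - 1 - r), small (x + 1) (y - av)] \<subseteq> P" by simp
    moreover have "successively (tri X) (W # [small (x - 1) (y - av), small x (y - 1 - r), small (x + 1) (y - av)] @ [Z])"
      using tri_I'(3)[of _ x _ _ y] tri_I'(4)[of _ x _ y] tri_I'(5)[of _ y _ x]
        tri_cycle[OF tri_I'(3)[of x "x + 2" "x + 1" "y - av" y]] by (simp add: X_def W_def Z_def)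
    ultimately show ?thesis by (intro exI conjI disjI2) (assumption, assumption, simp)
  qed
  then obtain Es where Es: "successively (tri X) (W # Es @ [Z])" "set Es \<subseteq> P"
    and r: "map radius Es = [1, 1] \<or> map radius Es = [r, r, r]" by (elim exE conjE)
  have "tangent X W" using Es(1) by (cases Es) (auto simp: tri_def)
  moreover have "length (Es @ [Z]) < 6" using r by (auto dest: arg_cong[where f = length])
  ultimately obtain Hs where "corona P X (W # (Es @ [Z]) @ Hs)" "map radius (W # (Es @ [Z]) @ Hs) \<in> large_words"
    using large_corona[OF cp R'(1), of W "Es @ [Z]"] R' Es by (auto simp: X_def W_def Z_def)
  \<comment> \<open>The word LSSLSSSS drops out by itself here, as its groups of small discs have
    sizes two and four.\<close>
  then have H: "corona P (big x y) (big (x - 2) y # Es @ big (x + 2) y # Hs)"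
    and w: "map radius Hs = [1, 1] \<or> map radius Hs = [r, r, r]"
    using r r_less by (auto simp: large_words_def rots_simps X_def W_def Z_def)
  note s = corona_suffix[OF H]
  from w show ?thesis
  proof
    assume "map radius Hs = [1, 1]"
    then obtain F G where Hs: "Hs = [F, G]" "radius F = 1" "radius G = 1"
      by (auto simp: map_eq_Cons_conv)
    have "{F, G} \<subseteq> P \<and> radius F = 1 \<and> radius G = 1 \<and> tri (big x y) (big (x + 2) y) F \<and>
      tri (big x y) F G \<and> tri (big x y) G (big (x - 2) y)" using s Hs by simp
    then show ?thesis by blast
  next
    assume "map radius Hs = [r, r, r]"
    then obtain F G K where Hs: "Hs = [F, G, K]" "radius F = r" "radius G = r" "radius K = r"
      by (auto simp: map_eq_Cons_conv)
    have "{F, G, K} \<subseteq> P \<and> radius F = r \<and> radius G = r \<and> radius K = r \<and> tri (big x y) (big (x + 2) y) F \<and>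
      tri (big x y) F G \<and> tri (big x y) G K \<and> tri (big x y) K (big (x - 2) y)" using s Hs by simp
    then show ?thesis by blast
  qed
qed

lemma upper_half:
  assumes cp: "compact_packing_using r P" and R: "row P x y" and B: "below P d x y"
  shows "(big (x + 1) (y + sqrt 3) \<in> P \<and> big (x - 1) (y + sqrt 3) \<in> P) \<or>
    (small (x + 1) (y + av) \<in> P \<and> small x (y + 1 + r) \<in> P \<and> small (x - 1) (y + av) \<in> P)"
proof -
  have R': "big x y \<in> P" "big (x + 2) y \<in> P"
    using R[unfolded row_def, rule_format, of 0] R[unfolded row_def, rule_format, of 1] by simp_all
  from lower_half_rest[OF assms] show ?thesis
  proof (elim disjE exE conjE)
    fix F G assume F: "{F, G} \<subseteq> P" "radius F = 1" "radius G = 1"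
      "tri (big x y) (big (x + 2) y) F" "tri (big x y) F G"
    have "F = big (x + 1) (y + sqrt 3)"
      using cp_tri_unique[OF cp R'(1) _ F(4) _ R'(2)] tri_I(1)[of _ x _ _ y] F by simp
    moreover from this have "G = big (x - 1) (y + sqrt 3)"
      using cp_tri_unique[OF cp R'(1) _ F(5)] tri_I(2)[of _ x _ y] F by simp
    ultimately show ?thesis using F by simp
  next
    fix F G H assume F: "{F, G, H} \<subseteq> P" "radius F = r" "radius G = r" "radius H = r"
      "tri (big x y) (big (x + 2) y) F" "tri (big x y) F G" "tri (big x y) G H"
    have "F = small (x + 1) (y + av)"
      using cp_tri_unique[OF cp R'(1) _ F(5) _ R'(2)] tri_I(3)[of _ x _ _ y] F by simp
    moreover from this have "G = small x (y + 1 + r)"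
      using cp_tri_unique[OF cp R'(1) _ F(6)] tri_I(4)[of _ x _ y] F by simp
    moreover from this have "H = small (x - 1) (y + av)"
      using cp_tri_unique[OF cp R'(1) _ F(7)] tri_I(5)[of _ y _ x] F by simp
    ultimately show ?thesis using F by simp
  qed
qed

lemma below_shift: "below P d x y \<Longrightarrow> below P d (x + 2 * of_int i) y"
proof -
  assume b: "below P d x y"
  show "below P d (x + 2 * of_int i) y"
  proof (cases "d = 0")
    case True
    then show ?thesis using b row_shift[of P "x + 1" i] by (simp add: below_def algebra_simps)
  next
    case False
    have "small (x + 2 * of_int (i + j)) (y - 1 - r) \<in> P \<and> small (x + 2 * of_int (i + j) + 1) (y - av) \<in> P"
      for j using b unfolding below_def if_not_P[OF False] ..
    then show ?thesis using False by (simp add: below_def algebra_simps)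
  qed
qed

lemma int_const:
  fixes A :: "int \<Rightarrow> bool"
  assumes "\<And>i. A (i + 1) \<longleftrightarrow> A i" shows "A i \<longleftrightarrow> A 0"
proof (induction i rule: int_induct[where k = 0])
  case (step2 i)
  then show ?case using assms[of "i - 1"] by simp
qed (use assms in auto)

text \<open>The choice between LL and SSS is made at each disc of the row, but neighbouring discs
  share the gap between them and so agree. The whole row then chooses at once.\<close>

lemma class_I_step:
  assumes cp: "compact_packing_using r P" and R: "row P x y" and B: "below P d x y"
  shows "\<exists>e. e \<in> {0, 1} \<and> above P e x y \<and> row P (x + 1) (y + layer_height r e) \<and>
    below P e (x + 1) (y + layer_height r e)"
proof -
  define X where "X = (\<lambda>j::int. x + 2 * of_int j)"
  have X1: "X (j + 1) = X j + 2" "X (j - 1) = X j - 2" for j by (simp_all add: X_def)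
  have RX: "row P (X j) y" "below P d (X j) y" for j
    using R row_shift below_shift[OF B] by (simp_all add: X_def)
  have BX: "big (X j) y \<in> P" for j using R unfolding row_def X_def by blast
  have dich: "(big (X j + 1) (y + sqrt 3) \<in> P \<and> big (X j - 1) (y + sqrt 3) \<in> P) \<or>
    (small (X j + 1) (y + av) \<in> P \<and> small (X j) (y + 1 + r) \<in> P \<and> small (X j - 1) (y + av) \<in> P)" for j
    by (rule upper_half[OF cp RX])
  have excl: "\<not> (big (X j + 1) (y + sqrt 3) \<in> P \<and> small (X j + 1) (y + av) \<in> P)" for j
  proof
    assume a: "big (X j + 1) (y + sqrt 3) \<in> P \<and> small (X j + 1) (y + av) \<in> P"
    have "big (X j + 1) (y + sqrt 3) = small (X j + 1) (y + av)"
    proof (rule cp_apex_unique[OF cp BX[of j] BX[of "j + 1"]])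
      show "tri (big (X j) y) (big (X (j + 1)) y) (big (X j + 1) (y + sqrt 3))"
        "tri (big (X j) y) (big (X (j + 1)) y) (small (X j + 1) (y + av))"
        by (rule tri_I; simp add: X1)+
    qed (use a in auto)
    then show False using r_less by simp
  qed
  have const: "big (X j + 1) (y + sqrt 3) \<in> P \<longleftrightarrow> big (X 0 + 1) (y + sqrt 3) \<in> P" for j
  proof (rule int_const)
    fix i
    \<comment> \<open>The gap to the left of disc \<open>i + 1\<close> is the gap to the right of
      disc \<open>i\<close>.\<close>
    have e: "X (i + 1) - 1 = X i + 1" by (simp add: X1)
    show "big (X (i + 1) + 1) (y + sqrt 3) \<in> P \<longleftrightarrow> big (X i + 1) (y + sqrt 3) \<in> P"
      using dich[of "i + 1", unfolded e] dich[of i] excl[of "i + 1"] excl[of i] by argo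
  qed
  show ?thesis
  proof (cases "big (X 0 + 1) (y + sqrt 3) \<in> P")
    case True
    then have "big (x + 2 * of_int j + 1) (y + sqrt 3) \<in> P" for j :: int using const[of j] by (simp add: X_def)
    then have "row P (x + 1) (y + sqrt 3)" by (simp add: row_def algebra_simps)
    moreover have "below P 0 (x + 1) (y + sqrt 3)"
      using R row_shift[of P x 1 y] by (simp add: below_def algebra_simps)
    ultimately show ?thesis by (intro exI[of _ 0]) (simp add: above_def layer_height_av)
  next
    case False
    then have S: "small (X j + 1) (y + av) \<in> P" "small (X j) (y + 1 + r) \<in> P" "small (X j - 1) (y + av) \<in> P" for j
      using const dich by blast+
    have ab: "above P 1 x y" using S unfolding above_def X_def by simp
    have "big (X j + 1) (y + 1 + r + av) \<in> P" for j
    proof -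
      \<comment> \<open>Around this upper small disc the neighbours S, L, S are known, so LSLLS
        continues with L, L. The first of these large discs belongs to the next row.\<close>
      define A where "A = small (X j) (y + 1 + r)"
      have t1: "tri A (small (X j - 1) (y + av)) (big (X j) y)"
        using tri_cycle[OF tri_I(5)[of "y + 1 + r" y "X j - 1" "X j" "y + av"]] by (simp add: A_def)
      have t2: "tri A (big (X j) y) (small (X j + 1) (y + av))"
        using tri_cycle[OF tri_cycle[OF tri_I(4)[of "X j + 1" "X j" "y + av" y "y + 1 + r"]]] by (simp add: A_def)
      have t3: "tri A (small (X j + 1) (y + av)) (big (X j + 1) (y + 1 + r + av))"
        using tri_I(6)[of "X j + 1" "X j" "y + av" "y + 1 + r" "y + 1 + r + av"] by (simp add: A_def)
      obtain Hs where H: "corona P A (small (X j - 1) (y + av) # [big (X j) y, small (X j + 1) (y + av)] @ Hs)"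
        "map radius (small (X j - 1) (y + av) # [big (X j) y, small (X j + 1) (y + av)] @ Hs) \<in> set (rots [1, r, 1, 1, r])"
        using small_corona[OF cp, of A "small (X j - 1) (y + av)" "[big (X j) y, small (X j + 1) (y + av)]"]
          S BX t1 t2 by (auto simp: tri_def A_def)
      then obtain F G where F: "Hs = [F, G]" "radius F = 1" using r_less
        by (auto simp: rots_simps map_eq_Cons_conv)
      have FP: "F \<in> P" "tri A (small (X j + 1) (y + av)) F" using H(1) by (auto simp: F corona_def)
      have "F = big (X j + 1) (y + 1 + r + av)"
        using cp_tri_unique[OF cp _ FP(1) FP(2)] t3 F(2) S by (simp add: A_def)
      then show ?thesis using FP by simp
    qed
    then have "row P (x + 1) (y + 1 + r + av)" by (simp add: row_def X_def algebra_simps)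
    then show ?thesis using ab above_below(1)[OF ab] by (intro exI[of _ 1]) (simp add: layer_height_av add.assoc)
  qed
qed

text \<open>
  The word excluded here has its small discs in groups of two and four; it is the mark of the
  second class.
\<close>

definition no_split :: "disc set \<Rightarrow> bool" where
  "no_split P \<longleftrightarrow> (\<forall>X\<in>P. \<forall>Fs. corona P X Fs \<longrightarrow> map radius Fs \<notin> set (rots [1, r, r, 1, r, r, r, r]))"

lemma no_split_move:
  assumes f: "plane_isometry f" and P: "no_split P"
  shows "no_split (move f ` P)"
  unfolding no_split_def
proof (intro ballI allI impI notI)
  fix X Fs assume X: "X \<in> move f ` P" "corona (move f ` P) X Fs"
    and w: "map radius Fs \<in> set (rots [1, r, r, 1, r, r, r, r])"
  obtain g where g: "plane_isometry g" "\<And>z. g (f z) = z" using plane_isometry_inverse[OF f] by metis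
  have gP: "move g ` move f ` P = P" by (simp add: image_image g(2))
  then have XP: "move g X \<in> P" using X(1) by blast
  from tri_move[OF g(1)] show False
  proof
    assume "\<forall>D E F. tri (move g D) (move g E) (move g F) \<longleftrightarrow> tri D E F"
    from corona_move_direct[OF g(1) this X(2)] have "corona P (move g X) (map (move g) Fs)"
      unfolding gP .
    then show False using P XP w unfolding no_split_def by (force simp: o_def)
  next
    assume "\<forall>D E F. tri (move g D) (move g E) (move g F) \<longleftrightarrow> tri D F E"
    from corona_move_opposite[OF g(1) this X(2)]
    have "corona P (move g X) (map (move g) (rev (rotate1 Fs)))" unfolding gP .
    moreover have "map radius (map (move g) (rev (rotate1 Fs))) = rev (rotate1 (map radius Fs))"
      by (simp add: rev_map rotate1_map o_def)
    \<comment> \<open>A reflection reads the word backwards, and as a cyclic word it is a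
      palindrome.\<close>
    moreover have "rev (rotate1 u) \<in> set (rots [1, r, r, 1, r, r, r, r])"
      if "u \<in> set (rots [1, r, r, 1, r, r, r, r])" for u
      using that by (auto simp: rots_simps)
    ultimately show False using P XP w unfolding no_split_def by metis
  qed
qed

text \<open>The seed of Class I: a large disc on the real axis with large neighbours left and right
  and SSS below.\<close>

definition strip :: "disc set \<Rightarrow> real \<Rightarrow> bool" where
  "strip P x \<longleftrightarrow> {big x 0, big (x - 2) 0, small (x - 1) (- av), small x (- 1 - r), small (x + 1) (- av), big (x + 2) 0} \<subseteq> P"

text \<open>At the right neighbour the word begins with L, S. Without LSSLSSSS it can only continue
  as LSSSL, and this is the next strip.\<close>

lemma strip_right:
  assumes cp: "compact_packing_using r P" and ns: "no_split P" and S: "strip P x"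
  shows "strip P (x + 2)"
proof -
  define Y where "Y = big (x + 2) 0"
  have m: "big x 0 \<in> P" "small (x + 1) (- av) \<in> P" "Y \<in> P" using S by (auto simp: strip_def Y_def)
  have t: "tri Y (big x 0) (small (x + 1) (- av))" unfolding Y_def by (rule tri_I'(3)) auto
  obtain Hs where H: "corona P Y (big x 0 # [small (x + 1) (- av)] @ Hs)"
    "map radius (big x 0 # [small (x + 1) (- av)] @ Hs) \<in> large_words"
    using large_corona[OF cp m(3), of "big x 0" "[small (x + 1) (- av)]"] m t by (auto simp: tri_def Y_def)
  moreover have "map radius (big x 0 # [small (x + 1) (- av)] @ Hs) \<notin> set (rots [1, r, r, 1, r, r, r, r])"
    using ns m(3) H(1) unfolding no_split_def by blast
  ultimately obtain F G K Hs' where F: "Hs = F # G # K # Hs'" "radius F = r" "radius G = r" "radius K = 1"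
    using r_less by (auto simp: large_words_def rots_simps map_eq_Cons_conv)
  have FP: "F \<in> P" "G \<in> P" "K \<in> P" "tri Y (small (x + 1) (- av)) F" "tri Y F G" "tri Y G K"
    using H(1) by (auto simp: F corona_def)
  have "F = small (x + 2) (- 1 - r)"
    using cp_tri_unique[OF cp m(3) FP(1,4)] tri_I'(4)[of "x + 1" "x + 2" "- av" 0 "- 1 - r"] m F by (simp add: Y_def)
  moreover from this have "G = small (x + 3) (- av)"
    using cp_tri_unique[OF cp m(3) FP(2,5)] tri_I'(5)[of "- 1 - r" 0 "x + 3" "x + 2" "- av"] FP F by (simp add: Y_def)
  moreover from this have "K = big (x + 4) 0"
    using cp_tri_unique[OF cp m(3) FP(3,6)]
      tri_cycle[OF tri_I'(3)[of "x + 2" "x + 4" "x + 3" "- av" 0]] FP F by (simp add: Y_def)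
  ultimately show ?thesis using m FP by (simp add: strip_def Y_def algebra_simps)
qed

lemma strip_left:
  assumes cp: "compact_packing_using r P" and ns: "no_split P" and S: "strip P x"
  shows "strip P (x - 2)"
proof -
  define g where "g = (\<lambda>z::complex. - cnj z)"
  have g: "plane_isometry g" unfolding g_def by (rule plane_isometry_uminus_cnj)
  have gC: "move g (Complex x y, p) = (Complex (- x) y, p)" for x y p
    by (simp add: g_def complex_eq_iff)
  have mem: "(Complex (- x) y, p) \<in> move g ` Q" if "(Complex x y, p) \<in> Q" for x y p Q
    using imageI[OF that, of "move g"] by (simp only: gC)
  have gg: "move g ` move g ` P = P" by (simp add: image_image g_def)
  have "strip (move g ` P) (- x)"
    using S mem[of x 0 1 P] mem[of "x - 2" 0 1 P] mem[of "x - 1" "-av" r P] mem[of x "- 1 - r" r P]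
      mem[of "x + 1" "-av" r P] mem[of "x + 2" 0 1 P] by (simp add: strip_def)
  then have S': "strip (move g ` P) (- x + 2)"
    using strip_right[OF compact_packing_using_move[OF g cp] no_split_move[OF g ns]] by blast
  show ?thesis
    using S' mem[of "2 - x" 0 1 "move g ` P"] mem[of "- x" 0 1 "move g ` P"] mem[of "1 - x" "-av" r "move g ` P"]
      mem[of "2 - x" "- 1 - r" r "move g ` P"] mem[of "3 - x" "-av" r "move g ` P"] mem[of "4 - x" 0 1 "move g ` P"]
    unfolding strip_def gg by (simp add: algebra_simps)
qed

lemma strip_row:
  assumes cp: "compact_packing_using r P" and ns: "no_split P" and S: "strip P 0"
  shows "row P 0 0" "below P 1 0 0"
proof -
  have *: "strip P (2 * of_int j)" for j :: int
  proof (rule int_induct[where k = 0 and P = "\<lambda>j. strip P (2 * of_int j)"])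
    show "strip P (2 * of_int 0)" using S by simp
  next
    fix i :: int assume "strip P (2 * of_int i)"
    note strip_right[OF cp ns this]
    moreover have "2 * of_int (i + 1) = 2 * of_int i + (2::real)" by simp
    ultimately show "strip P (2 * of_int (i + 1))" by (simp only:)
  next
    fix i :: int assume "strip P (2 * of_int i)"
    note strip_left[OF cp ns this]
    moreover have "2 * of_int (i - 1) = 2 * of_int i - (2::real)" by simp
    ultimately show "strip P (2 * of_int (i - 1))" by (simp only:)
  qed
  show "row P 0 0" unfolding row_def
  proof
    fix j :: int
    show "big (0 + 2 * of_int j) 0 \<in> P" using *[of j] by (simp add: strip_def)
  qed
  have "small (0 + 2 * of_int j) (0 - 1 - r) \<in> P \<and> small (0 + 2 * of_int j + 1) (0 - av) \<in> P" for j :: int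
    using *[of j] by (simp add: strip_def)
  then show "below P 1 0 0" unfolding below_def if_not_P[OF one_neq_zero] ..
qed

text \<open>A direct motion puts a disc at the origin and one chosen neighbour at a prescribed
  place, keeping the cyclic order.\<close>

lemma normalise_corona:
  assumes c: "corona P X (E # Fs)" and z: "norm z = radius X + radius E" "z \<noteq> 0"
  obtains f where "plane_isometry f" "f (centre X) = 0" "corona (move f ` P) (0, radius X) ((z, radius E) # map (move f) Fs)"
proof -
  define a where "a = z / (centre E - centre X)"
  have "tangent X E" using c by (auto simp: corona_def)
  then have n: "norm (centre E - centre X) = norm z" using z norm_tangent by simp
  then have a: "norm a = 1" using z(2) by (simp add: a_def norm_divide n)
  have "centre E - centre X \<noteq> 0" using n z by auto
  then have az: "a * (centre E - centre X) = z" using a_def nonzero_eq_divide_eq by metis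
  define f where "f = (\<lambda>w. a * w + - (a * centre X))"
  have f: "plane_isometry f" unfolding f_def by (rule plane_isometry_affine[OF a])
  have "\<forall>D E F. tri (move f D) (move f E) (move f F) \<longleftrightarrow> tri D E F"
    using tri_move_affine(1)[OF a] unfolding f_def by blast
  from corona_move_direct[OF f this c]
  have "corona (move f ` P) (move f X) (move f E # map (move f) Fs)" by simp
  moreover have fX: "f (centre X) = 0" "f (centre E) = z" using az by (simp_all add: f_def algebra_simps)
  ultimately show thesis using that[OF f fX(1)] by simp
qed

text \<open>Some large disc \<open>X\<close> touches a small one, and without LSSLSSSS its word
  contains LSSSL. Placing the first large disc of that block at \<open>-2\<close> gives a
  strip.\<close>

lemma class_I_start:
  assumes cp: "compact_packing_using r P" and ns: "no_split P"
  obtains f where "plane_isometry f" "row (move f ` P) 0 0" "below (move f ` P) 1 0 0"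
proof -
  have "r \<in> radius ` P" using cp by (simp add: compact_packing_using_def)
  then obtain S where S: "r = radius S" "S \<in> P" by (rule imageE)
  obtain Fs where Fs: "corona P S Fs" using cp_corona[OF cp S(2)] by blast
  have "1 \<in> set (map radius Fs)" using small_words[OF cp S(2) S(1)[symmetric] Fs] by (auto simp: rots_simps)
  then obtain X where X: "X \<in> set Fs" "radius X = 1" by auto
  have XP: "X \<in> P" "tangent X S" using X Fs by (auto simp: corona_def tangent_sym)
  obtain Gs where "corona P X Gs" using cp_corona[OF cp XP(1)] by blast
  then obtain Hs where H: "corona P X (S # Hs)" using corona_head[OF _ S(2) XP(2)] by metis
  have "map radius (S # Hs) \<in> large_words" by (rule large_words[OF cp XP(1) X(2) H])
  moreover have "map radius (S # Hs) \<notin> set (rots [1, r, r, 1, r, r, r, r])"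
    using ns XP(1) H unfolding no_split_def by blast
  ultimately have "map radius (S # Hs) \<in> set (rots [1, r, r, r, 1, 1, 1]) \<union> set (rots [1, r, r, r, 1, r, r, r])"
    using S(1)[symmetric] r_less by (auto simp: large_words_def rots_simps)
  then have "\<exists>k w. rotate k (map radius (S # Hs)) = [1, r, r, r, 1] @ w"
  proof
    assume "map radius (S # Hs) \<in> set (rots [1, r, r, r, 1, 1, 1])"
    from rots_unrotate[OF this] show ?thesis by (elim exE) (intro exI, simp)
  next
    assume "map radius (S # Hs) \<in> set (rots [1, r, r, r, 1, r, r, r])"
    from rots_unrotate[OF this] show ?thesis by (elim exE) (intro exI, simp)
  qed
  then obtain k w where "rotate k (map radius (S # Hs)) = [1, r, r, r, 1] @ w" by (elim exE)
  then have "map radius (rotate k (S # Hs)) = [1, r, r, r, 1] @ w" by (simp only: rotate_map)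
  then obtain E F G K L Ks where E: "rotate k (S # Hs) = E # F # G # K # L # Ks"
    "radius E = 1" "radius F = r" "radius G = r" "radius K = r" "radius L = 1"
    by (auto simp: map_eq_Cons_conv)
  have c: "corona P X (E # F # G # K # L # Ks)" using corona_rotate[OF H, of k] E by simp
  have n: "norm (Complex (-2) 0) = radius X + radius E" "Complex (-2) 0 \<noteq> 0"
    using X(2) E(2) by (simp_all add: cmod_def complex_eq_iff)
  obtain f where f: "plane_isometry f" "f (centre X) = 0"
    and fc: "corona (move f ` P) (0, radius X) ((Complex (-2) 0, radius E) # map (move f) (F # G # K # L # Ks))"
    using normalise_corona[OF c n] .
  define P' where "P' = move f ` P"
  have cp': "compact_packing_using r P'" unfolding P'_def by (rule compact_packing_using_move[OF f(1) cp])
  have "move f X \<in> P'" unfolding P'_def by (rule imageI[OF XP(1)])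
  moreover have z: "(0, radius X) = big 0 0" using X(2) by (simp add: complex_eq_iff)
  ultimately have P0: "big 0 0 \<in> P'" by (simp only: f(2))
  then have c': "corona P' (big 0 0) (big (-2) 0 # [] @ move f F # move f G # move f K # move f L # map (move f) Ks)"
    using fc E(2) unfolding z by (simp add: P'_def)
  have m: "big (-2) 0 \<in> P'" "move f F \<in> P'" "move f G \<in> P'" "move f K \<in> P'" "move f L \<in> P'"
    and t: "tri (big 0 0) (big (-2) 0) (move f F)" "tri (big 0 0) (move f F) (move f G)"
      "tri (big 0 0) (move f G) (move f K)" "tri (big 0 0) (move f K) (move f L)"
    using c' corona_suffix[OF c'] by (auto simp: corona_def)
  have F: "move f F = small (-1) (- av)"
    by (rule cp_tri_eq[OF cp' P0 m(1,2) t(1)], rule tri_I'(3)) (use E in simp_all)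
  have G: "move f G = small 0 (- 1 - r)"
    by (rule cp_tri_eq[OF cp' P0 m(2,3) t(2)], unfold F, rule tri_I'(4)) (use E in simp_all)
  have K: "move f K = small 1 (- av)"
    by (rule cp_tri_eq[OF cp' P0 m(3,4) t(3)], unfold G, rule tri_I'(5)) (use E in simp_all)
  have L: "move f L = big 2 0"
    by (rule cp_tri_eq[OF cp' P0 m(4,5) t(4)], unfold K, rule tri_cycle, rule tri_I'(3)) (use E in simp_all)
  have "strip P' 0" unfolding strip_def using m P0 F G K L by simp
  from strip_row[OF cp' _ this] show thesis
    using that[OF f(1)] no_split_move[OF f(1) ns] unfolding P'_def by blast
qed


lemma class_I_up:
  assumes cp: "compact_packing_using r P" and "row P 0 0" "below P d 0 0"
  shows "\<exists>(e :: nat \<Rightarrow> nat) (y :: nat \<Rightarrow> real). y 0 = 0 \<and> (\<forall>n. e n \<in> {0, 1} \<and>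
    y (Suc n) = y n + layer_height r (e n) \<and> row P (real n) (y n) \<and> above P (e n) (real n) (y n))"
proof -
  \<comment> \<open>A state is the height of row \<open>n\<close> and the kind of the gap below it.
    The last conjunct is there because dependent choice would not otherwise fix the initial
    height.\<close>
  define A where "A = (\<lambda>n (d, y). row P (real n) y \<and> below P d (real n) y \<and> (n = 0 \<longrightarrow> y = 0))"
  define B where "B = (\<lambda>n (d :: nat, y) (d', y'). d' \<in> {0, 1} \<and> above P d' (real n) y \<and> y' = y + layer_height r d')"
  have "\<exists>f. \<forall>n. A n (f n) \<and> B n (f n) (f (Suc n))"
  proof (rule dependent_nat_choice)
    show "\<exists>s. A 0 s" using assms by (intro exI[of _ "(d, 0)"]) (simp add: A_def)
  next
    fix s n assume "A n s"
    moreover obtain d y where s: "s = (d, y)" by (cases s)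
    ultimately have "row P (real n) y" "below P d (real n) y" by (simp_all add: A_def)
    from class_I_step[OF cp this] obtain e where e: "e \<in> {0, 1}" "above P e (real n) y"
      "row P (real n + 1) (y + layer_height r e)" "below P e (real n + 1) (y + layer_height r e)" by blast
    then show "\<exists>t. A (Suc n) t \<and> B n s t"
      by (intro exI[of _ "(e, y + layer_height r e)"]) (simp add: A_def B_def s add.commute)
  qed
  then obtain f where f: "A n (f n)" "B n (f n) (f (Suc n))" for n by blast
  have "snd (f 0) = 0" using f(1)[of 0] by (simp add: A_def split_beta)
  moreover have "fst (f (Suc n)) \<in> {0, 1}" "snd (f (Suc n)) = snd (f n) + layer_height r (fst (f (Suc n)))"
    "row P (real n) (snd (f n))" "above P (fst (f (Suc n))) (real n) (snd (f n))" for n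
    using f(1)[of n] f(2)[of n] by (simp_all add: A_def B_def split_beta)
  \<comment> \<open>The gap above row \<open>n\<close> is recorded as the gap below row
    \<open>n + 1\<close>, hence the \<open>Suc\<close>.\<close>
  ultimately show ?thesis by (intro exI[of _ "\<lambda>n. fst (f (Suc n))"] exI[of _ "\<lambda>n. snd (f n)"]) blast
qed

definition pack_I :: "(int \<Rightarrow> nat) \<Rightarrow> (int \<Rightarrow> real) \<Rightarrow> disc set" where
  "pack_I \<delta> y = {big (of_int (2 * j + k)) (y k) | j k. True}
       \<union> {small (of_int (2 * j + k)) (y k + 1 + r) | j k. \<delta> k = 1}
       \<union> {small (of_int (2 * j + k + 1)) (y k + av) | j k. \<delta> k = 1}"

definition heights :: "(int \<Rightarrow> nat) \<Rightarrow> (int \<Rightarrow> real) \<Rightarrow> bool" where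
  "heights \<delta> y \<longleftrightarrow> range \<delta> \<subseteq> {0, 1} \<and> y 0 = 0 \<and> (\<forall>k. y (k + 1) = y k + layer_height r (\<delta> k))"

lemma class_I_iff: "P \<in> class_I r \<longleftrightarrow> (\<exists>\<delta> y. heights \<delta> y \<and> (\<exists>k. \<delta> k \<noteq> 0) \<and> P = pack_I \<delta> y)"
  unfolding class_I_def heights_def pack_I_def sqrt_av by blast

lemma mem_cnj: "(Complex x (- y), p) \<in> move cnj ` P \<longleftrightarrow> (Complex x y, p) \<in> P"
proof -
  have "Complex x (- y) = cnj (Complex x y)" by (simp add: complex_cnj)
  moreover have "move cnj D = move cnj E \<longleftrightarrow> D = E" for D E by (simp add: prod_eq_iff)
  ultimately show ?thesis
    by (metis (no_types, lifting) fst_conv image_iff snd_conv)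
qed

text \<open>Rows above the first come from the upward construction; those below come from the same
  construction in the packing reflected in the real axis.\<close>

lemma class_I_layers:
  assumes cp: "compact_packing_using r P" and R: "row P 0 0" and B: "below P d 0 0"
  shows "\<exists>\<delta> y. heights \<delta> y \<and> pack_I \<delta> y \<subseteq> P"
proof -
  obtain e y where y: "y 0 = 0" and e: "e n \<in> {0, 1}" "y (Suc n) = y n + layer_height r (e n)"
    "row P (real n) (y n)" "above P (e n) (real n) (y n)" for n :: nat
    using class_I_up[OF assms] by blast
  define P' where "P' = move cnj ` P"
  have cp': "compact_packing_using r P'" unfolding P'_def
    by (rule compact_packing_using_move[OF plane_isometry_cnj cp])
  have mem: "(Complex x z, p) \<in> P' \<longleftrightarrow> (Complex x (- z), p) \<in> P" for x z p
    using mem_cnj[of x "- z" p P] by (simp add: P'_def)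
  have R': "row P' 0 0" using R by (simp add: row_def mem)
  \<comment> \<open>What lies above row 0 lies below it after the reflection, so it can start the
    second construction.\<close>
  have "below P' (e 0) 0 0" using e(4)[of 0] 
    by (simp add: y below_def above_def row_def mem add.commute split: if_splits)
  then obtain f z where z: "z 0 = 0" and f: "f n \<in> {0, 1}" "z (Suc n) = z n + layer_height r (f n)"
    "row P' (real n) (z n)" "above P' (f n) (real n) (z n)" for n :: nat
    using class_I_up[OF cp' R'] by blast
  \<comment> \<open>Gap \<open>-n - 1\<close> lies between rows \<open>-n - 1\<close> and
    \<open>-n\<close>; in the reflected packing it is the gap above row \<open>n\<close>.\<close>
  define \<delta> where "\<delta> = (\<lambda>k::int. if k \<ge> 0 then e (nat k) else f (nat (- k - 1)))"
  define Y where "Y = (\<lambda>k::int. if k \<ge> 0 then y (nat k) else - z (nat (- k)))"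
  have neg: "\<exists>n. k = - int n - 1" if "\<not> k \<ge> 0" for k :: int
    using that by (intro exI[of _ "nat (- k - 1)"]) simp
  have dn: "\<delta> (int n) = e n" "\<delta> (- int n - 1) = f n" "Y (int n) = y n" "Y (- int n) = - z n"
    "Y (- int n - 1) = - z (Suc n)" for n
  proof -
    have "nat (- (- int n - 1)) = Suc n" by simp
    then show "\<delta> (int n) = e n" "\<delta> (- int n - 1) = f n" "Y (int n) = y n" "Y (- int n) = - z n"
      "Y (- int n - 1) = - z (Suc n)" by (auto simp: \<delta>_def Y_def y z)
  qed
  have "Y (k + 1) = Y k + layer_height r (\<delta> k)" for k
  proof (cases "k \<ge> 0")
    case True
    then obtain n where k: "k = int n" using nonneg_int_cases by blast
    then have "k + 1 = int (Suc n)" by simp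
    then show ?thesis using dn(1,3) k e(2) by metis
  next
    case False
    then obtain n where k: "k = - int n - 1" using neg by blast
    then have "k + 1 = - int n" by simp
    then show ?thesis using f(2)[of n] by (simp add: dn k)
  qed
  moreover have "\<delta> k \<in> {0, 1}" for k using e(1) f(1) by (simp add: \<delta>_def)
  then have "range \<delta> \<subseteq> {0, 1}" by (rule image_subsetI)
  moreover have "Y 0 = 0" by (simp add: Y_def y)
  ultimately have h: "heights \<delta> Y" unfolding heights_def by (intro conjI allI)
  have b: "big (of_int (2 * j + k)) (Y k) \<in> P" for j k
  proof (cases "k \<ge> 0")
    case True
    then obtain n where k: "k = int n" using nonneg_int_cases by blast
    have "big (real n + 2 * of_int j) (y n) \<in> P" using e(3)[of n] unfolding row_def by blast
    then show ?thesis by (simp add: k dn add.commute)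
  next
    case False
    then obtain n where k: "k = - int n - 1" using neg by blast
    have "big (real (Suc n) + 2 * of_int (j - int (Suc n))) (z (Suc n)) \<in> P'" using f(3)[of "Suc n"] unfolding row_def by blast
    then show ?thesis by (simp add: k dn mem algebra_simps)
  qed
  have s: "small (of_int (2 * j + k)) (Y k + 1 + r) \<in> P \<and> small (of_int (2 * j + k + 1)) (Y k + av) \<in> P" if d: "\<delta> k = 1" for j k
  proof (cases "k \<ge> 0")
    case True
    then obtain n where k: "k = int n" using nonneg_int_cases by blast
    have "e n \<noteq> 0" using d by (simp add: k dn)
    then have "\<forall>j::int. small (real n + 2 * of_int j) (y n + 1 + r) \<in> P \<and> small (real n + 2 * of_int j + 1) (y n + av) \<in> P"
      using e(4)[of n] by (simp add: above_def)
    then show ?thesis by (simp add: k dn add.commute)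
  next
    case False
    then obtain n where k: "k = - int n - 1" using neg by blast
    have fn: "f n \<noteq> 0" using d by (simp add: k dn)
    then have A: "\<forall>j::int. small (real n + 2 * of_int j) (z n + 1 + r) \<in> P' \<and> small (real n + 2 * of_int j + 1) (z n + av) \<in> P'"
      using f(4)[of n] by (simp add: above_def)
    \<comment> \<open>Seen from below, the two small layers of a gap exchange roles:
      \<open>1 + r\<close> above reflected row \<open>n\<close> is \<open>av\<close> above row
      \<open>-n - 1\<close>.\<close>
    have "small (real n + 2 * of_int (j - int n)) (z n + 1 + r) \<in> P'"
      "small (real n + 2 * of_int (j - int n - 1) + 1) (z n + av) \<in> P'" using A by blast+
    moreover have "z (Suc n) = z n + 1 + r + av" using f(2)[of n] fn by (simp add: layer_height_av)
    ultimately show ?thesis by (simp add: k dn mem algebra_simps)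
  qed
  have "pack_I \<delta> Y \<subseteq> P" unfolding pack_I_def using b s by blast
  then show ?thesis using h by blast
qed

section \<open>The second class, layer by layer\<close>

lemma sv_hv: "1.29 < sv * hv" "sv * hv < 1.32"
proof -
  have e: "sv * hv = 2 / (1 + r)" using r_pos by (simp add: sv_def hv_def)
  show "1.29 < sv * hv" "sv * hv < 1.32" unfolding e using r_bounds by (simp_all add: field_simps)
qed

lemmas constants_II = qv_eqs qv_bounds sv_hv av_bounds r_bounds r_pos

text \<open>Triangles at a large disc when the next row is shifted by \<open>+sv\<close>; the
  variants with \<open>_x\<close>, \<open>_y\<close>, \<open>_xy\<close> are the reflections in one
  or both axes.\<close>

lemma tri_II:
  shows "tri (big x y) (small (x + qv) (y - r)) (small (x + qv) (y + r))"
    "tri (big x y) (small (x + qv) (y + r)) (big (x + sv) (y + hv))"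
    "tri (big x y) (big (x + sv) (y + hv)) (small (x + sv - qv) (y + hv - r))"
    "tri (big x y) (small (x + sv - qv) (y + hv - r)) (small (x - qv) (y + r))"
    "tri (big x y) (small (x - qv) (y + r)) (small (x - qv) (y - r))"
  by (rule tri_Complex; use constants_II in \<open>simp add: power2_eq_square algebra_simps\<close>)+

lemma tri_II_x:
  shows "tri (big x y) (big (x - sv) (y + hv)) (small (x - qv) (y + r))"
    "tri (big x y) (small (x - sv + qv) (y + hv - r)) (big (x - sv) (y + hv))"
    "tri (big x y) (small (x + qv) (y + r)) (small (x - sv + qv) (y + hv - r))"
  by (rule tri_Complex; use constants_II in \<open>simp add: power2_eq_square algebra_simps\<close>)+

lemma tri_II_y:
  shows "tri (big x y) (big (x + sv) (y - hv)) (small (x + qv) (y - r))"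
    "tri (big x y) (small (x + sv - qv) (y - hv + r)) (big (x + sv) (y - hv))"
    "tri (big x y) (small (x - qv) (y - r)) (small (x + sv - qv) (y - hv + r))"
  by (rule tri_Complex; use constants_II in \<open>simp add: power2_eq_square algebra_simps\<close>)+

lemma tri_II_xy:
  shows "tri (big x y) (small (x - qv) (y - r)) (big (x - sv) (y - hv))"
    "tri (big x y) (big (x - sv) (y - hv)) (small (x - sv + qv) (y - hv + r))"
    "tri (big x y) (small (x - sv + qv) (y - hv + r)) (small (x + qv) (y - r))"
  by (rule tri_Complex; use constants_II in \<open>simp add: power2_eq_square algebra_simps\<close>)+

definition row2 :: "disc set \<Rightarrow> real \<Rightarrow> real \<Rightarrow> bool" where
  "row2 P x y \<longleftrightarrow> (\<forall>j::int. big (x + 2 * qv * of_int j) y \<in> P \<and>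
     small (x + 2 * qv * of_int j + qv) (y + r) \<in> P \<and> small (x + 2 * qv * of_int j + qv) (y - r) \<in> P)"

text \<open>The sign \<open>e\<close> gives the shift of the row below. Only those discs of that row
  which touch the large disc from below are recorded.\<close>

definition below2 :: "disc set \<Rightarrow> real \<Rightarrow> real \<Rightarrow> real \<Rightarrow> bool" where
  "below2 P e x y \<longleftrightarrow> (\<forall>j::int. big (x + 2 * qv * of_int j + e * sv) (y - hv) \<in> P \<and>
     small (x + 2 * qv * of_int j + e * (sv - qv)) (y - hv + r) \<in> P)"

lemma row2_at:
  assumes "row2 P x y"
  shows "big (x + 2 * qv * of_int j) y \<in> P"
    "small (x + 2 * qv * of_int j + qv) (y + r) \<in> P" "small (x + 2 * qv * of_int j + qv) (y - r) \<in> P"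
    "small (x + 2 * qv * of_int j - qv) (y + r) \<in> P" "small (x + 2 * qv * of_int j - qv) (y - r) \<in> P"
proof -
  show "big (x + 2 * qv * of_int j) y \<in> P"
    "small (x + 2 * qv * of_int j + qv) (y + r) \<in> P" "small (x + 2 * qv * of_int j + qv) (y - r) \<in> P"
    using assms[unfolded row2_def, rule_format, of j] by simp_all
  have e: "x + 2 * qv * of_int (j - 1) + qv = x + 2 * qv * of_int j - qv" by (simp add: algebra_simps)
  show "small (x + 2 * qv * of_int j - qv) (y + r) \<in> P" "small (x + 2 * qv * of_int j - qv) (y - r) \<in> P"
    using assms[unfolded row2_def, rule_format, of "j - 1"] unfolding e by simp_all
qed

lemma below2_row2:
  assumes R: "row2 P (x + e * sv) (y - hv)" and e: "e \<in> {1, -1}"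
  shows "below2 P e x y"
  unfolding below2_def
proof (intro allI conjI)
  fix j :: int
  have 1: "x + e * sv + 2 * qv * of_int j = x + 2 * qv * of_int j + e * sv" by simp
  show "big (x + 2 * qv * of_int j + e * sv) (y - hv) \<in> P" using row2_at(1)[OF R, of j] unfolding 1 .
  from e show "small (x + 2 * qv * of_int j + e * (sv - qv)) (y - hv + r) \<in> P"
  proof (elim insertE emptyE)
    assume e: "e = 1"
    have 2: "x + e * sv + 2 * qv * of_int j - qv = x + 2 * qv * of_int j + e * (sv - qv)"
      unfolding e by simp
    show ?thesis using row2_at(4)[OF R, of j] unfolding 2 .
  next
    assume e: "e = - 1"
    have 2: "x + e * sv + 2 * qv * of_int j + qv = x + 2 * qv * of_int j + e * (sv - qv)"
      unfolding e by simp
    show ?thesis using row2_at(2)[OF R, of j] unfolding 2 .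
  qed
qed

text \<open>Six of the eight neighbours are known, from the upper left small disc through the bottom
  to the upper right one. The admissible words leave LS or SL for the rest, which are the two
  possible shifts.\<close>

lemma upper_dichotomy:
  assumes cp: "compact_packing_using r P" and e: "e \<in> {1, -1}"
    and m: "big x y \<in> P" "small (x + qv) (y + r) \<in> P" "small (x + qv) (y - r) \<in> P"
      "small (x - qv) (y + r) \<in> P" "small (x - qv) (y - r) \<in> P"
      "big (x + e * sv) (y - hv) \<in> P" "small (x + e * (sv - qv)) (y - hv + r) \<in> P"
  shows "(big (x + sv) (y + hv) \<in> P \<and> small (x + sv - qv) (y + hv - r) \<in> P) \<or>
    (big (x - sv) (y + hv) \<in> P \<and> small (x - sv + qv) (y + hv - r) \<in> P)"
proof -
  define X where "X = big x y"
  define S where "S = small (x - qv) (y + r)"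
  define R where "R = small (x + qv) (y + r)"
  have mX: "X \<in> P" "S \<in> P" "R \<in> P" "radius X = 1" using m by (simp_all add: X_def S_def R_def)
  have "\<exists>L. successively (tri X) (S # L @ [R]) \<and> set L \<subseteq> P \<and> (map radius L = [r, r, 1, r] \<or> map radius L = [r, 1, r, r])"
    using e
  proof (elim insertE emptyE)
    assume e: "e = 1"
    have "set [small (x - qv) (y - r), small (x + sv - qv) (y - hv + r), big (x + sv) (y - hv), small (x + qv) (y - r)] \<subseteq> P"
      using m by (simp add: e algebra_simps)
    moreover have "successively (tri X) (S # [small (x - qv) (y - r), small (x + sv - qv) (y - hv + r),
        big (x + sv) (y - hv), small (x + qv) (y - r)] @ [R])"
      using tri_II(1,5)[of x y] tri_II_y[of x y] by (simp add: X_def S_def R_def)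
    ultimately show ?thesis by (intro exI conjI disjI1) (assumption, assumption, simp)
  next
    assume e: "e = - 1"
    have "set [small (x - qv) (y - r), big (x - sv) (y - hv), small (x - sv + qv) (y - hv + r), small (x + qv) (y - r)] \<subseteq> P"
      using m by (simp add: e algebra_simps)
    moreover have "successively (tri X) (S # [small (x - qv) (y - r), big (x - sv) (y - hv),
        small (x - sv + qv) (y - hv + r), small (x + qv) (y - r)] @ [R])"
      using tri_II(1,5)[of x y] tri_II_xy[of x y] by (simp add: X_def S_def R_def)
    ultimately show ?thesis by (intro exI conjI disjI2) (assumption, assumption, simp)
  qed
  then obtain L where L: "successively (tri X) (S # L @ [R])" "set L \<subseteq> P"
    and rL: "map radius L = [r, r, 1, r] \<or> map radius L = [r, 1, r, r]" by (elim exE conjE)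
  have "tangent X S" using L(1) by (cases L) (auto simp: tri_def)
  moreover have "length (L @ [R]) < 6" using rL by (auto dest: arg_cong[where f = length])
  ultimately obtain Hs where Hs: "corona P X (S # (L @ [R]) @ Hs)" "map radius (S # (L @ [R]) @ Hs) \<in> large_words"
    using large_corona[OF cp mX(1,4), of S "L @ [R]"] mX L by auto
  then have "map radius Hs = [1, r] \<or> map radius Hs = [r, 1]" using rL r_less
    by (auto simp: large_words_def rots_simps S_def R_def)
  then obtain F G where "Hs = [F, G]" and w: "radius F = 1 \<and> radius G = r \<or> radius F = r \<and> radius G = 1"
    by (auto simp: map_eq_Cons_conv)
  then have H: "corona P X (S # L @ R # [F, G])" using Hs(1) by simp
  have t: "tri X R F" "tri X F G" and FG: "F \<in> P" "G \<in> P" using corona_suffix[OF H] by simp_all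
  from w show ?thesis
  proof
    assume w: "radius F = 1 \<and> radius G = r"
    have F: "F = big (x + sv) (y + hv)"
      by (rule cp_tri_eq[OF cp mX(1,3) FG(1) t(1)]) (use w tri_II(2) in \<open>simp_all add: X_def R_def\<close>)
    have "G = small (x + sv - qv) (y + hv - r)"
      by (rule cp_tri_eq[OF cp mX(1) FG t(2)]) (use w tri_II(3) in \<open>simp_all add: X_def F\<close>)
    then show ?thesis using FG F by simp
  next
    assume w: "radius F = r \<and> radius G = 1"
    have F: "F = small (x - sv + qv) (y + hv - r)"
      by (rule cp_tri_eq[OF cp mX(1,3) FG(1) t(1)]) (use w tri_II_x(3) in \<open>simp_all add: X_def R_def\<close>)
    have "G = big (x - sv) (y + hv)"
      by (rule cp_tri_eq[OF cp mX(1) FG t(2)]) (use w tri_II_x(2) in \<open>simp_all add: X_def F\<close>)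
    then show ?thesis using FG F by simp
  qed
qed

text \<open>Each lower small disc of the new row already has neighbours L, S, L, L, so its fifth
  neighbour is small; it is the upper disc of the vertical pair.\<close>

lemma row2_up:
  assumes cp: "compact_packing_using r P" and R: "row2 P x y"
    and W: "\<And>j::int. big (x + 2 * qv * of_int j + sv) (y + hv) \<in> P"
    and F: "\<And>j::int. small (x + 2 * qv * of_int j + sv - qv) (y + hv - r) \<in> P"
  shows "row2 P (x + sv) (y + hv)"
  unfolding row2_def
proof
  fix j :: int
  define u where "u = x + 2 * qv * of_int j"
  have u1: "x + 2 * qv * of_int (j + 1) = u + 2 * qv" by (simp add: u_def algebra_simps)
  define S V0 W0 Y V1 where "S = small (u + qv + sv) (y + hv - r)" and "V0 = big (u + sv) (y + hv)"
    and "W0 = small (u + qv) (y + r)" and "Y = big (u + 2 * qv) y" and "V1 = big (u + 2 * qv + sv) (y + hv)"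
  have "small (u + 2 * qv + sv - qv) (y + hv - r) \<in> P" using F[of "j + 1"] unfolding u1 .
  moreover have "u + 2 * qv + sv - qv = u + qv + sv" by simp
  ultimately have mS: "S \<in> P" by (simp add: S_def)
  have m: "V0 \<in> P" "W0 \<in> P" "Y \<in> P" "V1 \<in> P"
    using W[of j] W[of "j + 1"] row2_at(1)[OF R, of "j + 1"] row2_at(2)[OF R, of j]
    unfolding u1 unfolding u_def[symmetric] by (simp_all add: V0_def W0_def Y_def V1_def)
  have t: "tri S V0 W0" "tri S W0 Y" "tri S Y V1" "tri S V1 (small (u + qv + sv) (y + hv + r))"
    unfolding S_def V0_def W0_def Y_def V1_def
    by (rule tri_Complex; use constants_II in \<open>simp add: power2_eq_square algebra_simps\<close>)+
  have tV: "tangent S V0" using t by (simp add: tri_def)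
  obtain Hs where H: "corona P S (V0 # [W0, Y, V1] @ Hs)" "map radius (V0 # [W0, Y, V1] @ Hs) \<in> set (rots [1, r, 1, 1, r])"
    using small_corona[OF cp mS _ tV, of "[W0, Y, V1]"] t m by (auto simp: S_def)
  then obtain G where G: "Hs = [G]" "radius G = r" using r_less
    by (auto simp: rots_simps map_eq_Cons_conv V0_def W0_def Y_def V1_def)
  have GP: "G \<in> P" "tri S V1 G" using corona_suffix[of P S V0 "[W0, Y]" V1 Hs] H(1) G by auto
  have "G = small (u + qv + sv) (y + hv + r)"
    by (rule cp_tri_eq[OF cp mS m(4) GP t(4) G(2)])
  then have "small (u + qv + sv) (y + hv + r) \<in> P" using GP by simp
  then show "big (x + sv + 2 * qv * of_int j) (y + hv) \<in> P \<and>
     small (x + sv + 2 * qv * of_int j + qv) (y + hv + r) \<in> P \<and> small (x + sv + 2 * qv * of_int j + qv) (y + hv - r) \<in> P"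
    using m mS by (simp add: u_def V0_def S_def algebra_simps)
qed

lemma mem_mirror: "(Complex (- x) y, p) \<in> move (\<lambda>z. - cnj z) ` P \<longleftrightarrow> (Complex x y, p) \<in> P"
proof -
  have "Complex (- x) y = - cnj (Complex x y)" by (simp add: complex_eq_iff)
  moreover have "move (\<lambda>z. - cnj z) D = move (\<lambda>z. - cnj z) E \<longleftrightarrow> D = E" for D E by (simp add: prod_eq_iff)
  ultimately show ?thesis
    by (metis (no_types, lifting) fst_conv image_iff snd_conv)
qed

lemma row2_mirror: "row2 (move (\<lambda>z. - cnj z) ` P) (- x) y \<longleftrightarrow> row2 P x y"
proof -
  have "row2 P x y" if R: "row2 (move (\<lambda>z. - cnj z) ` P) (- x) y" for P x
    unfolding row2_def
  proof
    fix j :: int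
    have "- x + 2 * qv * of_int (- j) = - (x + 2 * qv * of_int j)"
      "- x + 2 * qv * of_int (- j) - qv = - (x + 2 * qv * of_int j + qv)" by simp_all
    then show "big (x + 2 * qv * of_int j) y \<in> P \<and>
     small (x + 2 * qv * of_int j + qv) (y + r) \<in> P \<and> small (x + 2 * qv * of_int j + qv) (y - r) \<in> P"
      using row2_at(1,4,5)[OF R, of "- j"] by (simp only: mem_mirror simp_thms)
  qed
  from this[of P x] this[of "move (\<lambda>z. - cnj z) ` P" "- x"] show ?thesis
    by (auto simp: image_image)
qed

lemma row2_up_minus:
  assumes cp: "compact_packing_using r P" and R: "row2 P x y"
    and W: "\<And>j::int. big (x + 2 * qv * of_int j - sv) (y + hv) \<in> P"
    and F: "\<And>j::int. small (x + 2 * qv * of_int j - sv + qv) (y + hv - r) \<in> P"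
  shows "row2 P (x - sv) (y + hv)"
proof -
  define P' where "P' = move (\<lambda>z. - cnj z) ` P"
  have cp': "compact_packing_using r P'" unfolding P'_def
    by (rule compact_packing_using_move[OF plane_isometry_uminus_cnj cp])
  have "row2 P' (- x + sv) (y + hv)"
  proof (rule row2_up[OF cp'])
    show "row2 P' (- x) y" using R by (simp add: P'_def row2_mirror)
    fix j :: int
    have 1: "- x + 2 * qv * of_int j + sv = - (x + 2 * qv * of_int (- j) - sv)"
      "- x + 2 * qv * of_int j + sv - qv = - (x + 2 * qv * of_int (- j) - sv + qv)" by simp_all
    show "big (- x + 2 * qv * of_int j + sv) (y + hv) \<in> P'"
      unfolding 1(1) P'_def mem_mirror by (rule W)
    show "small (- x + 2 * qv * of_int j + sv - qv) (y + hv - r) \<in> P'"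
      unfolding 1(2) P'_def mem_mirror by (rule F)
  qed
  then have "row2 P' (- (x - sv)) (y + hv)" by simp
  then show ?thesis unfolding P'_def row2_mirror .
qed

lemma class_II_step:
  assumes cp: "compact_packing_using r P" and R: "row2 P x y" and B: "below2 P e x y" "e \<in> {1, -1}"
  shows "\<exists>d. d \<in> {1, -1} \<and> row2 P (x + d * sv) (y + hv)"
proof -
  define X where "X = (\<lambda>j::int. x + 2 * qv * of_int j)"
  have X1: "X (j + 1) = X j + 2 * qv" for j by (simp add: X_def algebra_simps)
  have RX: "big (X j) y \<in> P" "small (X j + qv) (y + r) \<in> P" "small (X j + qv) (y - r) \<in> P"
    "small (X j - qv) (y + r) \<in> P" "small (X j - qv) (y - r) \<in> P" for j
    unfolding X_def by (rule row2_at[OF R])+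
  define plus where "plus = (\<lambda>j. big (X j + sv) (y + hv) \<in> P \<and> small (X j + sv - qv) (y + hv - r) \<in> P)"
  define minus where "minus = (\<lambda>j. big (X j - sv) (y + hv) \<in> P \<and> small (X j - sv + qv) (y + hv - r) \<in> P)"
  have dich: "plus j \<or> minus j" for j
    unfolding plus_def minus_def
  proof (rule upper_dichotomy[OF cp B(2) RX])
    show "big (X j + e * sv) (y - hv) \<in> P" "small (X j + e * (sv - qv)) (y - hv + r) \<in> P"
      using B(1)[unfolded below2_def, rule_format, of j] by (simp_all add: X_def)
  qed
  have excl: False if a: "plus j" "minus j" for j
  proof -
    have m: "big (X j + sv) (y + hv) \<in> P" "small (X j - sv + qv) (y + hv - r) \<in> P"
      using a by (simp_all add: plus_def minus_def)
    have "big (X j + sv) (y + hv) = small (X j - sv + qv) (y + hv - r)"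
      by (rule cp_apex_unique[OF cp RX(1,2) m tri_II(2) tri_II_x(3)])
    then show False using r_less by simp
  qed
  \<comment> \<open>The small disc between two large discs of the row sees L, S, L below. In LSLLS
    the letters before and after such a block differ, so flanking discs of equal radius are
    impossible. If neighbouring large discs chose opposite shifts, the flanking discs would be both
    large or both small.\<close>
  have clash: False if VG: "V \<in> P" "G \<in> P" "radius G = radius V"
    and t: "tri (small (X j + qv) (y + r)) V (big (X j) y)" "tri (small (X j + qv) (y + r)) (big (X j + 2 * qv) y) G"
    for V G j
  proof -
    define S A B Y where "S = small (X j + qv) (y + r)" and "A = big (X j) y" and "B = small (X j + qv) (y - r)"
      and "Y = big (X j + 2 * qv) y"
    have m: "S \<in> P" "A \<in> P" "B \<in> P" "Y \<in> P"
      using RX(1-3)[of j] RX(1)[of "j + 1"] unfolding X1 by (simp_all add: S_def A_def B_def Y_def)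
    have t': "tri S V A" "tri S Y G" using t by (simp_all add: S_def A_def Y_def)
    have t2: "tri S A B" "tri S B Y" unfolding S_def A_def B_def Y_def
      by (rule tri_Complex; use constants_II in \<open>simp add: power2_eq_square algebra_simps\<close>)+
    have tV: "tangent S V" using t' by (simp add: tri_def)
    obtain Hs where "map radius (V # [A, B, Y, G] @ Hs) \<in> set (rots [1, r, 1, 1, r])"
      using small_corona[OF cp m(1) _ tV, of "[A, B, Y, G]"] t' t2 m VG by (auto simp: S_def)
    then show False using VG(3) r_less by (auto simp: rots_simps A_def B_def Y_def)
  qed
  have ex2: False if a: "plus j" "minus (j + 1)" for j
    by (rule clash[of "big (X j + sv) (y + hv)" "big (X j + 2 * qv - sv) (y + hv)" j])
      (use a in \<open>simp_all add: plus_def minus_def X1\<close>,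
        (rule tri_Complex; use constants_II in \<open>simp add: power2_eq_square algebra_simps\<close>)+)
  have ex3: False if a: "minus j" "plus (j + 1)" for j
    by (rule clash[of "small (X j - sv + qv) (y + hv - r)" "small (X j + 2 * qv + sv - qv) (y + hv - r)" j])
      (use a in \<open>simp_all add: plus_def minus_def X1\<close>,
        (rule tri_Complex; use constants_II in \<open>simp add: power2_eq_square algebra_simps\<close>)+)
  have const: "plus j \<longleftrightarrow> plus 0" for j
  proof (rule int_const)
    show "plus (i + 1) \<longleftrightarrow> plus i" for i using dich[of i] dich[of "i + 1"] ex2[of i] ex3[of i] by argo
  qed
  show ?thesis
  proof (cases "plus 0")
    case True
    then have p: "plus j" for j using const by simp
    have "row2 P (x + sv) (y + hv)"
      by (rule row2_up[OF cp R]; use p in \<open>simp add: plus_def X_def\<close>)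
    then show ?thesis by (intro exI[of _ 1]) simp
  next
    case False
    then have p: "minus j" for j using const dich by blast
    have "row2 P (x - sv) (y + hv)"
      by (rule row2_up_minus[OF cp R]; use p in \<open>simp add: minus_def X_def\<close>)
    then show ?thesis by (intro exI[of _ "-1"]) simp
  qed
qed

text \<open>The seed of Class II: a large disc surrounded by LSSLSSSS. It is symmetric in the real
  axis, so the lower half of each deduction follows by conjugation.\<close>

definition dconf :: "disc set \<Rightarrow> real \<Rightarrow> bool" where
  "dconf P x \<longleftrightarrow> {big x 0, small (x + qv) (- r), small (x + qv) r, big (x + sv) hv, small (x + sv - qv) (hv - r),
     small (x - qv) r, small (x - qv) (- r), small (x + sv - qv) (- (hv - r)), big (x + sv) (- hv)} \<subseteq> P"

lemma dconf_cnj: "dconf (move cnj ` P) x \<longleftrightarrow> dconf P x"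
proof -
  have m: "(Complex x z, p) \<in> move cnj ` P \<longleftrightarrow> (Complex x (- z), p) \<in> P" for x z p
    using mem_cnj[of x "- z" p P] by simp
  show ?thesis unfolding dconf_def insert_subset m by auto
qed

lemma dconf_right_aux:
  assumes cp: "compact_packing_using r P" and D: "dconf P x"
  shows "big (x + 2 * qv) 0 \<in> P" "small (x + 2 * qv + sv - qv) (hv - r) \<in> P"
proof -
  define S A B C where "S = small (x + qv) r" and "A = big (x + sv) hv" and "B = big x 0" and "C = small (x + qv) (- r)"
  define Y F where "Y = big (x + 2 * qv) 0" and "F = small (x + 2 * qv + sv - qv) (hv - r)"
  have m: "S \<in> P" "A \<in> P" "B \<in> P" "C \<in> P" using D by (auto simp: dconf_def S_def A_def B_def C_def)
  have t: "tri S A B" "tri S B C" "tri S C Y" "tri S Y F"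
    unfolding S_def A_def B_def C_def Y_def F_def by (rule tri_Complex; use constants_II in \<open>simp add: power2_eq_square algebra_simps\<close>)+
  have tA: "tangent S A" using t by (simp add: tri_def)
  obtain Hs where H: "corona P S (A # [B, C] @ Hs)" "map radius (A # [B, C] @ Hs) \<in> set (rots [1, r, 1, 1, r])"
    using small_corona[OF cp m(1) _ tA, of "[B, C]"] t m by (auto simp: S_def)
  then obtain G K where G: "Hs = [G, K]" "radius G = 1" "radius K = r" using r_less
    by (auto simp: rots_simps map_eq_Cons_conv A_def B_def C_def)
  have GP: "G \<in> P" "K \<in> P" "tri S C G" "tri S G K" using corona_suffix[of P S A "[B]" C Hs] H(1) G by auto
  have Y: "G = Y" unfolding Y_def
    by (rule cp_tri_eq[OF cp m(1,4) GP(1,3) _ G(2)]) (use t(3) Y_def in simp)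
  have "K = F" unfolding F_def
    by (rule cp_tri_eq[OF cp m(1) GP(1,2,4) _ G(3)]) (use t(4) Y F_def in simp)
  then show "big (x + 2 * qv) 0 \<in> P" "small (x + 2 * qv + sv - qv) (hv - r) \<in> P"
    using GP Y by (simp_all add: Y_def F_def)
qed

text \<open>The next large disc in the row is known to have four consecutive small neighbours, and
  LSSLSSSS is the only admissible word with such a block.\<close>

lemma dconf_right:
  assumes cp: "compact_packing_using r P" and D: "dconf P x"
  shows "dconf P (x + 2 * qv)"
proof -
  define u where "u = x + 2 * qv"
  have "small (u + sv - qv) (- (hv - r)) \<in> P"
    using dconf_right_aux(2)[OF compact_packing_using_move[OF plane_isometry_cnj cp], of x] D
      mem_cnj[of "u + sv - qv" "- (hv - r)" r P] by (simp add: dconf_cnj u_def)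
  moreover note dconf_right_aux[OF cp D, folded u_def]
  moreover have e: "u - qv = x + qv" by (simp add: u_def)
  have "small (x + qv) r \<in> P" "small (x + qv) (- r) \<in> P" using D by (simp_all add: dconf_def)
  then have "small (u - qv) r \<in> P" "small (u - qv) (- r) \<in> P" unfolding e .
  moreover define Y A B C E where "Y = big u 0" and "A = small (u + sv - qv) (hv - r)" and "B = small (u - qv) r"
    and "C = small (u - qv) (- r)" and "E = small (u + sv - qv) (- (hv - r))"
  ultimately have m: "Y \<in> P" "A \<in> P" "B \<in> P" "C \<in> P" "E \<in> P" by simp_all
  define F G K L where "F = big (u + sv) (- hv)" and "G = small (u + qv) (- r)" and "K = small (u + qv) r"
    and "L = big (u + sv) hv"
  have t: "tri Y A B" "tri Y B C" "tri Y C E" "tri Y E F" "tri Y F G" "tri Y G K" "tri Y K L"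
    unfolding Y_def A_def B_def C_def E_def F_def G_def K_def L_def by (rule tri_Complex; use constants_II in \<open>simp add: power2_eq_square algebra_simps\<close>)+
  have tA: "tangent Y A" and rY: "radius Y = 1" using t by (simp_all add: tri_def Y_def)
  obtain Hs where H: "corona P Y (A # [B, C, E] @ Hs)" "map radius (A # [B, C, E] @ Hs) \<in> large_words"
    using large_corona[OF cp m(1) rY tA, of "[B, C, E]"] t m by auto
  then obtain F' G' K' L' where Hs: "Hs = [F', G', K', L']" "radius F' = 1" "radius G' = r" "radius K' = r" "radius L' = 1"
    using r_less by (auto simp: large_words_def rots_simps map_eq_Cons_conv A_def B_def C_def E_def)
  have p: "F' \<in> P" "G' \<in> P" "K' \<in> P" "L' \<in> P" "tri Y E F'" "tri Y F' G'" "tri Y G' K'" "tri Y K' L'"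
    using corona_suffix[of P Y A "[B, C]" E Hs] H(1) Hs by auto
  have F: "F' = F" unfolding F_def
    by (rule cp_tri_eq[OF cp m(1,5) p(1,5) _ Hs(2)]) (use t(4) F_def in simp)
  have G: "G' = G" unfolding G_def
    by (rule cp_tri_eq[OF cp m(1) p(1,2,6) _ Hs(3)]) (use t(5) F G_def in simp)
  have K: "K' = K" unfolding K_def
    by (rule cp_tri_eq[OF cp m(1) p(2,3,7) _ Hs(4)]) (use t(6) G K_def in simp)
  have L: "L' = L" unfolding L_def
    by (rule cp_tri_eq[OF cp m(1) p(3,4,8) _ Hs(5)]) (use t(7) K L_def in simp)
  have "{Y, G, K, L, A, B, C, E, F} \<subseteq> P" using m p(1-4) F G K L by simp
  then show ?thesis
    unfolding dconf_def u_def[symmetric] Y_def A_def B_def C_def E_def F_def G_def K_def L_def .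
qed

lemma dconf_left_aux:
  assumes cp: "compact_packing_using r P" and D: "dconf P x"
  shows "big (x - 2 * qv) 0 \<in> P" "big (x - 2 * qv + sv) hv \<in> P"
proof -
  define S A B C where "S = small (x - qv) r" and "A = small (x - qv) (- r)" and "B = big x 0"
    and "C = small (x + sv - qv) (hv - r)"
  define Y F where "Y = big (x - 2 * qv) 0" and "F = big (x - 2 * qv + sv) hv"
  have m: "S \<in> P" "A \<in> P" "B \<in> P" "C \<in> P" using D by (auto simp: dconf_def S_def A_def B_def C_def)
  have t: "tri S A B" "tri S B C" "tri S C F" "tri S F Y"
    unfolding S_def A_def B_def C_def Y_def F_def by (rule tri_Complex; use constants_II in \<open>simp add: power2_eq_square algebra_simps\<close>)+
  have tA: "tangent S A" using t by (simp add: tri_def)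
  obtain Hs where H: "corona P S (A # [B, C] @ Hs)" "map radius (A # [B, C] @ Hs) \<in> set (rots [1, r, 1, 1, r])"
    using small_corona[OF cp m(1) _ tA, of "[B, C]"] t m by (auto simp: S_def)
  then obtain G K where G: "Hs = [G, K]" "radius G = 1" "radius K = 1" using r_less
    by (auto simp: rots_simps map_eq_Cons_conv A_def B_def C_def)
  have GP: "G \<in> P" "K \<in> P" "tri S C G" "tri S G K" using corona_suffix[of P S A "[B]" C Hs] H(1) G by auto
  have F: "G = F" unfolding F_def
    by (rule cp_tri_eq[OF cp m(1,4) GP(1,3) _ G(2)]) (use t(3) F_def in simp)
  have "K = Y" unfolding Y_def
    by (rule cp_tri_eq[OF cp m(1) GP(1,2,4) _ G(3)]) (use t(4) F Y_def in simp)
  then show "big (x - 2 * qv) 0 \<in> P" "big (x - 2 * qv + sv) hv \<in> P"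
    using GP F by (simp_all add: Y_def F_def)
qed

text \<open>Here the known neighbours spell LSSL, which again occurs in LSSLSSSS only.\<close>

lemma dconf_left:
  assumes cp: "compact_packing_using r P" and D: "dconf P x"
  shows "dconf P (x - 2 * qv)"
proof -
  define u where "u = x - 2 * qv"
  have "big (u + sv) (- hv) \<in> P"
    using dconf_left_aux(2)[OF compact_packing_using_move[OF plane_isometry_cnj cp], of x] D
      mem_cnj[of "u + sv" "- hv" 1 P] by (simp add: dconf_cnj u_def)
  moreover note dconf_left_aux[OF cp D, folded u_def]
  moreover have e: "u + qv = x - qv" by (simp add: u_def)
  have "small (x - qv) r \<in> P" "small (x - qv) (- r) \<in> P" using D by (simp_all add: dconf_def)
  then have "small (u + qv) r \<in> P" "small (u + qv) (- r) \<in> P" unfolding e .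
  moreover define Y A B C E where "Y = big u 0" and "A = big (u + sv) (- hv)" and "B = small (u + qv) (- r)"
    and "C = small (u + qv) r" and "E = big (u + sv) hv"
  ultimately have m: "Y \<in> P" "A \<in> P" "B \<in> P" "C \<in> P" "E \<in> P" by simp_all
  define F G K L where "F = small (u + sv - qv) (hv - r)" and "G = small (u - qv) r" and "K = small (u - qv) (- r)"
    and "L = small (u + sv - qv) (- (hv - r))"
  have t: "tri Y A B" "tri Y B C" "tri Y C E" "tri Y E F" "tri Y F G" "tri Y G K" "tri Y K L"
    unfolding Y_def A_def B_def C_def E_def F_def G_def K_def L_def by (rule tri_Complex; use constants_II in \<open>simp add: power2_eq_square algebra_simps\<close>)+
  have tA: "tangent Y A" and rY: "radius Y = 1" using t by (simp_all add: tri_def Y_def)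
  obtain Hs where H: "corona P Y (A # [B, C, E] @ Hs)" "map radius (A # [B, C, E] @ Hs) \<in> large_words"
    using large_corona[OF cp m(1) rY tA, of "[B, C, E]"] t m by auto
  then obtain F' G' K' L' where Hs: "Hs = [F', G', K', L']" "radius F' = r" "radius G' = r" "radius K' = r" "radius L' = r"
    using r_less by (auto simp: large_words_def rots_simps map_eq_Cons_conv A_def B_def C_def E_def)
  have p: "F' \<in> P" "G' \<in> P" "K' \<in> P" "L' \<in> P" "tri Y E F'" "tri Y F' G'" "tri Y G' K'" "tri Y K' L'"
    using corona_suffix[of P Y A "[B, C]" E Hs] H(1) Hs by auto
  have F: "F' = F" unfolding F_def
    by (rule cp_tri_eq[OF cp m(1,5) p(1,5) _ Hs(2)]) (use t(4) F_def in simp)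
  have G: "G' = G" unfolding G_def
    by (rule cp_tri_eq[OF cp m(1) p(1,2,6) _ Hs(3)]) (use t(5) F G_def in simp)
  have K: "K' = K" unfolding K_def
    by (rule cp_tri_eq[OF cp m(1) p(2,3,7) _ Hs(4)]) (use t(6) G K_def in simp)
  have L: "L' = L" unfolding L_def
    by (rule cp_tri_eq[OF cp m(1) p(3,4,8) _ Hs(5)]) (use t(7) K L_def in simp)
  have "{Y, B, C, E, F, G, K, L, A} \<subseteq> P" using m p(1-4) F G K L by simp
  then show ?thesis
    unfolding dconf_def u_def[symmetric] Y_def A_def B_def C_def E_def F_def G_def K_def L_def .
qed


text \<open>The disc with this word is large because small ones have five neighbours. The list is
  rotated to start with the lower right small disc, placed at \<open>Complex qv (- r)\<close>; all
  other positions follow.\<close>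

lemma class_II_start:
  assumes cp: "compact_packing_using r P" and ns: "\<not> no_split P"
  obtains f where "plane_isometry f" "dconf (move f ` P) 0"
proof -
  obtain X Fs where X: "X \<in> P" "corona P X Fs" "map radius Fs \<in> set (rots [1, r, r, 1, r, r, r, r])"
    using ns unfolding no_split_def by blast
  have "radius X = 1"
  proof (rule ccontr)
    assume "radius X \<noteq> 1"
    then have "radius X = r" using cp_radius[OF cp X(1)] by simp
    from small_words[OF cp X(1) this X(2)] have "length Fs = 5"
      by (auto simp: rots_simps dest: arg_cong[where f = length])
    moreover have "length Fs = 8" using X(3) by (auto simp: rots_simps dest: arg_cong[where f = length])
    ultimately show False by simp
  qed
  obtain k where "rotate k (map radius Fs) = [1, r, r, 1, r, r, r, r]" using rots_unrotate[OF X(3)] by (elim exE)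
  then have "map radius (rotate (Suc k) Fs) = [r, r, 1, r, r, r, r, 1]" by (simp add: rotate_map rotate1_map[symmetric])
  then obtain F0 F1 F2 F3 F4 F5 F6 F7 where F: "rotate (Suc k) Fs = [F0, F1, F2, F3, F4, F5, F6, F7]"
    and rad: "radius F0 = r" "radius F1 = r" "radius F2 = 1" "radius F3 = r" "radius F4 = r" "radius F5 = r"
      "radius F6 = r" "radius F7 = 1"
    by (auto simp: map_eq_Cons_conv)
  have c: "corona P X [F0, F1, F2, F3, F4, F5, F6, F7]" using corona_rotate[OF X(2), of "Suc k"] unfolding F .
  have n1: "norm (Complex qv (- r)) = radius X + radius F0"
  proof -
    have "qv * qv + r * r = (1 + r)\<^sup>2" using qv_eqs(1) by (simp add: power2_eq_square algebra_simps)
    then show ?thesis using \<open>radius X = 1\<close> rad r_pos by (simp add: cmod_def power2_eq_square[symmetric])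
  qed
  have n2: "Complex qv (- r) \<noteq> 0" using r_pos by (simp add: complex_eq_iff)
  obtain f where f: "plane_isometry f" and fX: "f (centre X) = 0"
    and fc: "corona (move f ` P) (0, radius X) ((Complex qv (- r), radius F0) # map (move f) [F1, F2, F3, F4, F5, F6, F7])"
    using normalise_corona[OF c n1 n2] .
  define P' where "P' = move f ` P"
  define G1 G2 G3 G4 G5 G6 G7 where "G1 = move f F1" and "G2 = move f F2" and "G3 = move f F3" and "G4 = move f F4"
    and "G5 = move f F5" and "G6 = move f F6" and "G7 = move f F7"
  have rG: "radius G1 = r" "radius G2 = 1" "radius G3 = r" "radius G4 = r" "radius G5 = r"
      "radius G6 = r" "radius G7 = 1" using rad by (simp_all add: G1_def G2_def G3_def G4_def G5_def G6_def G7_def)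
  define Y A where "Y = big 0 0" and "A = small (0 + qv) (0 - r)"
  have "map (move f) [F1, F2, F3, F4, F5, F6, F7] = [G1, G2, G3, G4, G5, G6, G7]"
    by (simp add: G1_def G2_def G3_def G4_def G5_def G6_def G7_def)
  moreover have "(0, radius X) = Y" "(Complex qv (- r), radius F0) = A"
    using \<open>radius X = 1\<close> rad by (simp_all add: Y_def A_def complex_eq_iff)
  ultimately have cY: "corona P' Y (A # [] @ G1 # [G2, G3, G4, G5, G6, G7])"
    using fc unfolding P'_def by (simp only: append.simps)
  have cp': "compact_packing_using r P'" unfolding P'_def by (rule compact_packing_using_move[OF f cp])
  have m: "A \<in> P'" "G1 \<in> P'" "G2 \<in> P'" "G3 \<in> P'" "G4 \<in> P'" "G5 \<in> P'" "G6 \<in> P'" "G7 \<in> P'"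
    and t: "tri Y A G1" "tri Y G1 G2" "tri Y G2 G3" "tri Y G3 G4" "tri Y G4 G5" "tri Y G5 G6" "tri Y G6 G7"
    using cY corona_suffix[OF cY] by (auto simp: corona_def)
  have mY: "Y \<in> P'"
  proof -
    have "move f X \<in> P'" unfolding P'_def by (rule imageI[OF X(1)])
    moreover have "move f X = Y" using fX \<open>radius X = 1\<close> by (simp add: Y_def complex_eq_iff)
    ultimately show ?thesis by simp
  qed
  have 1: "G1 = small (0 + qv) (0 + r)"
    by (rule cp_tri_eq[OF cp' mY m(1,2) t(1) _ rG(1)]) (unfold Y_def A_def, rule tri_II(1))
  have 2: "G2 = big (0 + sv) (0 + hv)"
    by (rule cp_tri_eq[OF cp' mY m(2,3) t(2) _ rG(2)]) (unfold Y_def 1, rule tri_II(2))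
  have 3: "G3 = small (0 + sv - qv) (0 + hv - r)"
    by (rule cp_tri_eq[OF cp' mY m(3,4) t(3) _ rG(3)]) (unfold Y_def 2, rule tri_II(3))
  have 4: "G4 = small (0 - qv) (0 + r)"
    by (rule cp_tri_eq[OF cp' mY m(4,5) t(4) _ rG(4)]) (unfold Y_def 3, rule tri_II(4))
  have 5: "G5 = small (0 - qv) (0 - r)"
    by (rule cp_tri_eq[OF cp' mY m(5,6) t(5) _ rG(5)]) (unfold Y_def 4, rule tri_II(5))
  have 6: "G6 = small (0 + sv - qv) (0 - hv + r)"
    by (rule cp_tri_eq[OF cp' mY m(6,7) t(6) _ rG(6)]) (unfold Y_def 5, rule tri_II_y(3))
  have 7: "G7 = big (0 + sv) (0 - hv)"
    by (rule cp_tri_eq[OF cp' mY m(7,8) t(7) _ rG(7)]) (unfold Y_def 6, rule tri_II_y(2))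
  have "dconf P' 0" using mY m unfolding 1 2 3 4 5 6 7 by (simp add: dconf_def Y_def A_def)
  then show thesis using that[OF f] by (simp add: P'_def)
qed

lemma dconf_rows:
  assumes cp: "compact_packing_using r P" and D: "dconf P 0"
  shows "row2 P 0 0" "below2 P 1 0 0"
proof -
  have *: "dconf P (2 * qv * of_int j)" for j :: int
  proof (rule int_induct[where k = 0 and P = "\<lambda>j. dconf P (2 * qv * of_int j)"])
    show "dconf P (2 * qv * of_int 0)" using D by simp
  next
    fix i :: int assume "dconf P (2 * qv * of_int i)"
    note dconf_right[OF cp this]
    moreover have "2 * qv * of_int (i + 1) = 2 * qv * of_int i + 2 * qv" by (simp add: algebra_simps)
    ultimately show "dconf P (2 * qv * of_int (i + 1))" by (simp only:)
  next
    fix i :: int assume "dconf P (2 * qv * of_int i)"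
    note dconf_left[OF cp this]
    moreover have "2 * qv * of_int (i - 1) = 2 * qv * of_int i - 2 * qv" by (simp add: algebra_simps)
    ultimately show "dconf P (2 * qv * of_int (i - 1))" by (simp only:)
  qed
  show "row2 P 0 0" unfolding row2_def
  proof
    fix j :: int
    show "big (0 + 2 * qv * of_int j) 0 \<in> P \<and> small (0 + 2 * qv * of_int j + qv) (0 + r) \<in> P \<and>
      small (0 + 2 * qv * of_int j + qv) (0 - r) \<in> P" using *[of j] by (simp add: dconf_def)
  qed
  show "below2 P 1 0 0" unfolding below2_def
  proof
    fix j :: int
    show "big (0 + 2 * qv * of_int j + 1 * sv) (0 - hv) \<in> P \<and>
      small (0 + 2 * qv * of_int j + 1 * (sv - qv)) (0 - hv + r) \<in> P"
      using *[of j] by (simp add: dconf_def algebra_simps)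
  qed
qed

lemma class_II_up:
  assumes cp: "compact_packing_using r P" and "row2 P 0 0" "below2 P e 0 0" "e \<in> {1, -1}"
  shows "\<exists>(d :: nat \<Rightarrow> real) (x :: nat \<Rightarrow> real). x 0 = 0 \<and> (\<forall>n. d n \<in> {1, -1} \<and>
    x (Suc n) = x n + d n * sv \<and> row2 P (x n) (real n * hv))"
proof -
  define A where "A = (\<lambda>n (d, x). row2 P x (real n * hv) \<and> below2 P d x (real n * hv) \<and> d \<in> {1, -1} \<and> (n = 0 \<longrightarrow> x = 0))"
  define B where "B = (\<lambda>n :: nat. \<lambda>(d :: real, x) (d', x'). x' = x - d' * sv)"
  have "\<exists>f. \<forall>n. A n (f n) \<and> B n (f n) (f (Suc n))"
  proof (rule dependent_nat_choice)
    show "\<exists>s. A 0 s" using assms by (intro exI[of _ "(e, 0)"]) (simp add: A_def)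
  next
    fix s n assume "A n s"
    moreover obtain d x where s: "s = (d, x)" by (cases s)
    ultimately have "row2 P x (real n * hv)" "below2 P d x (real n * hv)" "d \<in> {1, -1}" by (simp_all add: A_def)
    from class_II_step[OF cp this] obtain d' where d': "d' \<in> {1, -1}" "row2 P (x + d' * sv) (real n * hv + hv)" by blast
    have e: "real n * hv + hv = real (Suc n) * hv" by (simp add: algebra_simps)
    \<comment> \<open>Seen from the new row the old one is shifted the other way, so the sign
      carried to the next step is \<open>- d'\<close>.\<close>
    have "below2 P (- d') (x + d' * sv) (real (Suc n) * hv)"
    proof (rule below2_row2)
      have "x + d' * sv + - d' * sv = x" "real (Suc n) * hv - hv = real n * hv" by (simp_all add: algebra_simps)
      then show "row2 P (x + d' * sv + - d' * sv) (real (Suc n) * hv - hv)"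
        using \<open>row2 P x (real n * hv)\<close> by (simp only:)
    qed (use d' in auto)
    then show "\<exists>t. A (Suc n) t \<and> B n s t" using d' unfolding e
      by (intro exI[of _ "(- d', x + d' * sv)"]) (auto simp: A_def B_def s)
  qed
  then obtain f where f: "A n (f n)" "B n (f n) (f (Suc n))" for n by blast
  have "snd (f 0) = 0" using f(1)[of 0] by (simp add: A_def split_beta)
  moreover have "- fst (f (Suc n)) \<in> {1, -1}" "snd (f (Suc n)) = snd (f n) + - fst (f (Suc n)) * sv"
    "row2 P (snd (f n)) (real n * hv)" for n
    using f(1)[of n] f(1)[of "Suc n"] f(2)[of n] by (auto simp: A_def B_def split_beta)
  ultimately show ?thesis by (intro exI[of _ "\<lambda>n. - fst (f (Suc n))"] exI[of _ "\<lambda>n. snd (f n)"]) blast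
qed

definition pack_II :: "(int \<Rightarrow> real) \<Rightarrow> disc set" where
  "pack_II x = {big (x k + of_int j * (2 * qv)) (of_int k * hv) | j k. True}
       \<union> {small (x k + (of_int j + 1 / 2) * (2 * qv)) (of_int k * hv + r) | j k. True}
       \<union> {small (x k + (of_int j + 1 / 2) * (2 * qv)) (of_int k * hv - r) | j k. True}"

definition shifts :: "(int \<Rightarrow> real) \<Rightarrow> (int \<Rightarrow> real) \<Rightarrow> bool" where
  "shifts \<epsilon> x \<longleftrightarrow> range \<epsilon> \<subseteq> {1, -1} \<and> x 0 = 0 \<and> (\<forall>k. x (k + 1) = x k + \<epsilon> k * sv)"

lemma class_II_iff: "P \<in> class_II r \<longleftrightarrow> (\<exists>\<epsilon> x. shifts \<epsilon> x \<and> P = pack_II x)"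
  unfolding class_II_def Let_def class_II_consts shifts_def pack_II_def by blast

lemma row2_cnj: "row2 (move cnj ` P) x y \<longleftrightarrow> row2 P x (- y)"
proof -
  have m: "(Complex x z, p) \<in> move cnj ` P \<longleftrightarrow> (Complex x (- z), p) \<in> P" for x z p
    using mem_cnj[of x "- z" p P] by simp
  have e: "- (y + r) = - y - r" "- (y - r) = - y + r" by simp_all
  show ?thesis unfolding row2_def m e by auto
qed

lemma class_II_layers:
  assumes cp: "compact_packing_using r P" and R: "row2 P 0 0" and B: "below2 P e 0 0" "e \<in> {1, -1}"
  shows "\<exists>\<epsilon> x. shifts \<epsilon> x \<and> pack_II x \<subseteq> P"
proof -
  obtain d x where x: "x 0 = 0" and d: "d n \<in> {1, -1}" "x (Suc n) = x n + d n * sv"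
    "row2 P (x n) (real n * hv)" for n :: nat
    using class_II_up[OF assms] by blast
  define P' where "P' = move cnj ` P"
  have cp': "compact_packing_using r P'" unfolding P'_def
    by (rule compact_packing_using_move[OF plane_isometry_cnj cp])
  have R': "row2 P' 0 0" using R by (simp add: P'_def row2_cnj)
  \<comment> \<open>Row 1, reflected in the real axis, is the row below that starts the downward
    construction.\<close>
  have "row2 P' (0 + d 0 * sv) (0 - hv)" using d(3)[of "Suc 0"] d(2)[of 0] by (simp add: P'_def row2_cnj x)
  from below2_row2[OF this d(1)] obtain f z where z: "z 0 = 0" and f: "f n \<in> {1, -1}" "z (Suc n) = z n + f n * sv"
    "row2 P' (z n) (real n * hv)" for n :: nat
    using class_II_up[OF cp' R' _ d(1)[of 0]] by blast
  \<comment> \<open>The sequence \<open>f\<close> records shifts while going down, so its sign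
    changes when they are read upwards.\<close>
  define \<epsilon> where "\<epsilon> = (\<lambda>k::int. if k \<ge> 0 then d (nat k) else - f (nat (- k - 1)))"
  define X where "X = (\<lambda>k::int. if k \<ge> 0 then x (nat k) else z (nat (- k)))"
  have neg: "\<exists>n. k = - int n - 1" if "\<not> k \<ge> 0" for k :: int
    using that by (intro exI[of _ "nat (- k - 1)"]) simp
  have dn: "\<epsilon> (int n) = d n" "\<epsilon> (- int n - 1) = - f n" "X (int n) = x n" "X (- int n) = z n"
    "X (- int n - 1) = z (Suc n)" for n
  proof -
    have "nat (- (- int n - 1)) = Suc n" by simp
    then show "\<epsilon> (int n) = d n" "\<epsilon> (- int n - 1) = - f n" "X (int n) = x n" "X (- int n) = z n"
      "X (- int n - 1) = z (Suc n)" by (auto simp: \<epsilon>_def X_def x z)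
  qed
  have "X (k + 1) = X k + \<epsilon> k * sv" for k
  proof (cases "k \<ge> 0")
    case True
    then obtain n where k: "k = int n" using nonneg_int_cases by blast
    then have "k + 1 = int (Suc n)" by simp
    then show ?thesis using dn(1,3) k d(2) by metis
  next
    case False
    then obtain n where k: "k = - int n - 1" using neg by blast
    then have "k + 1 = - int n" by simp
    then show ?thesis using f(2)[of n] by (simp add: dn k)
  qed
  moreover have "\<epsilon> k \<in> {1, -1}" for k using d(1)[of "nat k"] f(1)[of "nat (- k - 1)"] by (auto simp: \<epsilon>_def)
  then have "range \<epsilon> \<subseteq> {1, -1}" by (rule image_subsetI)
  moreover have "X 0 = 0" by (simp add: X_def x)
  ultimately have h: "shifts \<epsilon> X" unfolding shifts_def by (intro conjI allI)
  have rows: "row2 P (X k) (of_int k * hv)" for k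
  proof (cases "k \<ge> 0")
    case True
    then obtain n where k: "k = int n" using nonneg_int_cases by blast
    show ?thesis using d(3)[of n] by (simp add: k dn)
  next
    case False
    then obtain n where k: "k = - int n - 1" using neg by blast
    have "of_int k * hv = - (real (Suc n) * hv)" by (simp add: k algebra_simps)
    moreover have "row2 P (z (Suc n)) (- (real (Suc n) * hv))" using f(3)[of "Suc n"] unfolding P'_def row2_cnj .
    ultimately show ?thesis by (simp only: k dn)
  qed
  have "big (X k + of_int j * (2 * qv)) (of_int k * hv) \<in> P \<and>
    small (X k + (of_int j + 1 / 2) * (2 * qv)) (of_int k * hv + r) \<in> P \<and>
    small (X k + (of_int j + 1 / 2) * (2 * qv)) (of_int k * hv - r) \<in> P" for j k
  proof -
    have e: "X k + of_int j * (2 * qv) = X k + 2 * qv * of_int j"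
      "X k + (of_int j + 1 / 2) * (2 * qv) = X k + 2 * qv * of_int j + qv" by (simp_all add: algebra_simps)
    show ?thesis unfolding e using row2_at(1-3)[OF rows] by blast
  qed
  then have "pack_II X \<subseteq> P" unfolding pack_II_def by blast
  then show ?thesis using h by blast
qed

section \<open>The packings of both classes are compact\<close>

abbreviation apart :: "disc \<Rightarrow> disc \<Rightarrow> bool" where
  "apart D E \<equiv> radius D + radius E \<le> dist (centre D) (centre E)"

text \<open>By \<open>wreath_corona\<close> it suffices to exhibit one closing ring around each
  disc; that no neighbour is missing is automatic.\<close>

lemma compact_packing_usingI:
  assumes rad: "radius ` Q = {1, r}" and pack: "pairwise apart Q"
    and w: "\<And>D. D \<in> Q \<Longrightarrow> \<exists>Fs. wreath D Fs \<and> set Fs \<subseteq> Q"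
  shows "compact_packing_using r Q"
proof -
  have rQ: "radius D \<in> {1, r}" if "D \<in> Q" for D using rad that by blast
  then have pos: "\<forall>D\<in>Q. radius D > 0" using r_pos by fastforce
  have "\<exists>Fs. corona Q D Fs" if D: "D \<in> Q" for D
  proof -
    obtain Fs where "wreath D Fs" "set Fs \<subseteq> Q" using w[OF D] by blast
    from wreath_corona[OF pos pack D this, of "max_ang (radius D)"] ang_range[OF rQ rQ rQ] D show ?thesis by blast
  qed
  then show ?thesis using rad pos pack by (simp add: compact_packing_using_def compact_packing_iff)
qed

lemma apart_Complex:
  assumes "p1 > 0" "p2 > 0" "(p1 + p2) * (p1 + p2) \<le> (x2 - x1) * (x2 - x1) + (y2 - y1) * (y2 - y1)"
  shows "apart (Complex x1 y1, p1) (Complex x2 y2, p2)"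
proof -
  have "sqrt ((p1 + p2)\<^sup>2) \<le> sqrt ((x2 - x1)\<^sup>2 + (y2 - y1)\<^sup>2)"
    using assms(3) by (intro real_sqrt_le_mono) (simp add: power2_eq_square)
  moreover have "dist (Complex x1 y1) (Complex x2 y2) = sqrt ((x2 - x1)\<^sup>2 + (y2 - y1)\<^sup>2)"
    by (simp add: dist_norm cmod_def power2_commute)
  ultimately show ?thesis using assms(1,2) by simp
qed

lemma apart_sym: "apart D E \<longleftrightarrow> apart E D"
  by (simp add: dist_commute add.commute)

lemma apart_bounds:
  assumes "p1 > 0" "p2 > 0" "0 \<le> a" "a \<le> \<bar>x2 - x1\<bar>" "0 \<le> b" "b \<le> \<bar>y2 - y1\<bar>"
    "(p1 + p2) * (p1 + p2) \<le> a * a + b * b"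
  shows "apart (Complex x1 y1, p1) (Complex x2 y2, p2)"
proof (rule apart_Complex)
  have "a * a \<le> \<bar>x2 - x1\<bar> * \<bar>x2 - x1\<bar>" "b * b \<le> \<bar>y2 - y1\<bar> * \<bar>y2 - y1\<bar>"
    using assms by (intro mult_mono; linarith)+
  then show "(p1 + p2) * (p1 + p2) \<le> (x2 - x1) * (x2 - x1) + (y2 - y1) * (y2 - y1)"
    using assms(7) by (simp add: abs_mult_self_eq)
qed (use assms in auto)

lemma odd_abs: "1 \<le> \<bar>of_int (2 * n + 1) :: real\<bar>"
proof -
  have "1 \<le> \<bar>2 * n + 1\<bar>" by presburger
  then show ?thesis by linarith
qed

lemma even_abs: "n \<noteq> 0 \<Longrightarrow> 2 \<le> \<bar>of_int (2 * n) :: real\<bar>"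
  by linarith

subsection \<open>Class I\<close>

lemma heights_step:
  assumes h: "heights \<delta> y"
  shows "y (k + 1) = y k + (if \<delta> k = 0 then sqrt 3 else 1 + r + av)" "\<delta> k = 0 \<or> \<delta> k = 1"
proof -
  show "y (k + 1) = y k + (if \<delta> k = 0 then sqrt 3 else 1 + r + av)"
    using h by (simp add: heights_def layer_height_av)
  show "\<delta> k = 0 \<or> \<delta> k = 1" using h unfolding heights_def by (metis insertE emptyE rangeI subsetD)
qed

lemma sqrt3_bounds: "1.73 < sqrt 3" "sqrt 3 < 1.74" "sqrt 3 * sqrt 3 = 3"
proof -
  have "173 / 100 < sqrt 3" by (rule real_less_rsqrt) (simp add: power2_eq_square)
  moreover have "sqrt 3 < 174 / 100" by (rule real_less_lsqrt) (simp_all add: power2_eq_square)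
  ultimately show "1.73 < sqrt 3" "sqrt 3 < 1.74" by simp_all
qed simp

lemma heights_mono:
  assumes h: "heights \<delta> y" and "k \<le> l"
  shows "y l \<ge> y k + sqrt 3 * of_int (l - k)"
  using assms(2)
proof (induction l rule: int_ge_induct)
  case (step l)
  then show ?case using heights_step[OF h, of l] sqrt3_bounds av_bounds r_bounds
    by (auto simp: algebra_simps split: if_splits)
qed simp

lemma heights_gap:
  assumes h: "heights \<delta> y" and "k < l"
  shows "y l \<ge> y k + sqrt 3" "\<delta> k = 1 \<Longrightarrow> y l \<ge> y k + 1 + r + av"
    "l \<noteq> k + 1 \<Longrightarrow> y l \<ge> y k + 2 * sqrt 3" "\<delta> k = 1 \<Longrightarrow> l \<noteq> k + 1 \<Longrightarrow> y l \<ge> y k + 1 + r + av + sqrt 3"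
proof -
  have s: "y l \<ge> y (k + 1) + sqrt 3 * of_int (l - (k + 1))" using heights_mono[OF h, of "k + 1" l] assms(2) by simp
  have n: "0 \<le> of_int (l - (k + 1)) * sqrt 3" using assms(2) sqrt3_bounds by simp
  have st: "y (k + 1) \<ge> y k + sqrt 3" "\<delta> k = 1 \<Longrightarrow> y (k + 1) = y k + 1 + r + av"
    using heights_step[OF h, of k] sqrt3_bounds av_bounds r_bounds by (auto split: if_splits)
  show "y l \<ge> y k + sqrt 3" "\<delta> k = 1 \<Longrightarrow> y l \<ge> y k + 1 + r + av" using s n st by (simp_all add: mult.commute)
  assume "l \<noteq> k + 1"
  then have "(1::real) \<le> of_int (l - (k + 1))" using assms(2) by linarith
  then have "sqrt 3 * 1 \<le> sqrt 3 * of_int (l - (k + 1))" using sqrt3_bounds by (intro mult_left_mono) auto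
  note m = this
  show "y l \<ge> y k + 2 * sqrt 3" using s st(1) m by linarith
  show "y l \<ge> y k + 1 + r + av + sqrt 3" if "\<delta> k = 1" using s st(2)[OF that] m by linarith
qed

text \<open>In adjacent rows the abscissae have opposite parity, so the offsets are at least 1 and
  \<open>sqrt 3\<close>; rows further apart are separated by height alone.\<close>

lemma apart_I_big_big:
  assumes h: "heights \<delta> y" and ne: "big (of_int (2 * j + k)) (y k) \<noteq> big (of_int (2 * j' + k')) (y k')"
  shows "apart (big (of_int (2 * j + k)) (y k)) (big (of_int (2 * j' + k')) (y k'))"
proof -
  have less: "apart (big (of_int (2 * j + k)) (y k)) (big (of_int (2 * j' + k')) (y k'))" if "k < k'" for j k j' k'
  proof (cases "k' = k + 1")
    case True
    have "1 \<le> \<bar>of_int (2 * (j' - j) + 1) :: real\<bar>" by (rule odd_abs)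
    then show ?thesis using heights_gap(1)[OF h that] sqrt3_bounds
      by (intro apart_bounds[of _ _ 1 _ _ "sqrt 3"]) (auto simp: True)
  next
    case False
    then show ?thesis using heights_gap(3)[OF h that] sqrt3_bounds
      by (intro apart_bounds[of _ _ 0 _ _ "2 * sqrt 3"]) auto
  qed
  show ?thesis
  proof (cases k k' rule: linorder_cases)
    case equal
    then have "j' - j \<noteq> 0" using ne by auto
    from even_abs[OF this] show ?thesis using equal by (intro apart_bounds[of _ _ 2 _ _ 0]) auto
  next
    case greater
    then show ?thesis using less[of k' k j' j] apart_sym by blast
  qed (rule less)
qed

lemma apart_I_big_A:
  assumes h: "heights \<delta> y" and d: "\<delta> k' = 1"
  shows "apart (big (of_int (2 * j + k)) (y k)) (small (of_int (2 * j' + k')) (y k' + 1 + r))"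
proof (cases "k' = k - 1")
  case True
  have "1 \<le> \<bar>of_int (2 * (j' - j - 1) + 1) :: real\<bar>" by (rule odd_abs)
  then show ?thesis using heights_gap(2)[OF h _ d, of k] heights_step(1)[OF h, of "k - 1"] d av_eqs av_bounds r_pos
    by (intro apart_bounds[of _ _ 1 _ _ av]) (auto simp: True algebra_simps)
next
  case False
  have "1 + r \<le> \<bar>y k' + 1 + r - y k\<bar>"
  proof (cases "k \<le> k'")
    case True
    then have "y k \<le> y k'" using heights_gap(1)[OF h, of k k'] sqrt3_bounds by (cases "k = k'") auto
    then show ?thesis using r_pos by simp
  next
    case F: False
    then have "y k \<ge> y k' + 1 + r + av + sqrt 3" using heights_gap(4)[OF h _ d, of k] False by simp
    then show ?thesis using av_bounds sqrt3_bounds r_bounds by simp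
  qed
  then show ?thesis using r_pos by (intro apart_bounds[of _ _ 0 _ _ "1 + r"]) auto
qed

lemma apart_I_big_B:
  assumes h: "heights \<delta> y" and d: "\<delta> k' = 1"
  shows "apart (big (of_int (2 * j + k)) (y k)) (small (of_int (2 * j' + k' + 1)) (y k' + av))"
proof (cases "k' = k")
  case True
  have "1 \<le> \<bar>of_int (2 * (j' - j) + 1) :: real\<bar>" by (rule odd_abs)
  then show ?thesis using av_eqs av_bounds r_pos
    by (intro apart_bounds[of _ _ 1 _ _ av]) (auto simp: True algebra_simps)
next
  case False
  have "1 + r \<le> \<bar>y k' + av - y k\<bar>"
  proof (cases "k < k'")
    case True
    then have "y k + sqrt 3 \<le> y k'" using heights_gap(1)[OF h, of k k'] by simp
    then show ?thesis using av_bounds sqrt3_bounds r_bounds by simp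
  next
    case F: False
    then have "y k \<ge> y k' + 1 + r + av" using heights_gap(2)[OF h _ d, of k] False by simp
    then show ?thesis using r_bounds by simp
  qed
  then show ?thesis using r_pos by (intro apart_bounds[of _ _ 0 _ _ "1 + r"]) auto
qed

text \<open>The offset \<open>(t, u)\<close> treats the upper and the lower small layers at
  once.\<close>

lemma apart_I_small:
  assumes h: "heights \<delta> y" and d: "\<delta> k = 1" "\<delta> k' = 1" and c: "k \<noteq> k' \<or> j \<noteq> j'"
  shows "apart (small (of_int (2 * j + k) + t) (y k + u)) (small (of_int (2 * j' + k') + t) (y k' + u))"
proof (cases "k = k'")
  case True
  then have "j' - j \<noteq> 0" using c by auto
  from even_abs[OF this] have "2 \<le> \<bar>of_int (2 * j') - of_int (2 * j) :: real\<bar>" by simp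
  moreover have "(r + r) * (r + r) \<le> 2 * 2" using r_pos r_less by (intro mult_mono) auto
  ultimately show ?thesis using r_pos True by (intro apart_bounds[of _ _ 2 _ _ 0]) auto
next
  case False
  then have "k < k' \<or> k' < k" by auto
  then have "1 + r + av \<le> \<bar>y k' - y k\<bar>"
    using heights_gap(2)[OF h, of k k'] heights_gap(2)[OF h, of k' k] d by auto
  moreover have "(r + r) * (r + r) \<le> (1 + r + av) * (1 + r + av)"
    using r_pos r_less av_bounds by (intro mult_mono) auto
  ultimately show ?thesis using r_pos av_bounds by (intro apart_bounds[of _ _ 0 _ _ "1 + r + av"]) auto
qed

lemma apart_I_A_B:
  assumes h: "heights \<delta> y" and d: "\<delta> k = 1" "\<delta> k' = 1"
  shows "apart (small (of_int (2 * j + k)) (y k + 1 + r)) (small (of_int (2 * j' + k' + 1)) (y k' + av))"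
proof (cases "k = k'")
  case True
  have "1 \<le> \<bar>of_int (2 * (j' - j) + 1) :: real\<bar>" by (rule odd_abs)
  then show ?thesis using av_eqs av_bounds r_bounds r_pos
    by (intro apart_bounds[of _ _ 1 _ _ "1 + r - av"]) (auto simp: True algebra_simps)
next
  case False
  then have "k < k' \<or> k' < k" by auto
  then have "2 * r \<le> \<bar>y k' + av - (y k + 1 + r)\<bar>"
    using heights_gap(2)[OF h, of k k'] heights_gap(2)[OF h, of k' k] d av_bounds r_bounds by auto
  then show ?thesis using r_pos by (intro apart_bounds[of _ _ 0 _ _ "2 * r"]) auto
qed

lemma pack_I_cases:
  assumes "D \<in> pack_I \<delta> y"
  obtains (big) j k where "D = big (of_int (2 * j + k)) (y k)"
    | (A) j k where "\<delta> k = 1" "D = small (of_int (2 * j + k)) (y k + 1 + r)"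
    | (B) j k where "\<delta> k = 1" "D = small (of_int (2 * j + k + 1)) (y k + av)"
  using assms unfolding pack_I_def by blast

lemma pack_I_apart:
  assumes h: "heights \<delta> y"
  shows "pairwise apart (pack_I \<delta> y)"
proof (rule pairwiseI)
  fix D E assume D: "D \<in> pack_I \<delta> y" and E: "E \<in> pack_I \<delta> y" and ne: "D \<noteq> E"
  show "apart D E"
    using D
  proof (cases rule: pack_I_cases)
    case D: (big j k)
    from E show ?thesis
    proof (cases rule: pack_I_cases)
      case (big j' k')
      then show ?thesis using apart_I_big_big[OF h] ne D by blast
    next
      case (A j' k')
      then show ?thesis using apart_I_big_A[OF h] D by blast
    next
      case (B j' k')
      then show ?thesis using apart_I_big_B[OF h] D by blast
    qed
  next
    case D: (A j k)
    from E show ?thesis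
    proof (cases rule: pack_I_cases)
      case (big j' k')
      then show ?thesis using apart_I_big_A[OF h] D apart_sym by blast
    next
      case (A j' k')
      then have "k \<noteq> k' \<or> j \<noteq> j'" using D ne by auto
      from apart_I_small[OF h D(1) A(1) this, of 0 "1 + r"] show ?thesis using D A by (simp add: add.assoc)
    next
      case (B j' k')
      then show ?thesis using apart_I_A_B[OF h] D by blast
    qed
  next
    case D: (B j k)
    from E show ?thesis
    proof (cases rule: pack_I_cases)
      case (big j' k')
      then show ?thesis using apart_I_big_B[OF h] D apart_sym by blast
    next
      case (A j' k')
      then show ?thesis using apart_I_A_B[OF h] D apart_sym by blast
    next
      case (B j' k')
      then have "k \<noteq> k' \<or> j \<noteq> j'" using D ne by auto
      from apart_I_small[OF h D(1) B(1) this, of 1 av] show ?thesis using D B by simp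
    qed
  qed
qed

lemma wreath_I_big:
  "wreath (big x y) (big (x + 2) y #
     (if d = 0 then [big (x + 1) (y + sqrt 3), big (x - 1) (y + sqrt 3)]
      else [small (x + 1) (y + av), small x (y + 1 + r), small (x - 1) (y + av)]) @ big (x - 2) y #
     (if e = 0 then [big (x - 1) (y - sqrt 3), big (x + 1) (y - sqrt 3)]
      else [small (x - 1) (y - av), small x (y - 1 - r), small (x + 1) (y - av)]))"
proof -
  have 1: "tri (big x y) (big (x + 2) y) (big (x + 1) (y + sqrt 3))"
    "tri (big x y) (big (x + 1) (y + sqrt 3)) (big (x - 1) (y + sqrt 3))"
    "tri (big x y) (big (x - 1) (y + sqrt 3)) (big (x - 2) y)"
    "tri (big x y) (big (x - 2) y) (big (x - 1) (y - sqrt 3))"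
    "tri (big x y) (big (x - 1) (y - sqrt 3)) (big (x + 1) (y - sqrt 3))"
    "tri (big x y) (big (x + 1) (y - sqrt 3)) (big (x + 2) y)"
    by (rule tri_Complex; use constants_I in \<open>simp add: power2_eq_square algebra_simps\<close>)+
  have 2: "tri (big x y) (big (x + 2) y) (small (x + 1) (y + av))"
    "tri (big x y) (small (x + 1) (y + av)) (small x (y + 1 + r))"
    "tri (big x y) (small x (y + 1 + r)) (small (x - 1) (y + av))"
    "tri (big x y) (small (x - 1) (y + av)) (big (x - 2) y)"
    "tri (big x y) (big (x - 2) y) (small (x - 1) (y - av))"
    "tri (big x y) (small (x - 1) (y - av)) (small x (y - 1 - r))"
    "tri (big x y) (small x (y - 1 - r)) (small (x + 1) (y - av))"
    "tri (big x y) (small (x + 1) (y - av)) (big (x + 2) y)"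
    by (rule tri_Complex; use constants_I in \<open>simp add: power2_eq_square algebra_simps\<close>)+
  show ?thesis using 1 2 by (simp add: wreath_def ang_values)
qed

lemma wreath_I_small:
  "wreath (small x y) [small (x + 1) (y + av - 1 - r), big (x + 1) (y + av), big (x - 1) (y + av),
     small (x - 1) (y + av - 1 - r), big x (y - 1 - r)]"
  "wreath (small x y) [small (x - 1) (y - av + 1 + r), big (x - 1) (y - av), big (x + 1) (y - av),
     small (x + 1) (y - av + 1 + r), big x (y + 1 + r)]"
proof -
  have 1: "tri (small x y) (small (x + 1) (y + av - 1 - r)) (big (x + 1) (y + av))"
    "tri (small x y) (big (x + 1) (y + av)) (big (x - 1) (y + av))"
    "tri (small x y) (big (x - 1) (y + av)) (small (x - 1) (y + av - 1 - r))"
    "tri (small x y) (small (x - 1) (y + av - 1 - r)) (big x (y - 1 - r))"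
    "tri (small x y) (big x (y - 1 - r)) (small (x + 1) (y + av - 1 - r))"
    by (rule tri_Complex; use constants_I in \<open>simp add: power2_eq_square algebra_simps\<close>)+
  have 2: "tri (small x y) (small (x - 1) (y - av + 1 + r)) (big (x - 1) (y - av))"
    "tri (small x y) (big (x - 1) (y - av)) (big (x + 1) (y - av))"
    "tri (small x y) (big (x + 1) (y - av)) (small (x + 1) (y - av + 1 + r))"
    "tri (small x y) (small (x + 1) (y - av + 1 + r)) (big x (y + 1 + r))"
    "tri (small x y) (big x (y + 1 + r)) (small (x - 1) (y - av + 1 + r))"
    by (rule tri_Complex; use constants_I in \<open>simp add: power2_eq_square algebra_simps\<close>)+
  show "wreath (small x y) [small (x + 1) (y + av - 1 - r), big (x + 1) (y + av), big (x - 1) (y + av),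
     small (x - 1) (y + av - 1 - r), big x (y - 1 - r)]"
    using 1 by (simp add: wreath_def ang_values)
  show "wreath (small x y) [small (x - 1) (y - av + 1 + r), big (x - 1) (y - av), big (x + 1) (y - av),
     small (x + 1) (y - av + 1 + r), big x (y + 1 + r)]"
    using 2 by (simp add: wreath_def ang_values)
qed

lemma pack_I_mem:
  shows "x = of_int (2 * j + k) \<Longrightarrow> z = y k \<Longrightarrow> big x z \<in> pack_I \<delta> y"
    "\<delta> k = 1 \<Longrightarrow> x = of_int (2 * j + k) \<Longrightarrow> z = y k + 1 + r \<Longrightarrow> small x z \<in> pack_I \<delta> y"
    "\<delta> k = 1 \<Longrightarrow> x = of_int (2 * j + k + 1) \<Longrightarrow> z = y k + av \<Longrightarrow> small x z \<in> pack_I \<delta> y"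
  unfolding pack_I_def by blast+

lemma pack_I_wreath:
  assumes h: "heights \<delta> y" and D: "D \<in> pack_I \<delta> y"
  shows "\<exists>Fs. wreath D Fs \<and> set Fs \<subseteq> pack_I \<delta> y"
  using D
proof (cases rule: pack_I_cases)
  case (big j k)
  define x where "x = (of_int (2 * j + k) :: real)"
  have b: "big (x + 2) (y k) \<in> pack_I \<delta> y" "big (x - 2) (y k) \<in> pack_I \<delta> y"
    using pack_I_mem(1)[of "x + 2" "j + 1" k] pack_I_mem(1)[of "x - 2" "j - 1" k] by (simp_all add: x_def)
  have up0: "big (x + 1) (y k + sqrt 3) \<in> pack_I \<delta> y \<and> big (x - 1) (y k + sqrt 3) \<in> pack_I \<delta> y" if "\<delta> k = 0"
    using pack_I_mem(1)[of "x + 1" j "k + 1" "y k + sqrt 3" y] pack_I_mem(1)[of "x - 1" "j - 1" "k + 1" "y k + sqrt 3" y]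
      heights_step(1)[OF h, of k] that
    by (simp add: x_def)
  have dn0: "big (x - 1) (y k - sqrt 3) \<in> pack_I \<delta> y \<and> big (x + 1) (y k - sqrt 3) \<in> pack_I \<delta> y" if "\<delta> (k - 1) = 0"
    using pack_I_mem(1)[of "x - 1" j "k - 1" "y k - sqrt 3" y] pack_I_mem(1)[of "x + 1" "j + 1" "k - 1" "y k - sqrt 3" y]
      heights_step(1)[OF h, of "k - 1"] that
    by (simp add: x_def)
  have up1: "small (x + 1) (y k + av) \<in> pack_I \<delta> y \<and> small x (y k + 1 + r) \<in> pack_I \<delta> y \<and> small (x - 1) (y k + av) \<in> pack_I \<delta> y"
    if "\<delta> k = 1"
    using pack_I_mem(3)[of \<delta> k "x + 1" j "y k + av" y] pack_I_mem(3)[of \<delta> k "x - 1" "j - 1" "y k + av" y]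
      pack_I_mem(2)[of \<delta> k x j "y k + 1 + r" y] that
    by (simp add: x_def)
  have dn1: "small (x - 1) (y k - av) \<in> pack_I \<delta> y \<and> small x (y k - 1 - r) \<in> pack_I \<delta> y \<and> small (x + 1) (y k - av) \<in> pack_I \<delta> y"
    if "\<delta> (k - 1) = 1"
    using pack_I_mem(2)[of \<delta> "k - 1" "x - 1" j "y k - av" y] pack_I_mem(2)[of \<delta> "k - 1" "x + 1" "j + 1" "y k - av" y]
      pack_I_mem(3)[of \<delta> "k - 1" x j "y k - 1 - r" y] heights_step(1)[OF h, of "k - 1"] that
    by (simp add: x_def add.assoc)
  show ?thesis
  proof (intro exI conjI)
    show "wreath D (big (x + 2) (y k) #
     (if \<delta> k = 0 then [big (x + 1) (y k + sqrt 3), big (x - 1) (y k + sqrt 3)]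
      else [small (x + 1) (y k + av), small x (y k + 1 + r), small (x - 1) (y k + av)]) @ big (x - 2) (y k) #
     (if \<delta> (k - 1) = 0 then [big (x - 1) (y k - sqrt 3), big (x + 1) (y k - sqrt 3)]
      else [small (x - 1) (y k - av), small x (y k - 1 - r), small (x + 1) (y k - av)]))"
      unfolding big x_def[symmetric] by (rule wreath_I_big)
    show "set (big (x + 2) (y k) #
     (if \<delta> k = 0 then [big (x + 1) (y k + sqrt 3), big (x - 1) (y k + sqrt 3)]
      else [small (x + 1) (y k + av), small x (y k + 1 + r), small (x - 1) (y k + av)]) @ big (x - 2) (y k) #
     (if \<delta> (k - 1) = 0 then [big (x - 1) (y k - sqrt 3), big (x + 1) (y k - sqrt 3)]
      else [small (x - 1) (y k - av), small x (y k - 1 - r), small (x + 1) (y k - av)])) \<subseteq> pack_I \<delta> y"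
      using b up0 up1 dn0 dn1 heights_step(2)[OF h, of k] heights_step(2)[OF h, of "k - 1"] by auto
  qed
next
  case (A j k)
  define x z where "x = (of_int (2 * j + k) :: real)" and "z = y k + 1 + r"
  have "small (x + 1) (z + av - 1 - r) \<in> pack_I \<delta> y" "big (x + 1) (z + av) \<in> pack_I \<delta> y" "big (x - 1) (z + av) \<in> pack_I \<delta> y"
     "small (x - 1) (z + av - 1 - r) \<in> pack_I \<delta> y" "big x (z - 1 - r) \<in> pack_I \<delta> y"
    using pack_I_mem(3)[of \<delta> k "x + 1" j "z + av - 1 - r" y] pack_I_mem(1)[of "x + 1" j "k + 1" "z + av" y]
      pack_I_mem(1)[of "x - 1" "j - 1" "k + 1" "z + av" y] pack_I_mem(3)[of \<delta> k "x - 1" "j - 1" "z + av - 1 - r" y]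
      pack_I_mem(1)[of x j k "z - 1 - r" y] A heights_step(1)[OF h, of k]
    by (simp_all add: x_def z_def)
  then show ?thesis using wreath_I_small(1)[of x z] unfolding A(2) x_def[symmetric] z_def[symmetric]
    by (intro exI conjI) (assumption, simp)
next
  case (B j k)
  define x z where "x = (of_int (2 * j + k + 1) :: real)" and "z = y k + av"
  have "small (x - 1) (z - av + 1 + r) \<in> pack_I \<delta> y" "big (x - 1) (z - av) \<in> pack_I \<delta> y" "big (x + 1) (z - av) \<in> pack_I \<delta> y"
     "small (x + 1) (z - av + 1 + r) \<in> pack_I \<delta> y" "big x (z + 1 + r) \<in> pack_I \<delta> y"
    using pack_I_mem(2)[of \<delta> k "x - 1" j "z - av + 1 + r" y] pack_I_mem(1)[of "x - 1" j k "z - av" y]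
      pack_I_mem(1)[of "x + 1" "j + 1" k "z - av" y] pack_I_mem(2)[of \<delta> k "x + 1" "j + 1" "z - av + 1 + r" y]
      pack_I_mem(1)[of x j "k + 1" "z + 1 + r" y] B heights_step(1)[OF h, of k]
    by (simp_all add: x_def z_def)
  then show ?thesis using wreath_I_small(2)[of x z] unfolding B(2) x_def[symmetric] z_def[symmetric]
    by (intro exI conjI) (assumption, simp)
qed

lemma pack_I_radius:
  "D \<in> pack_I \<delta> y \<Longrightarrow> radius D \<in> {1, r}"
  "\<delta> k = 1 \<Longrightarrow> radius ` pack_I \<delta> y = {1, r}"
proof -
  show 1: "D \<in> pack_I \<delta> y \<Longrightarrow> radius D \<in> {1, r}" for D by (erule pack_I_cases) auto
  assume "\<delta> k = 1"
  then have "big (of_int (2 * 0 + k)) (y k) \<in> pack_I \<delta> y" "small (of_int (2 * 0 + k)) (y k + 1 + r) \<in> pack_I \<delta> y"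
    unfolding pack_I_def by blast+
  then have "1 \<in> radius ` pack_I \<delta> y" "r \<in> radius ` pack_I \<delta> y" by force+
  then show "radius ` pack_I \<delta> y = {1, r}" using 1 by blast
qed

lemma class_I_compact:
  assumes "Q \<in> class_I r" shows "compact_packing_using r Q"
proof -
  obtain \<delta> y k where h: "heights \<delta> y" "\<delta> k \<noteq> 0" "Q = pack_I \<delta> y" using assms unfolding class_I_iff by blast
  then have "\<delta> k = 1" using heights_step(2)[OF h(1), of k] by simp
  then show ?thesis unfolding h(3)
    by (rule compact_packing_usingI[OF pack_I_radius(2) pack_I_apart[OF h(1)] pack_I_wreath[OF h(1)]])
qed

subsection \<open>Class II\<close>

lemma shifts_step: "shifts \<epsilon> x \<Longrightarrow> x (k + 1) = x k + sv \<or> x (k + 1) = x k - sv"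
proof -
  assume h: "shifts \<epsilon> x"
  then have "\<epsilon> k \<in> {1, -1}" unfolding shifts_def by blast
  moreover have "x (k + 1) = x k + \<epsilon> k * sv" using h by (simp add: shifts_def)
  ultimately show ?thesis by auto
qed

lemma shift_even: "sv \<le> \<bar>sv + 2 * qv * of_int n\<bar>" "sv \<le> \<bar>- sv + 2 * qv * of_int n\<bar>"
proof -
  have "n = 0 \<or> 1 \<le> \<bar>n\<bar>" by auto
  then have "sv \<le> \<bar>sv + 2 * qv * of_int n\<bar> \<and> sv \<le> \<bar>- sv + 2 * qv * of_int n\<bar>"
  proof
    assume "1 \<le> \<bar>n\<bar>"
    then have "1 \<le> \<bar>of_int n :: real\<bar>" by linarith
    then have "2 * qv * 1 \<le> 2 * qv * \<bar>of_int n\<bar>" using qv_bounds by (intro mult_left_mono) auto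
    then have "2 * qv \<le> \<bar>2 * qv * of_int n\<bar>" using qv_bounds by (simp add: abs_mult)
    moreover have "sv \<le> qv" "0 < sv" using qv_bounds by simp_all
    ultimately show ?thesis by (intro conjI; linarith)
  qed (use qv_bounds in simp)
  then show "sv \<le> \<bar>sv + 2 * qv * of_int n\<bar>" "sv \<le> \<bar>- sv + 2 * qv * of_int n\<bar>" by blast+
qed

lemma shift_odd: "qv \<le> \<bar>qv * of_int (2 * n + 1)\<bar>"
  "qv - sv \<le> \<bar>sv + qv * of_int (2 * n + 1)\<bar>" "qv - sv \<le> \<bar>- sv + qv * of_int (2 * n + 1)\<bar>"
proof -
  have "qv * 1 \<le> qv * \<bar>of_int (2 * n + 1)\<bar>" using odd_abs[of n] qv_bounds by (intro mult_left_mono) auto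
  then have "qv \<le> \<bar>qv * of_int (2 * n + 1)\<bar>" using qv_bounds by (simp add: abs_mult)
  moreover have "0 < sv" using qv_bounds by simp
  ultimately show "qv \<le> \<bar>qv * of_int (2 * n + 1)\<bar>"
    "qv - sv \<le> \<bar>sv + qv * of_int (2 * n + 1)\<bar>" "qv - sv \<le> \<bar>- sv + qv * of_int (2 * n + 1)\<bar>"
    using \<open>0 < sv\<close> by linarith+
qed

text \<open>The index \<open>t\<close> is 0 for large discs and 1 or -1 for the upper and lower disc
  of a small pair, so separation is a case split on two such indices.\<close>

definition layer_disc :: "(int \<Rightarrow> real) \<Rightarrow> int \<Rightarrow> int \<Rightarrow> int \<Rightarrow> disc" where
  "layer_disc x t j k = (if t = 0 then big (x k + of_int j * (2 * qv)) (of_int k * hv)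
     else small (x k + (of_int j + 1 / 2) * (2 * qv)) (of_int k * hv + of_int t * r))"

lemma layer_disc_simps:
  "layer_disc x 0 j k = big (x k + of_int j * (2 * qv)) (of_int k * hv)"
  "t \<noteq> 0 \<Longrightarrow> layer_disc x t j k = small (x k + (of_int j + 1 / 2) * (2 * qv)) (of_int k * hv + of_int t * r)"
  by (simp_all add: layer_disc_def)

lemma pack_II_layer: "pack_II x = {layer_disc x t j k | t j k. t \<in> {0, 1, -1}}"
proof -
  have "{layer_disc x t j k | t j k. t \<in> {0, 1, -1}} = {layer_disc x 0 j k | j k. True} \<union>
    {layer_disc x 1 j k | j k. True} \<union> {layer_disc x (-1) j k | j k. True}" by blast
  then show ?thesis unfolding pack_II_def layer_disc_def by simp
qed

lemma apart_II_same:
  assumes t: "t \<in> {0, 1, -1}" "u \<in> {0, 1, -1}" and ne: "(t, j) \<noteq> (u, i)"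
  shows "apart (layer_disc x t j k) (layer_disc x u i k)"
proof -
  have even: "2 * qv \<le> \<bar>of_int n * (2 * qv)\<bar>" if "n \<noteq> 0" for n :: int
  proof -
    have "1 \<le> \<bar>of_int n :: real\<bar>" using that by linarith
    then have "1 * (2 * qv) \<le> \<bar>of_int n\<bar> * (2 * qv)" using qv_bounds by (intro mult_right_mono) auto
    then show ?thesis using qv_bounds by (simp add: abs_mult)
  qed
  have qq: "(r + r) * (r + r) \<le> 2 * 2" "2 * 2 \<le> (2 * qv) * (2 * qv)"
    using qv_bounds r_bounds by (intro mult_mono; simp)+
  consider "t = 0" "u = 0" | "t \<noteq> 0" "u = t" | "t = 0" "u \<noteq> 0" | "t \<noteq> 0" "u = 0" | "t \<noteq> 0" "u \<noteq> 0" "t \<noteq> u"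
    by blast
  then show ?thesis
  proof cases
    case 1
    then have "i - j \<noteq> 0" using ne by auto
    from even[OF this] have "2 * qv \<le> \<bar>of_int i * (2 * qv) - of_int j * (2 * qv)\<bar>" by (simp add: algebra_simps)
    then show ?thesis unfolding 1 layer_disc_simps
      by (intro apart_bounds[of _ _ "2 * qv" _ _ 0]) (use qq qv_bounds in simp_all)
  next
    case 2
    then have "i - j \<noteq> 0" using ne by auto
    from even[OF this] have "2 * qv \<le> \<bar>of_int i * (2 * qv) - of_int j * (2 * qv)\<bar>" by (simp add: algebra_simps)
    moreover have "(of_int i + 1 / 2) * (2 * qv) - (of_int j + 1 / 2) * (2 * qv) = of_int i * (2 * qv) - of_int j * (2 * qv)"
      by (simp add: algebra_simps)
    ultimately show ?thesis unfolding 2(2) layer_disc_simps(2)[OF 2(1)]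
      by (intro apart_bounds[of _ _ "2 * qv" _ _ 0]) (use qq r_pos qv_bounds in simp_all)
  next
    case 3
    have a: "qv \<le> \<bar>(of_int i + 1 / 2) * (2 * qv) - of_int j * (2 * qv)\<bar>"
      using shift_odd(1)[of "i - j"] by (simp add: algebra_simps)
    have b: "\<bar>of_int u * r\<bar> = r" using 3 t(2) r_pos by auto
    show ?thesis unfolding 3(1) layer_disc_simps(1) layer_disc_simps(2)[OF 3(2)]
      by (rule apart_bounds[of _ _ qv _ _ r]) (use a b r_pos qv_bounds qv_eqs(1) in \<open>simp_all add: algebra_simps\<close>)
  next
    case 4
    have a: "qv \<le> \<bar>of_int i * (2 * qv) - (of_int j + 1 / 2) * (2 * qv)\<bar>"
      using shift_odd(1)[of "i - j - 1"] by (simp add: algebra_simps)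
    have b: "\<bar>of_int t * r\<bar> = r" using 4 t(1) r_pos by auto
    show ?thesis unfolding 4(2) layer_disc_simps(1) layer_disc_simps(2)[OF 4(1)]
      by (rule apart_bounds[of _ _ qv _ _ r]) (use a b r_pos qv_bounds qv_eqs(1) in \<open>simp_all add: algebra_simps\<close>)
  next
    case 5
    have "t = 1 \<and> u = -1 \<or> t = -1 \<and> u = 1" using 5 t by auto
    then have b: "\<bar>of_int u * r - of_int t * r\<bar> = 2 * r" using r_pos by auto
    show ?thesis unfolding layer_disc_simps(2)[OF 5(1)] layer_disc_simps(2)[OF 5(2)]
      by (rule apart_bounds[of _ _ 0 _ _ "2 * r"]) (use b r_pos in simp_all)
  qed
qed

lemma apart_II_next:
  assumes h: "shifts \<epsilon> x" and t: "t \<in> {0, 1, -1}" "u \<in> {0, 1, -1}"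
  shows "apart (layer_disc x t j k) (layer_disc x u i (k + 1))"
proof -
  obtain e where e: "x (k + 1) = x k + e" "e = sv \<or> e = - sv" using shifts_step[OF h, of k] by auto
  have even: "sv \<le> \<bar>e + of_int i * (2 * qv) - of_int j * (2 * qv)\<bar>"
    using shift_even[of "i - j"] e(2) by (auto simp: algebra_simps)
  have odd1: "qv - sv \<le> \<bar>e + (of_int i + 1 / 2) * (2 * qv) - of_int j * (2 * qv)\<bar>"
    using shift_odd(2,3)[of "i - j"] e(2) by (auto simp: algebra_simps)
  have odd2: "qv - sv \<le> \<bar>e + of_int i * (2 * qv) - (of_int j + 1 / 2) * (2 * qv)\<bar>"
    using shift_odd(2,3)[of "i - j - 1"] e(2) by (auto simp: algebra_simps)
  have y: "of_int (k + 1) * hv = of_int k * hv + hv" by (simp add: algebra_simps)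
  \<comment> \<open>All three are in fact equalities: they are the tangencies between consecutive
    layers.\<close>
  have sq: "(1 + 1) * (1 + 1) \<le> sv * sv + hv * hv" "(1 + r) * (1 + r) \<le> (qv - sv) * (qv - sv) + (hv - r) * (hv - r)"
    "(r + r) * (r + r) \<le> sv * sv + (hv - 2 * r) * (hv - 2 * r)"
    using qv_eqs by (simp_all add: algebra_simps)
  have b: "0 < hv - 2 * r" "1 + r \<le> hv + r" "2 * r \<le> hv" using qv_bounds r_bounds by simp_all
  have far: "apart (Complex x1 y1, p1) (Complex x2 y2, p2)" if "p1 > 0" "p2 > 0" "p1 + p2 \<le> y2 - y1" for x1 y1 p1 x2 y2 p2
    using that by (intro apart_bounds[of _ _ 0 _ _ "p1 + p2"]) auto
  consider "t = 0" "u = 0" | "t = 0" "u = 1" | "t = 0" "u = -1" | "t = 1" "u = 0" | "t = -1" "u = 0"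
    | "t = 1" "u = -1" | "t \<noteq> 0" "u \<noteq> 0" "t \<le> u" using t by fastforce
  then show ?thesis
  proof cases
    case 1
    show ?thesis unfolding 1 layer_disc_simps e y
      by (rule apart_bounds[of _ _ sv _ _ hv]) (use even sq(1) qv_bounds in \<open>simp_all add: algebra_simps\<close>)
  next
    case 2
    show ?thesis unfolding 2 layer_disc_simps(1) layer_disc_simps(2)[OF one_neq_zero] e y
      by (rule far) (use b r_pos in simp_all)
  next
    case 3
    then have u: "u \<noteq> 0" by simp
    show ?thesis unfolding 3(1) layer_disc_simps(1) layer_disc_simps(2)[OF u] e y
      by (rule apart_bounds[of _ _ "qv - sv" _ _ "hv - r"])
        (use 3(2) odd1 sq(2) qv_bounds r_bounds r_pos in \<open>simp_all add: algebra_simps\<close>)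
  next
    case 4
    then have t: "t \<noteq> 0" by simp
    show ?thesis unfolding 4(2) layer_disc_simps(1) layer_disc_simps(2)[OF t] e y
      by (rule apart_bounds[of _ _ "qv - sv" _ _ "hv - r"])
        (use 4(1) odd2 sq(2) qv_bounds r_bounds r_pos in \<open>simp_all add: algebra_simps\<close>)
  next
    case 5
    then have t: "t \<noteq> 0" by simp
    show ?thesis unfolding 5(2) layer_disc_simps(1) layer_disc_simps(2)[OF t] e y
      by (rule far) (use 5(1) b r_pos in simp_all)
  next
    case 6
    then have tu: "t \<noteq> 0" "u \<noteq> 0" by simp_all
    show ?thesis unfolding layer_disc_simps(2)[OF tu(1)] layer_disc_simps(2)[OF tu(2)] e y
      by (rule apart_bounds[of _ _ sv _ _ "hv - 2 * r"])
        (use 6 even sq(3) b qv_bounds r_pos in \<open>simp_all add: algebra_simps\<close>)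
  next
    case 7
    have "0 \<le> of_int (u - t) * r" using 7 r_pos by simp
    then have "r + r \<le> of_int k * hv + hv + of_int u * r - (of_int k * hv + of_int t * r)"
      using b by (simp add: algebra_simps)
    then show ?thesis unfolding layer_disc_simps(2)[OF 7(1)] layer_disc_simps(2)[OF 7(2)] e y
      by (intro far) (use r_pos in simp_all)
  qed
qed

lemma apart_II_far:
  assumes t: "t \<in> {0, 1, -1}" "u \<in> {0, 1, -1}" and k: "k + 2 \<le> l"
  shows "apart (layer_disc x t j k) (layer_disc x u i l)"
proof -
  have y: "2 * hv \<le> of_int l * hv - of_int k * hv"
  proof -
    have "2 * hv \<le> of_int (l - k) * hv" using k qv_bounds by (intro mult_right_mono) linarith+
    then show ?thesis by (simp add: algebra_simps)
  qed
  have tu: "- r \<le> of_int t * r" "of_int t * r \<le> r" "- r \<le> of_int u * r" "of_int u * r \<le> r" using t r_pos by auto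
  have far: "apart (Complex x1 y1, p1) (Complex x2 y2, p2)" if "p1 > 0" "p2 > 0" "p1 + p2 \<le> y2 - y1" for x1 y1 p1 x2 y2 p2
    using that by (intro apart_bounds[of _ _ 0 _ _ "p1 + p2"]) auto
  have s: "2 \<le> of_int l * hv + of_int u * r - (of_int k * hv + of_int t * r)"
  proof -
    have "1 \<le> hv - r" using qv_bounds r_bounds by simp
    then show ?thesis using y tu by linarith
  qed
  have "\<exists>x1 p1. layer_disc x t j k = (Complex x1 (of_int k * hv + of_int t * r), p1) \<and> 0 < p1 \<and> p1 \<le> 1" for t j k
    using r_pos r_less by (auto simp: layer_disc_def)
  then obtain x1 p1 x2 p2 where D: "layer_disc x t j k = (Complex x1 (of_int k * hv + of_int t * r), p1)" "0 < p1" "p1 \<le> 1"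
    and E: "layer_disc x u i l = (Complex x2 (of_int l * hv + of_int u * r), p2)" "0 < p2" "p2 \<le> 1" by metis
  show ?thesis unfolding D(1) E(1) by (rule far) (use D E s in simp_all)
qed

lemma pack_II_apart:
  assumes h: "shifts \<epsilon> x"
  shows "pairwise apart (pack_II x)"
proof (rule pairwiseI)
  fix D E assume "D \<in> pack_II x" "E \<in> pack_II x" and ne: "D \<noteq> E"
  then obtain t j k u i l where D: "D = layer_disc x t j k" "t \<in> {0, 1, -1}" and E: "E = layer_disc x u i l" "u \<in> {0, 1, -1}"
    unfolding pack_II_layer by blast
  consider "k = l" | "l = k + 1" | "k = l + 1" | "k + 2 \<le> l" | "l + 2 \<le> k" by linarith
  then show "apart D E"
  proof cases
    case 1
    then have "(t, j) \<noteq> (u, i)" using ne D E by auto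
    then show ?thesis unfolding D E 1 by (rule apart_II_same[OF D(2) E(2)])
  next
    case 2
    then show ?thesis unfolding D E using apart_II_next[OF h D(2) E(2)] by blast
  next
    case 3
    then show ?thesis unfolding D E using apart_II_next[OF h E(2) D(2), of i l j] apart_sym by blast
  next
    case 4
    then show ?thesis unfolding D E using apart_II_far[OF D(2) E(2)] by blast
  next
    case 5
    then show ?thesis unfolding D E using apart_II_far[OF E(2) D(2), of l k x i j] apart_sym by blast
  qed
qed

text \<open>The flags \<open>up\<close> and \<open>dn\<close> tell whether the row above and the row
  below are shifted by \<open>+sv\<close>; the two choices are independent.\<close>

lemma wreath_II_big:
  "wreath (big x y) (small (x + qv) (y + r) #
     (if up then [big (x + sv) (y + hv), small (x + sv - qv) (y + hv - r)]
      else [small (x - sv + qv) (y + hv - r), big (x - sv) (y + hv)]) @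
     small (x - qv) (y + r) # small (x - qv) (y - r) #
     (if dn then [small (x + sv - qv) (y - hv + r), big (x + sv) (y - hv)]
      else [big (x - sv) (y - hv), small (x - sv + qv) (y - hv + r)]) @ [small (x + qv) (y - r)])"
proof -
  note t = tri_II[of x y] tri_II_x[of x y] tri_II_y[of x y] tri_II_xy[of x y]
  show ?thesis using t by (simp add: wreath_def ang_values)
qed

lemma wreath_II_small:
  "wreath (small x y) (big (x - qv) (y - r) # small x (y - 2 * r) # big (x + qv) (y - r) #
     (if up then [small (x + sv) (y + hv - 2 * r), big (x - qv + sv) (y + hv - r)]
      else [big (x + qv - sv) (y + hv - r), small (x - sv) (y + hv - 2 * r)]))" (is ?A)
  "wreath (small x y) (big (x + qv) (y + r) # small x (y + 2 * r) # big (x - qv) (y + r) #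
     (if dn then [big (x - qv + sv) (y - hv + r), small (x + sv) (y - hv + 2 * r)]
      else [small (x - sv) (y - hv + 2 * r), big (x + qv - sv) (y - hv + r)]))" (is ?B)
proof -
  have 1: "tri (small x y) (big (x - qv) (y - r)) (small x (y - 2 * r))"
    "tri (small x y) (small x (y - 2 * r)) (big (x + qv) (y - r))"
    "tri (small x y) (big (x + qv) (y - r)) (small (x + sv) (y + hv - 2 * r))"
    "tri (small x y) (small (x + sv) (y + hv - 2 * r)) (big (x - qv + sv) (y + hv - r))"
    "tri (small x y) (big (x - qv + sv) (y + hv - r)) (big (x - qv) (y - r))"
    "tri (small x y) (big (x + qv) (y - r)) (big (x + qv - sv) (y + hv - r))"
    "tri (small x y) (big (x + qv - sv) (y + hv - r)) (small (x - sv) (y + hv - 2 * r))"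
    "tri (small x y) (small (x - sv) (y + hv - 2 * r)) (big (x - qv) (y - r))"
    by (rule tri_Complex; use constants_II in \<open>simp add: power2_eq_square algebra_simps\<close>)+
  have 2: "tri (small x y) (big (x + qv) (y + r)) (small x (y + 2 * r))"
    "tri (small x y) (small x (y + 2 * r)) (big (x - qv) (y + r))"
    "tri (small x y) (big (x - qv) (y + r)) (big (x - qv + sv) (y - hv + r))"
    "tri (small x y) (big (x - qv + sv) (y - hv + r)) (small (x + sv) (y - hv + 2 * r))"
    "tri (small x y) (small (x + sv) (y - hv + 2 * r)) (big (x + qv) (y + r))"
    "tri (small x y) (big (x - qv) (y + r)) (small (x - sv) (y - hv + 2 * r))"
    "tri (small x y) (small (x - sv) (y - hv + 2 * r)) (big (x + qv - sv) (y - hv + r))"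
    "tri (small x y) (big (x + qv - sv) (y - hv + r)) (big (x + qv) (y + r))"
    by (rule tri_Complex; use constants_II in \<open>simp add: power2_eq_square algebra_simps\<close>)+
  show ?A using 1 by (simp add: wreath_def ang_values)
  show ?B using 2 by (simp add: wreath_def ang_values)
qed

lemma pack_II_mem:
  shows "u = x k + of_int j * (2 * qv) \<Longrightarrow> z = of_int k * hv \<Longrightarrow> big u z \<in> pack_II x"
    "u = x k + (of_int j + 1 / 2) * (2 * qv) \<Longrightarrow> z = of_int k * hv + r \<Longrightarrow> small u z \<in> pack_II x"
    "u = x k + (of_int j + 1 / 2) * (2 * qv) \<Longrightarrow> z = of_int k * hv - r \<Longrightarrow> small u z \<in> pack_II x"
  unfolding pack_II_def by blast+

lemma pack_II_near:
  assumes h: "shifts \<epsilon> x" and u: "u = x k + of_int j * (2 * qv)" and z: "z = of_int k * hv"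
  shows "big u z \<in> pack_II x" "big (u + 2 * qv) z \<in> pack_II x"
    "small (u + qv) (z + r) \<in> pack_II x" "small (u + qv) (z - r) \<in> pack_II x"
    "small (u - qv) (z + r) \<in> pack_II x" "small (u - qv) (z - r) \<in> pack_II x"
    "x (k + 1) = x k + sv \<Longrightarrow> big (u + sv) (z + hv) \<in> pack_II x \<and> small (u + sv - qv) (z + hv - r) \<in> pack_II x \<and>
       small (u + sv + qv) (z + hv - r) \<in> pack_II x"
    "x (k + 1) = x k - sv \<Longrightarrow> big (u - sv) (z + hv) \<in> pack_II x \<and> small (u - sv + qv) (z + hv - r) \<in> pack_II x \<and>
       big (u - sv + 2 * qv) (z + hv) \<in> pack_II x"
    "x (k - 1) = x k + sv \<Longrightarrow> big (u + sv) (z - hv) \<in> pack_II x \<and> small (u + sv - qv) (z - hv + r) \<in> pack_II x \<and>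
       small (u + sv + qv) (z - hv + r) \<in> pack_II x"
    "x (k - 1) = x k - sv \<Longrightarrow> big (u - sv) (z - hv) \<in> pack_II x \<and> small (u - sv + qv) (z - hv + r) \<in> pack_II x \<and>
       big (u - sv + 2 * qv) (z - hv) \<in> pack_II x"
proof -
  show "big u z \<in> pack_II x"
    by (rule pack_II_mem(1)[of _ x "k" "j"]) (simp_all add: u z algebra_simps)
  show "big (u + 2 * qv) z \<in> pack_II x"
    by (rule pack_II_mem(1)[of _ x "k" "j + 1"]) (simp_all add: u z algebra_simps)
  show "small (u + qv) (z + r) \<in> pack_II x"
    by (rule pack_II_mem(2)[of _ x "k" "j"]) (simp_all add: u z algebra_simps)
  show "small (u + qv) (z - r) \<in> pack_II x"
    by (rule pack_II_mem(3)[of _ x "k" "j"]) (simp_all add: u z algebra_simps)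
  show "small (u - qv) (z + r) \<in> pack_II x"
    by (rule pack_II_mem(2)[of _ x "k" "j - 1"]) (simp_all add: u z algebra_simps)
  show "small (u - qv) (z - r) \<in> pack_II x"
    by (rule pack_II_mem(3)[of _ x "k" "j - 1"]) (simp_all add: u z algebra_simps)
  show "big (u + sv) (z + hv) \<in> pack_II x \<and>
       small (u + sv - qv) (z + hv - r) \<in> pack_II x \<and>
       small (u + sv + qv) (z + hv - r) \<in> pack_II x" if e: "x (k + 1) = x k + sv"
  proof (intro conjI)
    show "big (u + sv) (z + hv) \<in> pack_II x"
      by (rule pack_II_mem(1)[of _ x "k + 1" "j"]) (unfold e u z, simp_all add: algebra_simps)
    show "small (u + sv - qv) (z + hv - r) \<in> pack_II x"
      by (rule pack_II_mem(3)[of _ x "k + 1" "j - 1"]) (unfold e u z, simp_all add: algebra_simps)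
    show "small (u + sv + qv) (z + hv - r) \<in> pack_II x"
      by (rule pack_II_mem(3)[of _ x "k + 1" "j"]) (unfold e u z, simp_all add: algebra_simps)
  qed
  show "big (u - sv) (z + hv) \<in> pack_II x \<and>
       small (u - sv + qv) (z + hv - r) \<in> pack_II x \<and>
       big (u - sv + 2 * qv) (z + hv) \<in> pack_II x" if e: "x (k + 1) = x k - sv"
  proof (intro conjI)
    show "big (u - sv) (z + hv) \<in> pack_II x"
      by (rule pack_II_mem(1)[of _ x "k + 1" "j"]) (unfold e u z, simp_all add: algebra_simps)
    show "small (u - sv + qv) (z + hv - r) \<in> pack_II x"
      by (rule pack_II_mem(3)[of _ x "k + 1" "j"]) (unfold e u z, simp_all add: algebra_simps)
    show "big (u - sv + 2 * qv) (z + hv) \<in> pack_II x"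
      by (rule pack_II_mem(1)[of _ x "k + 1" "j + 1"]) (unfold e u z, simp_all add: algebra_simps)
  qed
  show "big (u + sv) (z - hv) \<in> pack_II x \<and>
       small (u + sv - qv) (z - hv + r) \<in> pack_II x \<and>
       small (u + sv + qv) (z - hv + r) \<in> pack_II x" if e: "x (k - 1) = x k + sv"
  proof (intro conjI)
    show "big (u + sv) (z - hv) \<in> pack_II x"
      by (rule pack_II_mem(1)[of _ x "k - 1" "j"]) (unfold e u z, simp_all add: algebra_simps)
    show "small (u + sv - qv) (z - hv + r) \<in> pack_II x"
      by (rule pack_II_mem(2)[of _ x "k - 1" "j - 1"]) (unfold e u z, simp_all add: algebra_simps)
    show "small (u + sv + qv) (z - hv + r) \<in> pack_II x"
      by (rule pack_II_mem(2)[of _ x "k - 1" "j"]) (unfold e u z, simp_all add: algebra_simps)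
  qed
  show "big (u - sv) (z - hv) \<in> pack_II x \<and>
       small (u - sv + qv) (z - hv + r) \<in> pack_II x \<and>
       big (u - sv + 2 * qv) (z - hv) \<in> pack_II x" if e: "x (k - 1) = x k - sv"
  proof (intro conjI)
    show "big (u - sv) (z - hv) \<in> pack_II x"
      by (rule pack_II_mem(1)[of _ x "k - 1" "j"]) (unfold e u z, simp_all add: algebra_simps)
    show "small (u - sv + qv) (z - hv + r) \<in> pack_II x"
      by (rule pack_II_mem(2)[of _ x "k - 1" "j"]) (unfold e u z, simp_all add: algebra_simps)
    show "big (u - sv + 2 * qv) (z - hv) \<in> pack_II x"
      by (rule pack_II_mem(1)[of _ x "k - 1" "j + 1"]) (unfold e u z, simp_all add: algebra_simps)
  qed
qed

lemma shifts_back: "shifts \<epsilon> x \<Longrightarrow> x (k - 1) = x k + sv \<or> x (k - 1) = x k - sv"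
  using shifts_step[of \<epsilon> x "k - 1"] by auto

lemma pack_II_wreath:
  assumes h: "shifts \<epsilon> x" and D: "D \<in> pack_II x"
  shows "\<exists>Fs. wreath D Fs \<and> set Fs \<subseteq> pack_II x"
proof -
  obtain t j k where t: "D = layer_disc x t j k" "t \<in> {0, 1, -1}" using D unfolding pack_II_layer by blast
  define u z where "u = x k + of_int j * (2 * qv)" and "z = of_int k * hv"
  note N = pack_II_near[OF h u_def z_def]
  have "t = 0 \<or> t = 1 \<or> t = -1" using t(2) by blast
  then show ?thesis
  proof (elim disjE)
    assume "t = 0"
    then have D: "D = big u z" using t(1) by (simp add: layer_disc_def u_def z_def)
    show ?thesis unfolding D
      by (rule exI, rule conjI, rule wreath_II_big[where up = "x (k + 1) = x k + sv" and dn = "x (k - 1) = x k + sv"])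
        (use N shifts_step[OF h, of k] shifts_back[OF h, of k] in auto)
  next
    assume "t = 1"
    then have D: "D = small (u + qv) (z + r)" using t(1) by (simp add: layer_disc_def u_def z_def algebra_simps)
    show ?thesis unfolding D
      by (rule exI, rule conjI, rule wreath_II_small(1)[where up = "x (k + 1) = x k + sv"])
        (use N shifts_step[OF h, of k] in \<open>auto simp: algebra_simps\<close>)
  next
    assume "t = -1"
    then have D: "D = small (u + qv) (z - r)" using t(1) by (simp add: layer_disc_def u_def z_def algebra_simps)
    show ?thesis unfolding D
      by (rule exI, rule conjI, rule wreath_II_small(2)[where dn = "x (k - 1) = x k + sv"])
        (use N shifts_back[OF h, of k] in \<open>auto simp: algebra_simps\<close>)
  qed
qed

lemma pack_II_radius: "radius ` pack_II x = {1, r}"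
proof -
  have "radius D \<in> {1, r}" if "D \<in> pack_II x" for D using that unfolding pack_II_def by auto
  moreover have "1 \<in> radius ` pack_II x" "r \<in> radius ` pack_II x"
    using pack_II_mem(1)[OF refl refl, of x 0 0] pack_II_mem(2)[OF refl refl, of x 0 0] by force+
  ultimately show ?thesis by blast
qed

lemma class_II_compact:
  assumes "Q \<in> class_II r" shows "compact_packing_using r Q"
proof -
  obtain \<epsilon> x where h: "shifts \<epsilon> x" "Q = pack_II x" using assms unfolding class_II_iff by blast
  show ?thesis unfolding h(2)
    by (rule compact_packing_usingI[OF pack_II_radius pack_II_apart[OF h(1)] pack_II_wreath[OF h(1)]])
qed

section \<open>Classification\<close>

lemma wreath_closed_eq:
  assumes cp: "compact_packing_using r P" and Q: "Q \<subseteq> P" "Q \<noteq> {}"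
    "\<And>D. D \<in> Q \<Longrightarrow> \<exists>Fs. wreath D Fs \<and> set Fs \<subseteq> Q"
  shows "Q = P"
  by (rule cp_subpacking_eq[OF cp_pack[OF cp] cp_radius[OF cp] Q])

lemma belongs_toI:
  assumes "plane_isometry f" "move f ` P \<in> C" shows "belongs_to P C"
proof -
  have "congruent_packings P (move f ` P)" using assms(1) unfolding congruent_packings_def by blast
  then show ?thesis using assms(2) congruent_packings_sym unfolding belongs_to_def by blast
qed

lemma compact_packing_classes:
  assumes cp: "compact_packing_using r P"
  shows "belongs_to P (class_I r) \<or> belongs_to P (class_II r)"
proof (cases "no_split P")
  case True
  obtain f where f: "plane_isometry f" "row (move f ` P) 0 0" "below (move f ` P) 1 0 0"
    using class_I_start[OF cp True] .
  note cp' = compact_packing_using_move[OF f(1) cp]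
  obtain \<delta> y where h: "heights \<delta> y" and sub: "pack_I \<delta> y \<subseteq> move f ` P"
    using class_I_layers[OF cp' f(2,3)] by blast
  have ne: "pack_I \<delta> y \<noteq> {}" using pack_I_mem(1)[OF refl refl, of 0 0 y \<delta>] by blast
  have eq: "pack_I \<delta> y = move f ` P" by (rule wreath_closed_eq[OF cp' sub ne pack_I_wreath[OF h]])
  have "r \<in> radius ` pack_I \<delta> y" using cp' unfolding eq compact_packing_using_def by simp
  then obtain D where D: "r = radius D" "D \<in> pack_I \<delta> y" by (rule imageE)
  from D(2) D(1) r_less have "\<exists>k. \<delta> k = 1" by (cases rule: pack_I_cases) auto
  then have "\<exists>k. \<delta> k \<noteq> 0" by (metis one_neq_zero)
  then have "move f ` P \<in> class_I r" unfolding eq[symmetric] class_I_iff using h by blast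
  from belongs_toI[OF f(1) this] show ?thesis ..
next
  case False
  obtain f where f: "plane_isometry f" "dconf (move f ` P) 0" using class_II_start[OF cp False] .
  note cp' = compact_packing_using_move[OF f(1) cp]
  obtain \<epsilon> x where h: "shifts \<epsilon> x" and sub: "pack_II x \<subseteq> move f ` P"
    using class_II_layers[OF cp' dconf_rows[OF cp' f(2)]] by blast
  have ne: "pack_II x \<noteq> {}" using pack_II_mem(1)[OF refl refl, of x 0 0] by blast
  have eq: "pack_II x = move f ` P" by (rule wreath_closed_eq[OF cp' sub ne pack_II_wreath[OF h]])
  then have "move f ` P \<in> class_II r" unfolding class_II_iff using h by blast
  from belongs_toI[OF f(1) this] show ?thesis ..
qed

lemma belongs_to_compact:
  assumes "belongs_to P (class_I r) \<or> belongs_to P (class_II r)"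
  shows "compact_packing_using r P"
proof -
  obtain Q where "Q \<in> class_I r \<or> Q \<in> class_II r" "congruent_packings Q P"
    using assms unfolding belongs_to_def by blast
  then show ?thesis using compact_packing_using_congruent class_I_compact class_II_compact by blast
qed

text \<open>Large discs in one row are at least \<open>2 * qv > 2\<close> apart, and rows with index
  difference at least two are at least \<open>2 * hv > 2\<close> apart.\<close>

lemma tangent_II_rows:
  assumes t: "tangent (layer_disc x 0 j k) (layer_disc x 0 i l)"
  shows "\<bar>k - l\<bar> = 1"
proof (rule ccontr)
  assume "\<bar>k - l\<bar> \<noteq> 1"
  then have "k = l \<or> 2 \<le> \<bar>l - k\<bar>" by linarith
  moreover have d: "(x l + of_int i * (2 * qv) - (x k + of_int j * (2 * qv)))\<^sup>2 + (of_int l * hv - of_int k * hv)\<^sup>2 = 2\<^sup>2"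
    (is "?a\<^sup>2 + ?b\<^sup>2 = _")
  proof -
    have "norm (centre (layer_disc x 0 i l) - centre (layer_disc x 0 j k)) = 2"
      using norm_tangent[OF t] by (simp add: layer_disc_simps)
    then have "sqrt (?a\<^sup>2 + ?b\<^sup>2) = 2" by (simp add: layer_disc_simps cmod_def)
    then show ?thesis by (metis abs_of_nonneg add_nonneg_nonneg real_sqrt_abs real_sqrt_eq_iff zero_le_numeral zero_le_power2)
  qed
  ultimately show False
  proof (elim disjE)
    assume kl: "k = l"
    then have a: "?a = of_int (i - j) * (2 * qv)" by (simp add: algebra_simps)
    have "(of_int (i - j) * (2 * qv))\<^sup>2 = 4" using d unfolding a by (simp add: kl)
    moreover have "(of_int (i - j) * (2 * qv))\<^sup>2 = 4 * (of_int ((i - j) * (i - j)) * (qv * qv))"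
    proof -
      have "(n * (2 * qv))\<^sup>2 = 4 * ((n * n) * (qv * qv))" for n :: real by (simp add: power2_eq_square)
      then show ?thesis by (simp only: of_int_mult)
    qed
    ultimately have e: "of_int ((i - j) * (i - j)) * (qv * qv) = 1" by simp
    have "i - j = 0 \<or> 1 \<le> (i - j) * (i - j)"
      by (metis int_one_le_iff_zero_less not_real_square_gt_zero zero_less_mult_iff linorder_neqE_linordered_idom mult_neg_neg mult_pos_pos)
    then show False
    proof
      assume "1 \<le> (i - j) * (i - j)"
      then have "(1::real) \<le> of_int ((i - j) * (i - j))" by linarith
      then have "1 * (qv * qv) \<le> of_int ((i - j) * (i - j)) * (qv * qv)" using qv_bounds by (intro mult_right_mono) auto
      then have "qv * qv \<le> 1" unfolding e by simp
      then show False using qv_eqs(1) r_pos by simp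
    qed (use e in simp)
  next
    assume "2 \<le> \<bar>l - k\<bar>"
    then have "2 \<le> \<bar>of_int (l - k) :: real\<bar>" by linarith
    then have "2 * hv \<le> \<bar>of_int (l - k)\<bar> * hv" using qv_bounds by (intro mult_right_mono) auto
    also have "\<dots> = \<bar>?b\<bar>" using qv_bounds by (simp add: abs_mult left_diff_distrib[symmetric])
    finally have "(2 * hv)\<^sup>2 \<le> \<bar>?b\<bar>\<^sup>2" using qv_bounds by (intro power_mono) auto
    then have "(2 * hv)\<^sup>2 \<le> ?b\<^sup>2" by (simp only: power2_abs)
    moreover have "2\<^sup>2 < (2 * hv)\<^sup>2" using qv_bounds by (intro power_strict_mono) auto
    moreover have "0 \<le> ?a\<^sup>2" by simp
    ultimately show False using d by linarith
  qed
qed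

text \<open>Three row indices cannot pairwise differ by exactly one, by parity.\<close>

lemma no_big_triangle_II:
  assumes "D \<in> pack_II x" "E \<in> pack_II x" "F \<in> pack_II x" "tri D E F"
    "radius D = 1" "radius E = 1" "radius F = 1"
  shows False
proof -
  have big: "\<exists>j k. G = layer_disc x 0 j k" if "G \<in> pack_II x" "radius G = 1" for G
    using that r_less unfolding pack_II_def by (auto simp: layer_disc_simps)
  obtain i1 k1 i2 k2 i3 k3 where "D = layer_disc x 0 i1 k1" "E = layer_disc x 0 i2 k2" "F = layer_disc x 0 i3 k3"
    using big assms by metis
  then have "\<bar>k1 - k2\<bar> = 1" "\<bar>k2 - k3\<bar> = 1" "\<bar>k3 - k1\<bar> = 1"
    using assms(4) tangent_II_rows unfolding tri_def by blast+
  then show False by presburger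
qed

section \<open>The packing common to both classes\<close>

definition common_pack :: "disc set" where
  "common_pack = pack_I (\<lambda>_. 1) (\<lambda>k. of_int k * (1 + r + av))"

lemma common_heights: "heights (\<lambda>_. 1) (\<lambda>k. of_int k * (1 + r + av))"
  by (simp add: heights_def layer_height_av algebra_simps)

lemma common_class_I: "common_pack \<in> class_I r"
  unfolding class_I_iff common_pack_def using common_heights by blast

text \<open>
  The reflection \<open>f\<close> below turns the rows of touching large discs of the first class into the
  chains of touching large discs that run across the layers of the second class.
\<close>

lemma common_class_II: "belongs_to common_pack (class_II r)"
proof -
  \<comment> \<open>The unit vector along the chain of touching large discs from a row of Class II
    to the next; \<open>f\<close> sends the positive real direction to it.\<close>
  define w where "w = Complex (sv / 2) (hv / 2)"
  define f where "f = (\<lambda>z. w * cnj z + 0)"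
  define Q where "Q = pack_II (\<lambda>k. of_int k * sv)"
  have "norm w = 1" using qv_eqs(5) by (simp add: w_def cmod_def power2_eq_square)
  then have f: "plane_isometry f" unfolding f_def by (rule plane_isometry_affine(2))
  have fC: "f (Complex a b) = Complex ((sv * a + hv * b) / 2) ((hv * a - sv * b) / 2)" for a b
    by (simp add: f_def w_def complex_eq_iff algebra_simps add_divide_distrib diff_divide_distrib)
  have sh: "shifts (\<lambda>_. 1) (\<lambda>k. of_int k * sv)" by (simp add: shifts_def algebra_simps)
  have QC: "Q \<in> class_II r" unfolding Q_def class_II_iff using sh by blast
  have e: "hv + hv * r = 2 * qv" "sv * r = 2 * r - sv" "qv * hv = 1 + r + av"
    using qv_eqs r_pos by (simp_all add: qv_def hv_def field_simps)
  have "hv * (qv * hv) = qv * (hv * hv)" by (simp add: mult_ac)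
  also have "hv * hv = 4 - sv * sv" using qv_eqs(5) by simp
  also have "qv * (4 - sv * sv) = 4 * qv - (qv * sv) * sv" by (simp add: algebra_simps)
  also have "\<dots> = 4 * qv - sv" by (simp add: qv_eqs(2))
  finally have hh: "hv * (1 + r + av) = 4 * qv - sv" by (simp only: e(3))
  have "sv * (qv * hv) = (qv * sv) * hv" by (simp add: mult_ac)
  then have ss: "sv * (1 + r + av) = hv" unfolding e(3) qv_eqs(2) by simp
  \<comment> \<open>Under \<open>f\<close> the index along a row and the index of the row are
    exchanged: \<open>j\<close> becomes the layer and \<open>k\<close> the position in it.\<close>
  have lin: "sv * (2 * j + k) + hv * (k * (1 + r + av)) = 2 * (j * sv + k * (2 * qv))"
    "hv * (2 * j + k) - sv * (k * (1 + r + av)) = 2 * (j * hv)" for j k :: real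
  proof -
    have "hv * (k * (1 + r + av)) = k * (4 * qv - sv)" "sv * (k * (1 + r + av)) = k * hv"
      using hh ss by (metis mult.left_commute)+
    then show "sv * (2 * j + k) + hv * (k * (1 + r + av)) = 2 * (j * sv + k * (2 * qv))"
      "hv * (2 * j + k) - sv * (k * (1 + r + av)) = 2 * (j * hv)" by (simp_all add: algebra_simps)
  qed
  have av2: "hv * av = 2 * qv - sv" "sv * av = hv - 2 * r" using hh ss e by (simp_all add: algebra_simps)
  have "move f ` common_pack \<subseteq> Q"
  proof
    fix E assume "E \<in> move f ` common_pack"
    then obtain D where D: "E = move f D" "D \<in> common_pack" by (rule imageE)
    from D(2)[unfolded common_pack_def] show "E \<in> Q"
    proof (cases rule: pack_I_cases)
      case (big j k)
      show ?thesis unfolding D(1) big fst_conv snd_conv fC Q_def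
        by (rule pack_II_mem(1)[of _ _ j k]) (use lin[of "of_int j" "of_int k"] in simp_all)
    next
      case (A j k)
      show ?thesis unfolding D(1) A fst_conv snd_conv fC Q_def
        by (rule pack_II_mem(3)[of _ _ j k])
          (use lin[of "of_int j" "of_int k"] e(1,2) in \<open>simp_all add: algebra_simps diff_divide_distrib\<close>)
    next
      case (B j k)
      show ?thesis unfolding D(1) B fst_conv snd_conv fC Q_def
        by (rule pack_II_mem(2)[of _ _ j k])
          (use lin[of "of_int j" "of_int k"] av2 in \<open>simp_all add: algebra_simps\<close>)
    qed
  qed
  \<comment> \<open>Only an inclusion has been checked. Since the image is itself compact,
    connectedness turns it into equality.\<close>
  moreover have "compact_packing_using r (move f ` common_pack)"
    by (rule compact_packing_using_move[OF f class_I_compact[OF common_class_I]])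
  then have "\<exists>Fs. wreath D Fs \<and> set Fs \<subseteq> move f ` common_pack" if "D \<in> move f ` common_pack" for D
    using cp_corona[OF _ that] by (auto simp: corona_wreath)
  moreover have "move f ` common_pack \<noteq> {}"
    using pack_I_mem(1)[OF refl refl, of 0 0] unfolding common_pack_def by blast
  ultimately have "move f ` common_pack = Q"
    using wreath_closed_eq[OF class_II_compact[OF QC]] by blast
  then show ?thesis using belongs_toI[OF f] QC by simp
qed

lemma heights_all_one:
  assumes h: "heights \<delta> y" and d: "\<And>k. \<delta> k = 1"
  shows "pack_I \<delta> y = common_pack"
proof -
  have "y k = of_int k * (1 + r + av)" for k
  proof (induction k rule: int_induct[where k = 0])
    case base
    then show ?case using h by (simp add: heights_def)
  next
    case (step1 i)
    then show ?case using heights_step(1)[OF h, of i] d by (simp add: algebra_simps)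
  next
    case (step2 i)
    then show ?case using heights_step(1)[OF h, of "i - 1"] d by (simp add: algebra_simps)
  qed
  then show ?thesis using d by (simp add: common_pack_def pack_I_def)
qed

text \<open>A gap without small discs puts three mutually tangent large discs into the Class I
  packing; an isometry would carry them into a Class II packing. So every gap holds small discs,
  which leaves \<open>common_pack\<close>.\<close>

lemma both_classes:
  assumes "belongs_to Q (class_I r)" "belongs_to Q (class_II r)"
  shows "congruent_packings common_pack Q"
proof -
  obtain \<delta> y where h: "heights \<delta> y" and I: "congruent_packings (pack_I \<delta> y) Q"
    using assms(1) unfolding belongs_to_def by (metis class_I_iff)
  obtain x where II: "congruent_packings (pack_II x) Q"
    using assms(2) unfolding belongs_to_def by (metis class_II_iff)
  have "congruent_packings (pack_I \<delta> y) (pack_II x)"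
    using congruent_packings_trans[OF I congruent_packings_sym[OF II]] .
  then obtain f where f: "plane_isometry f" "pack_II x = move f ` pack_I \<delta> y"
    unfolding congruent_packings_def by blast
  have "\<delta> k = 1" for k
  proof (rule ccontr)
    assume "\<delta> k \<noteq> 1"
    then have d: "\<delta> k = 0" using heights_step(2)[OF h, of k] by simp
    define A B C where "A = big (of_int k) (y k)" and "B = big (of_int k + 2) (y k)"
      and "C = big (of_int k + 1) (y k + sqrt 3)"
    have t: "tri A B C" unfolding A_def B_def C_def by (rule tri_I(1)) simp_all
    have "A \<in> pack_I \<delta> y" "B \<in> pack_I \<delta> y" "C \<in> pack_I \<delta> y"
      unfolding A_def B_def C_def
      by (rule pack_I_mem(1)[of _ 0 k], simp_all)
         (rule pack_I_mem(1)[of _ 1 k], simp_all, rule pack_I_mem(1)[of _ 0 "k + 1"],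
           simp_all add: heights_step(1)[OF h, of k] d)
    moreover have mv: "move f D \<in> pack_II x" if "D \<in> pack_I \<delta> y" for D
      using that unfolding f(2) by (rule imageI)
    ultimately have m: "move f A \<in> pack_II x" "move f B \<in> pack_II x" "move f C \<in> pack_II x" by simp_all
    have r: "radius (move f A) = 1" "radius (move f B) = 1" "radius (move f C) = 1"
      by (simp_all add: A_def B_def C_def)
    from tri_move[OF f(1)] show False
    proof
      assume "\<forall>D E F. tri (move f D) (move f E) (move f F) \<longleftrightarrow> tri D E F"
      then have "tri (move f A) (move f B) (move f C)" using t by blast
      then show False using no_big_triangle_II[OF m _ r] by blast
    next
      assume "\<forall>D E F. tri (move f D) (move f E) (move f F) \<longleftrightarrow> tri D F E"
      then have "tri (move f A) (move f C) (move f B)" using t by blast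
      then show False using no_big_triangle_II[OF m(1,3,2) _ r(1,3,2)] by blast
    qed
  qed
  then show ?thesis using I heights_all_one[OF h] by simp
qed

end

theorem mainTheorem10:
  fixes r :: real
  assumes "0 < r" and "r < 1" and "8 * r ^ 3 + 3 * r\<^sup>2 - 2 * r - 1 = 0"
  shows "(\<forall>P. compact_packing_using r P \<longleftrightarrow>
              belongs_to P (class_I r) \<or> belongs_to P (class_II r)) \<and>
         (\<exists>P. belongs_to P (class_I r) \<and> belongs_to P (class_II r) \<and>
              (\<forall>Q. belongs_to Q (class_I r) \<and> belongs_to Q (class_II r)
                     \<longrightarrow> congruent_packings P Q))"
proof -
  interpret radius_root r using assms by unfold_locales
  have "belongs_to common_pack (class_I r)"
    using common_class_I congruent_packings_refl unfolding belongs_to_def by blast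
  then show ?thesis
    using compact_packing_classes belongs_to_compact common_class_II both_classes by blast
qed

end
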